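(* Let $n=2m$ be even, let $D_n=G(2,2,n)$ and $B_n=G(2,n)$, and let $c^1$ be the set of antisymmetric involutions in $B_n/\{\pm I\}$ (these form a single $S_n$-conjugacy class). Then, as $D_n$-modules, $$M(c^1)\cong\bigoplus_{\mu\vdash m}\rho^1_{[\mu,\mu]}.$$
   Context: $B_n=G(2,n)$ is the group of $n\times n$ signed permutation matrices; for $g\in B_n$ write $g=[\sigma_1^{z_1},\dots,\sigma_n^{z_n}]$ if the nonzero entry of row $j$ is in column $\sigma_j$ and equals $(-1)^{z_j}$; $z_j(g)=z_j\in\mathbb{Z}_2$, $z(g)=\sum z_j(g)$, $|g|=[\sigma_1,\dots,\sigma_n]\in S_n$. $D_n=\{g\in B_n:z(g)=0\}$. An element $v\in B_n/\{\pm I\}$ is antisymmetric if its lifts $\tilde v$ satisfy $\tilde v^T=-\tilde v$. $M(c^1)=\bigoplus_{v\in c^1}\mathbb{C}C_v$ with $D_n$-action $\varrho(g)C_v=(-1)^{\langle g,v\rangle}(-1)^{a(g,v)}C_{|g|v|g|^{-1}}$, where for a lift $\tilde v$, $\langle g,v\rangle=\sum_iz_i(g)z_i(\tilde v)$ and $a(g,v)=z_1(\tilde v)-z_{|g|^{-1}(1)}(\tilde v)$ (mod 2). Representations. For partitions $\lambda,\mu$ with $|\lambda|+|\mu|=n$, $\rho_{(\lambda,\mu)}=\mathrm{Ind}^{B_n}_{B_{|\lambda|}\times B_{|\mu|}}(\tilde\rho_\lambda\odot(\gamma\otimes\tilde\rho_\mu))$ with $\gamma(g)=(-1)^{z(g)}$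 and $\tilde\rho_\lambda(g)=\rho_\lambda(|g|)$ (Specht modules). For $\mu\vdash m$, the restriction of $\rho_{(\mu,\mu)}$ to $D_n$ is the sum of two non-isomorphic irreducibles $\rho^0_{[\mu,\mu]},\rho^1_{[\mu,\mu]}$ labelled as follows: let $\delta(g)=(-1)^{z(g)}$, $(V,\rho_\mu)$ a realization of $\rho_{(\mu,\emptyset)}$ of $B_m$; $\Theta$ the permutations $t=[t_1,\dots,t_n]$ with $t_1<\dots<t_m$, $t_{m+1}<\dots<t_n$, $\hat t=[t_{m+1},\dots,t_n,t_1,\dots,t_m]$; for $x\in B_n$ write uniquely $xt=t'\,\mathrm{diag}(x_1,x_2)$, $t'\in\Theta$, $x_i\in B_m$; $\rho_{(\mu,\mu)}$ is realized on $T\otimes V\otimes V$ ($T$ with basis $\Theta$) by $x(t\otimes v_1\otimes v_2)=\delta(x_2)t'\otimes\rho_\mu(x_1)v_1\otimes\rho_\mu(x_2)v_2$; the map $S(t\otimes v_1\otimes v_2)=\hat t\otimes v_2\otimes v_1$ commutes with $D_n$, and $\rho^0_{[\mu,\mu]}$ (resp. $\rho^1_{[\mu,\mu]}$) is the $D_n$-representation on its $+1$ (resp. $-1$) eigenspace. *)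

theory Defs
  imports
    "Jordan_Normal_Form.Matrix"
    "HOL-Algebra.Coset"
    "HOL-Combinatorics.Permutations"
    "HOL-Library.Function_Algebras"
    "HOL-Library.Z2"
begin

text \<open>Indices are 0-based throughout: positions \<open>1, \<dots>, n\<close> become \<open>0, \<dots>, n - 1\<close>.
  The type \<^typ>\<open>bit\<close> is the field with two elements.\<close>

section \<open>Complex representations on spaces of functions\<close>

definition fscale :: "complex \<Rightarrow> ('i \<Rightarrow> complex) \<Rightarrow> 'i \<Rightarrow> complex" where
  "fscale c f = (\<lambda>i. c * f i)"

interpretation cfun: vector_space "fscale :: complex \<Rightarrow> ('i \<Rightarrow> complex) \<Rightarrow> 'i \<Rightarrow> complex"
  by unfold_locales (auto simp: fscale_def fun_eq_iff algebra_simps)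

text \<open>\<^term>\<open>ebasis i\<close> is the basis vector with label \<open>i\<close>.\<close>

definition ebasis :: "'i \<Rightarrow> 'i \<Rightarrow> complex" where
  "ebasis i = (\<lambda>j. if j = i then 1 else 0)"

text \<open>For finite \<open>I\<close>, the linear map on functions supported on \<open>I\<close> that sends the basis vector
  \<open>ebasis i\<close> to \<open>\<phi> i\<close>.\<close>

definition lin_ext :: "'i set \<Rightarrow> ('i \<Rightarrow> 'j \<Rightarrow> complex) \<Rightarrow> ('i \<Rightarrow> complex) \<Rightarrow> 'j \<Rightarrow> complex" where
  "lin_ext I \<phi> f = (\<Sum>i\<in>I. fscale (f i) (\<phi> i))"

lemma lin_ext_apply: "lin_ext I \<phi> f j = (\<Sum>i\<in>I. f i * \<phi> i j)"
  unfolding lin_ext_def by (induction I rule: infinite_finite_induct) (auto simp: fscale_def)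

lemma lin_ext_unit: "finite I \<Longrightarrow> i \<in> I \<Longrightarrow> lin_ext I \<phi> (ebasis i) = \<phi> i"
  by (rule ext) (simp add: lin_ext_apply ebasis_def if_distrib[of "\<lambda>x. x * _"] cong: if_cong)

definition linear_map_on ::
    "('i \<Rightarrow> complex) set \<Rightarrow> (('i \<Rightarrow> complex) \<Rightarrow> 'j \<Rightarrow> complex) \<Rightarrow> bool" where
  "linear_map_on V \<phi> \<longleftrightarrow> (\<forall>f\<in>V. \<forall>g\<in>V. \<phi> (f + g) = \<phi> f + \<phi> g) \<and>
     (\<forall>c. \<forall>f\<in>V. \<phi> (fscale c f) = fscale c (\<phi> f))"

record ('g, 'i) rep =
  rep_space :: "('i \<Rightarrow> complex) set"
  rep_act :: "'g \<Rightarrow> ('i \<Rightarrow> complex) \<Rightarrow> 'i \<Rightarrow> complex"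

definition is_rep :: "('g, 'm) monoid_scheme \<Rightarrow> ('g, 'i) rep \<Rightarrow> bool" where
  "is_rep G R \<longleftrightarrow> group G \<and> cfun.subspace (rep_space R) \<and>
     (\<forall>g\<in>carrier G. rep_act R g ` rep_space R \<subseteq> rep_space R \<and>
       linear_map_on (rep_space R) (rep_act R g)) \<and>
     (\<forall>f\<in>rep_space R. rep_act R \<one>\<^bsub>G\<^esub> f = f) \<and>
     (\<forall>g\<in>carrier G. \<forall>h\<in>carrier G. \<forall>f\<in>rep_space R.
       rep_act R (g \<otimes>\<^bsub>G\<^esub> h) f = rep_act R g (rep_act R h f))"

definition rep_iso ::
    "('g, 'm) monoid_scheme \<Rightarrow> ('g, 'i) rep \<Rightarrow> ('g, 'j) rep \<Rightarrow> bool" where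
  "rep_iso G R R' \<longleftrightarrow> is_rep G R \<and> is_rep G R' \<and>
     (\<exists>\<phi>. bij_betw \<phi> (rep_space R) (rep_space R') \<and> linear_map_on (rep_space R) \<phi> \<and>
       (\<forall>g\<in>carrier G. \<forall>f\<in>rep_space R. \<phi> (rep_act R g f) = rep_act R' g (\<phi> f)))"

text \<open>External direct sum of a family indexed by a finite set \<open>K\<close>.\<close>

definition rep_sum :: "'k set \<Rightarrow> ('k \<Rightarrow> ('g, 'i) rep) \<Rightarrow> ('g, 'k \<times> 'i) rep" where
  "rep_sum K R = \<lparr>
     rep_space = {F. (\<forall>k\<in>K. (\<lambda>i. F (k, i)) \<in> rep_space (R k)) \<and>
       (\<forall>k i. k \<notin> K \<longrightarrow> F (k, i) = 0)},
     rep_act = (\<lambda>g F. \<lambda>(k, i). if k \<in> K then rep_act (R k) g (\<lambda>i. F (k, i)) i else 0)\<rparr>"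


section \<open>Signed permutation matrices\<close>

text \<open>\<open>perm_of g\<close> is \<open>j \<mapsto> \<sigma>\<^sub>j\<close> (extended by the identity) and \<open>colour g j\<close> is \<open>z\<^sub>j(g)\<close>.
  \<open>perm_mat n \<sigma>\<close> is the element \<open>[\<sigma>\<^sub>1, \<dots>, \<sigma>\<^sub>n]\<close> of \<open>S\<^sub>n\<close>, seen in \<open>B\<^sub>n\<close>.\<close>

definition perm_of :: "int mat \<Rightarrow> nat \<Rightarrow> nat" where
  "perm_of g j = (if j < dim_row g then (THE k. k < dim_col g \<and> g $$ (j, k) \<noteq> 0) else j)"

definition colour :: "int mat \<Rightarrow> nat \<Rightarrow> bit" where
  "colour g j = (if j < dim_row g \<and> g $$ (j, perm_of g j) = -1 then 1 else 0)"

definition total_colour :: "int mat \<Rightarrow> bit" where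
  "total_colour g = (\<Sum>j<dim_row g. colour g j)"

definition sgn_bit :: "bit \<Rightarrow> complex" where
  "sgn_bit b = (if b = 0 then 1 else -1)"

definition abs_mat :: "int mat \<Rightarrow> int mat" where
  "abs_mat g = map_mat abs g"

definition perm_mat :: "nat \<Rightarrow> (nat \<Rightarrow> nat) \<Rightarrow> int mat" where
  "perm_mat n \<sigma> = mat n n (\<lambda>(j, k). if k = \<sigma> j then 1 else 0)"

text \<open>Products of signed permutations \<open>g = [\<sigma>\<^sub>1^z\<^sub>1, \<dots>, \<sigma>\<^sub>n^z\<^sub>n]\<close> are products of permutations in the
  usual sense, i.e. compositions of maps, \<open>|g h|(j) = |g|(|h|(j))\<close>. Since row \<open>j\<close> of the matrix
  records the image of \<open>j\<close>, the group law is matrix multiplication in reversed order. With the other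
  order the decomposition \<open>x t = t' diag(x\<^sub>1, x\<^sub>2)\<close> below would not be unique and the action on
  \<open>M(c\<^sup>1)\<close> would not be multiplicative. \<open>Bgrp n\<close>, \<open>Dgrp n\<close> and \<open>perm_mats n\<close> are \<open>B\<^sub>n\<close>, \<open>D\<^sub>n\<close> and
  \<open>S\<^sub>n\<close>; \<open>PBgrp n\<close> below is \<open>B\<^sub>n/{\<plusminus>I}\<close>.\<close>

definition Bgrp :: "nat \<Rightarrow> int mat monoid" where
  "Bgrp n = \<lparr>carrier = {g \<in> carrier_mat n n.
       (\<forall>j<n. \<forall>k<n. g $$ (j, k) \<in> {-1, 0, 1}) \<and>
       (\<forall>j<n. \<exists>!k. k < n \<and> g $$ (j, k) \<noteq> 0) \<and>
       (\<forall>k<n. \<exists>!j. j < n \<and> g $$ (j, k) \<noteq> 0)},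
     mult = (\<lambda>g h. h * g), one = 1\<^sub>m n\<rparr>"

definition Dgrp :: "nat \<Rightarrow> int mat monoid" where
  "Dgrp n = (Bgrp n)\<lparr>carrier := {g \<in> carrier (Bgrp n). total_colour g = 0}\<rparr>"

definition perm_mats :: "nat \<Rightarrow> int mat set" where
  "perm_mats n = {g \<in> carrier (Bgrp n). abs_mat g = g}"

definition diag2 :: "nat \<Rightarrow> int mat \<Rightarrow> int mat \<Rightarrow> int mat" where
  "diag2 m x y = four_block_mat x (0\<^sub>m m m) (0\<^sub>m m m) y"


section \<open>The module of antisymmetric involutions\<close>

definition PBgrp :: "nat \<Rightarrow> int mat set monoid" where
  "PBgrp n = Bgrp n Mod {1\<^sub>m n, - 1\<^sub>m n}"

definition antisymmetric :: "int mat set \<Rightarrow> bool" where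
  "antisymmetric v \<longleftrightarrow> (\<forall>w\<in>v. transpose_mat w = - w)"

definition c1 :: "nat \<Rightarrow> int mat set set" where
  "c1 n = {v \<in> carrier (PBgrp n). v \<otimes>\<^bsub>PBgrp n\<^esub> v = \<one>\<^bsub>PBgrp n\<^esub> \<and> antisymmetric v}"

text \<open>Elements of \<^term>\<open>PBgrp n\<close> are cosets \<open>{w, - w}\<close>; conjugation acts on them elementwise.\<close>

definition conj_coset :: "nat \<Rightarrow> int mat \<Rightarrow> int mat set \<Rightarrow> int mat set" where
  "conj_coset n h v = (\<lambda>w. h \<otimes>\<^bsub>Bgrp n\<^esub> w \<otimes>\<^bsub>Bgrp n\<^esub> inv\<^bsub>Bgrp n\<^esub> h) ` v"

definition lift_of :: "int mat set \<Rightarrow> int mat" where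
  "lift_of v = (SOME w. w \<in> v)"

text \<open>For \<open>g \<in> D\<^sub>n\<close> and antisymmetric \<open>v\<close>, neither bit depends on the lift: passing from \<open>w\<close> to
  \<open>- w\<close> adds \<open>z(g) = 0\<close> to the first and \<open>1 - 1 = 0\<close> to the second.\<close>

definition pairing :: "nat \<Rightarrow> int mat \<Rightarrow> int mat set \<Rightarrow> bit" where
  "pairing n g v = (\<Sum>i<n. colour g i * colour (lift_of v) i)"

definition a_bit :: "nat \<Rightarrow> int mat \<Rightarrow> int mat set \<Rightarrow> bit" where
  "a_bit n g v = colour (lift_of v) 0 - colour (lift_of v) (perm_of (inv\<^bsub>Bgrp n\<^esub> (abs_mat g)) 0)"

definition M_c1 :: "nat \<Rightarrow> (int mat, int mat set) rep" where
  "M_c1 n = \<lparr>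
     rep_space = cfun.span (ebasis ` c1 n),
     rep_act = (\<lambda>g. lin_ext (c1 n)
       (\<lambda>v. fscale (sgn_bit (pairing n g v) * sgn_bit (a_bit n g v))
         (ebasis (conj_coset n (abs_mat g) v))))\<rparr>"


section \<open>Specht modules\<close>

definition int_partitions :: "nat \<Rightarrow> nat list set" where
  "int_partitions m = {\<mu>. sorted_wrt (\<ge>) \<mu> \<and> 0 \<notin> set \<mu> \<and> sum_list \<mu> = m}"

definition young_cells :: "nat list \<Rightarrow> (nat \<times> nat) set" where
  "young_cells \<mu> = {(i, j). i < length \<mu> \<and> j < \<mu> ! i}"

text \<open>Tableaux are bijective fillings of the cells \<open>(row, column)\<close>; values outside
  \<^term>\<open>young_cells \<mu>\<close> are irrelevant.\<close>

definition tableaux :: "nat list \<Rightarrow> (nat \<times> nat \<Rightarrow> nat) set" where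
  "tableaux \<mu> = {T. bij_betw T (young_cells \<mu>) {..<sum_list \<mu>}}"

text \<open>A tabloid (a tableau up to permuting the entries within rows) is the list of the sets of
  entries of its rows.\<close>

definition tabloid_of :: "nat list \<Rightarrow> (nat \<times> nat \<Rightarrow> nat) \<Rightarrow> nat set list" where
  "tabloid_of \<mu> T = map (\<lambda>i. T ` {(i, j) | j. j < \<mu> ! i}) [0..<length \<mu>]"

definition tabloids :: "nat list \<Rightarrow> nat set list set" where
  "tabloids \<mu> = tabloid_of \<mu> ` tableaux \<mu>"

definition column_stabilizer :: "nat list \<Rightarrow> (nat \<times> nat \<Rightarrow> nat) \<Rightarrow> (nat \<Rightarrow> nat) set" where
  "column_stabilizer \<mu> T = {\<pi>. \<pi> permutes {..<sum_list \<mu>} \<and>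
     (\<forall>j. \<pi> ` T ` {(i, j') \<in> young_cells \<mu>. j' = j} = T ` {(i, j') \<in> young_cells \<mu>. j' = j})}"

definition polytabloid :: "nat list \<Rightarrow> (nat \<times> nat \<Rightarrow> nat) \<Rightarrow> nat set list \<Rightarrow> complex" where
  "polytabloid \<mu> T =
     (\<Sum>\<pi>\<in>column_stabilizer \<mu> T. fscale (of_int (sign \<pi>)) (ebasis (tabloid_of \<mu> (\<pi> \<circ> T))))"

text \<open>The Specht module of \<open>\<mu> \<turnstile> m\<close>, inside the permutation module on tabloids, with \<open>B\<^sub>m\<close> acting
  through \<open>g \<mapsto> |g|\<close>; this is \<open>\<rho>\<^bsub>(\<mu>,\<emptyset>)\<^esub>\<close>.\<close>

definition specht :: "nat list \<Rightarrow> (int mat, nat set list) rep" where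
  "specht \<mu> = \<lparr>
     rep_space = cfun.span (polytabloid \<mu> ` tableaux \<mu>),
     rep_act = (\<lambda>g. lin_ext (tabloids \<mu>) (\<lambda>X. ebasis (map (\<lambda>R. perm_of g ` R) X)))\<rparr>"


section \<open>The constituents of \<open>\<rho>\<^bsub>(\<mu>,\<mu>)\<^esub>\<close> on \<open>D\<^sub>2\<^sub>m\<close>\<close>

definition Theta :: "nat \<Rightarrow> int mat set" where
  "Theta m = {t \<in> perm_mats (2 * m). strict_mono_on {..<m} (perm_of t) \<and>
     strict_mono_on {m..<2 * m} (perm_of t)}"

definition hat_perm :: "nat \<Rightarrow> int mat \<Rightarrow> int mat" where
  "hat_perm m t = perm_mat (2 * m) (\<lambda>j. if j < m then perm_of t (j + m) else perm_of t (j - m))"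

text \<open>The unique \<open>(t', x\<^sub>1, x\<^sub>2)\<close> with \<open>x t = t' diag(x\<^sub>1, x\<^sub>2)\<close>.\<close>

definition decomp :: "nat \<Rightarrow> int mat \<Rightarrow> int mat \<Rightarrow> int mat \<times> int mat \<times> int mat" where
  "decomp m x t = (THE (t', x1, x2). t' \<in> Theta m \<and>
     x1 \<in> carrier (Bgrp m) \<and> x2 \<in> carrier (Bgrp m) \<and>
     x \<otimes>\<^bsub>Bgrp (2 * m)\<^esub> t = t' \<otimes>\<^bsub>Bgrp (2 * m)\<^esub> diag2 m x1 x2)"

text \<open>\<open>tensor t v w\<close> is the pure tensor \<open>t \<otimes> v \<otimes> w\<close>, as a function of three basis labels.\<close>

definition tensor ::
    "'t \<Rightarrow> ('i \<Rightarrow> complex) \<Rightarrow> ('i \<Rightarrow> complex) \<Rightarrow> 't \<times> 'i \<times> 'i \<Rightarrow> complex" where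
  "tensor t v w = (\<lambda>(s, a, b). ebasis t s * v a * w b)"

text \<open>The operators below are given on the basis of \<open>T \<otimes> M \<otimes> M\<close>, where \<open>M\<close> is the permutation
  module on tabloids containing the Specht module \<open>V\<close>; lemmas \<open>TVV_act_tensor\<close> and
  \<open>TVV_swap_tensor\<close> give their values on pure tensors.\<close>

definition TVV_labels :: "nat \<Rightarrow> nat list \<Rightarrow> (int mat \<times> nat set list \<times> nat set list) set" where
  "TVV_labels m \<mu> = Theta m \<times> tabloids \<mu> \<times> tabloids \<mu>"

definition TVV :: "nat \<Rightarrow> nat list \<Rightarrow> (int mat, int mat \<times> nat set list \<times> nat set list) rep" where
  "TVV m \<mu> = \<lparr>
     rep_space = cfun.span {tensor t v w | t v w.
       t \<in> Theta m \<and> v \<in> rep_space (specht \<mu>) \<and> w \<in> rep_space (specht \<mu>)},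
     rep_act = (\<lambda>x. lin_ext (TVV_labels m \<mu>) (\<lambda>(t, a, b).
       case decomp m x t of (t', x1, x2) \<Rightarrow>
         fscale (sgn_bit (total_colour x2))
           (tensor t' (rep_act (specht \<mu>) x1 (ebasis a)) (rep_act (specht \<mu>) x2 (ebasis b)))))\<rparr>"

definition TVV_swap :: "nat \<Rightarrow> nat list \<Rightarrow>
    (int mat \<times> nat set list \<times> nat set list \<Rightarrow> complex) \<Rightarrow>
    int mat \<times> nat set list \<times> nat set list \<Rightarrow> complex" where
  "TVV_swap m \<mu> = lin_ext (TVV_labels m \<mu>) (\<lambda>(t, a, b). tensor (hat_perm m t) (ebasis b) (ebasis a))"

text \<open>\<open>rho_split m \<mu> \<epsilon>\<close> is \<open>\<rho>\<^sup>\<epsilon>\<^bsub>[\<mu>,\<mu>]\<^esub>\<close>, on the \<open>(-1)^\<epsilon>\<close>-eigenspace of \<open>S\<close>.\<close>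

definition rho_split :: "nat \<Rightarrow> nat list \<Rightarrow> bit \<Rightarrow>
    (int mat, int mat \<times> nat set list \<times> nat set list) rep" where
  "rho_split m \<mu> \<epsilon> = \<lparr>
     rep_space = {F \<in> rep_space (TVV m \<mu>). TVV_swap m \<mu> F = fscale (sgn_bit \<epsilon>) F},
     rep_act = rep_act (TVV m \<mu>)\<rparr>"


subsection \<open>Values on pure tensors\<close>

lemma finite_tabloids: "finite (tabloids \<mu>)"
proof (rule finite_subset)
  show "tabloids \<mu> \<subseteq> {X. set X \<subseteq> Pow {..<sum_list \<mu>} \<and> length X = length \<mu>}"
    by (fastforce simp: tabloids_def tabloid_of_def tableaux_def young_cells_def bij_betw_def)
qed (simp add: finite_lists_length_eq)

lemma finite_Theta: "finite (Theta m)"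
proof (rule finite_subset)
  let ?S = "{..<2 * m} \<times> {..<2 * m}"
  show "Theta m \<subseteq> (\<lambda>f. mat (2 * m) (2 * m) f) ` (?S \<rightarrow>\<^sub>E {-1, 0, 1})"
  proof
    fix t assume "t \<in> Theta m"
    then have t: "t \<in> carrier_mat (2 * m) (2 * m)"
      and e: "\<And>j k. j < 2 * m \<Longrightarrow> k < 2 * m \<Longrightarrow> t $$ (j, k) \<in> {-1, 0, 1}"
      unfolding Theta_def perm_mats_def Bgrp_def by auto
    let ?f = "restrict (\<lambda>p. t $$ p) ?S"
    have "t = mat (2 * m) (2 * m) ?f" using t by auto
    moreover have "?f \<in> ?S \<rightarrow>\<^sub>E {-1, 0, 1}" using e by (auto simp del: insert_iff)
    ultimately show "t \<in> (\<lambda>f. mat (2 * m) (2 * m) f) ` (?S \<rightarrow>\<^sub>E {-1, 0, 1})" by blast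
  qed
  show "finite ((\<lambda>f. mat (2 * m) (2 * m) f) ` (?S \<rightarrow>\<^sub>E {-1, 0, 1 :: int}))"
    by (intro finite_imageI finite_PiE) auto
qed

lemma lin_ext_tensor:
  assumes "t \<in> Theta m"
  shows "lin_ext (TVV_labels m \<mu>) \<phi> (tensor t v w) p =
    (\<Sum>a\<in>tabloids \<mu>. \<Sum>b\<in>tabloids \<mu>. v a * w b * \<phi> (t, a, b) p)"
proof -
  have "lin_ext (TVV_labels m \<mu>) \<phi> (tensor t v w) p =
    (\<Sum>s\<in>Theta m. \<Sum>a\<in>tabloids \<mu>. \<Sum>b\<in>tabloids \<mu>. tensor t v w (s, a, b) * \<phi> (s, a, b) p)"
    by (simp add: lin_ext_apply TVV_labels_def sum.cartesian_product)
  also have "\<dots> = (\<Sum>s\<in>Theta m. if s = t then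
      \<Sum>a\<in>tabloids \<mu>. \<Sum>b\<in>tabloids \<mu>. v a * w b * \<phi> (t, a, b) p else 0)"
    by (rule sum.cong) (auto simp: tensor_def ebasis_def)
  finally show ?thesis using assms by (simp add: finite_Theta)
qed

lemma specht_act_apply:
  "rep_act (specht \<mu>) g v = lin_ext (tabloids \<mu>) (\<lambda>a. rep_act (specht \<mu>) g (ebasis a)) v"
  by (rule ext) (simp add: lin_ext_apply specht_def lin_ext_unit[OF finite_tabloids])

lemma TVV_act_tensor:
  assumes "t \<in> Theta m" "decomp m x t = (t', x1, x2)"
  shows "rep_act (TVV m \<mu>) x (tensor t v w) =
    fscale (sgn_bit (total_colour x2)) (tensor t' (rep_act (specht \<mu>) x1 v) (rep_act (specht \<mu>) x2 w))"
proof
  fix p :: "int mat \<times> nat set list \<times> nat set list"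
  obtain s a b where p: "p = (s, a, b)" by (cases p) auto
  show "rep_act (TVV m \<mu>) x (tensor t v w) p = fscale (sgn_bit (total_colour x2))
      (tensor t' (rep_act (specht \<mu>) x1 v) (rep_act (specht \<mu>) x2 w)) p"
    unfolding TVV_def rep.simps lin_ext_tensor[OF assms(1)]
    by (subst (3 4) specht_act_apply)
      (simp add: p assms(2) fscale_def tensor_def lin_ext_apply sum_product sum_distrib_left mult_ac)
qed

lemma TVV_swap_tensor:
  assumes "t \<in> Theta m" "v \<in> rep_space (specht \<mu>)" "w \<in> rep_space (specht \<mu>)"
  shows "TVV_swap m \<mu> (tensor t v w) = tensor (hat_perm m t) w v"
proof -
  have supp: "u a = 0" if "u \<in> rep_space (specht \<mu>)" "a \<notin> tabloids \<mu>" for u a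
  proof -
    let ?U = "{u. u a = 0}"
    have pi: "\<pi> \<circ> T \<in> tableaux \<mu>" if "T \<in> tableaux \<mu>" "\<pi> \<in> column_stabilizer \<mu> T" for \<pi> T
      using that bij_betw_trans[OF _ permutes_imp_bij]
      by (auto simp: tableaux_def column_stabilizer_def)
    have "polytabloid \<mu> T \<in> ?U" if "T \<in> tableaux \<mu>" for T
    proof -
      have "polytabloid \<mu> T a = (\<Sum>\<pi>\<in>column_stabilizer \<mu> T.
          of_int (sign \<pi>) * ebasis (tabloid_of \<mu> (\<pi> \<circ> T)) a)"
        using lin_ext_apply[of "column_stabilizer \<mu> T" "\<lambda>\<pi>. ebasis (tabloid_of \<mu> (\<pi> \<circ> T))"
            "\<lambda>\<pi>. of_int (sign \<pi>)" a]
        by (simp add: polytabloid_def lin_ext_def)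
      also have "\<dots> = 0"
      proof (intro sum.neutral ballI)
        fix \<pi> assume "\<pi> \<in> column_stabilizer \<mu> T"
        then have "tabloid_of \<mu> (\<pi> \<circ> T) \<in> tabloids \<mu>"
          using pi[OF \<open>T \<in> tableaux \<mu>\<close>] by (simp add: tabloids_def)
        then show "of_int (sign \<pi>) * ebasis (tabloid_of \<mu> (\<pi> \<circ> T)) a = 0"
          using \<open>a \<notin> tabloids \<mu>\<close> by (auto simp: ebasis_def)
      qed
      finally show ?thesis by simp
    qed
    moreover have "cfun.subspace ?U" by (auto simp: cfun.subspace_def fscale_def)
    ultimately have "cfun.span (polytabloid \<mu> ` tableaux \<mu>) \<subseteq> ?U"
      by (intro cfun.span_minimal) auto
    then show ?thesis using that by (auto simp: specht_def)
  qed
  have one: "(\<Sum>a\<in>tabloids \<mu>. u a * ebasis a b) = u b" if "u \<in> rep_space (specht \<mu>)" for u b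
    using supp[OF that] by (simp add: ebasis_def if_distrib finite_tabloids cong: if_cong)
  show ?thesis
  proof
    fix p :: "int mat \<times> nat set list \<times> nat set list"
    obtain s a b where p: "p = (s, a, b)" by (cases p) auto
    have "TVV_swap m \<mu> (tensor t v w) p = ebasis (hat_perm m t) s *
        (\<Sum>y\<in>tabloids \<mu>. w y * ebasis y a) * (\<Sum>x\<in>tabloids \<mu>. v x * ebasis x b)"
      unfolding TVV_swap_def lin_ext_tensor[OF assms(1)] sum_product sum_distrib_left
      by (simp add: p tensor_def sum_product sum_distrib_left mult_ac)
    then show "TVV_swap m \<mu> (tensor t v w) p = tensor (hat_perm m t) w v p"
      using one[OF assms(2)] one[OF assms(3)] by (simp add: p tensor_def)
  qed
qed

end

theory Submission
  imports Defs "HOL-Combinatorics.Cycles" "HOL-Library.Multiset"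
begin

text \<open>An antisymmetric lift \<open>w\<close> splits the positions into those of colour 0 and those of colour 1 and
  matches the two halves, so the lifts correspond to pairs of a shuffle \<open>t\<close> and a permutation \<open>s\<close> of
  \<open>{..<m}\<close>. Sending \<open>t \<otimes> v\<^sub>1 \<otimes> v\<^sub>2\<close> to the matrix coefficient \<open>s \<mapsto> \<langle>s v\<^sub>1, v\<^sub>2\<rangle>\<close> at \<open>t\<close> identifies the sum of
  all \<open>T \<otimes> V\<^sub>\<mu> \<otimes> V\<^sub>\<mu>\<close> with the functions on lifts, by the Peter-Weyl theorem for the symmetric group,
  and turns \<open>S\<close> into \<open>w \<mapsto> - w\<close>. Hence the \<open>- 1\<close> eigenspaces of \<open>S\<close> become the functions that are odd
  under \<open>w \<mapsto> - w\<close>, which are \<open>M(c\<^sup>1)\<close> up to the sign of the colour of position 0. The Peter-Weyl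
  theorem follows from James's analysis of the signed column sums (independence) and from counting
  cycle types (completeness).\<close>

section \<open>Young diagrams\<close>

text \<open>Independence only has to isolate one Specht module at a time, so the dominance order is
  replaced by a number, the sum of the row indices of all cells. Among the nonzero components take
  one, \<nu>, where this number is largest. The signed column sum of a tableau of shape \<nu> kills
  all other components, and on \<nu> it has rank one, so vanishing matrix coefficients become
  vanishing pairings with tensors of polytabloids. These pairings detect zero because polytabloids
  have real coefficients. Completeness does not go through the sum of squared dimensions: for class
  functions it is a square linear system indexed by partitions, solvable since independence makes
  its kernel trivial; translating the indicator of the identity does the rest. Equivariance rests on
  a coincidence: the factorization x t = t' diag(x1, x2) behind the action on T, V, V also describes
  how conjugation moves the shuffle and the permutation attached to a lift, and z(x2) is exactly the
  pairing of x with that lift. The eigenvalue -1 is forced by a(g, v): it ties M(c1) to the colour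
  of position 0, which changes when w becomes -w.\<close>

lemma sum_card_le:
  fixes A :: "nat set"
  assumes "finite A"
  shows "\<Sum>{..<card A} \<le> \<Sum>A \<and> (\<Sum>A = \<Sum>{..<card A} \<longrightarrow> A = {..<card A})"
  using assms
proof (induction "card A" arbitrary: A)
  case 0
  then show ?case by auto
next
  case (Suc k)
  then have fin: "finite A" and ne: "A \<noteq> {}" by auto
  define M where "M = Max A"
  have M: "M \<in> A" unfolding M_def using fin ne by simp
  have cB: "card (A - {M}) = k" using Suc.hyps(2) M fin by simp
  have IH: "\<Sum>{..<k} \<le> \<Sum>(A - {M}) \<and> (\<Sum>(A - {M}) = \<Sum>{..<k} \<longrightarrow> A - {M} = {..<k})"
    using Suc.hyps(1)[of "A - {M}"] cB fin by auto
  \<comment> \<open>The \<open>Suc k\<close> elements lie in \<open>{..M}\<close>, so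
    \<open>M\<close> is at least \<open>k\<close>; in the equality case \<open>M\<close> must be
    \<open>k\<close>, and the rest is settled by induction.\<close>
  have "A \<subseteq> {..M}" using fin by (auto simp: M_def)
  from card_mono[OF _ this] have kM: "k \<le> M" using Suc.hyps(2) by simp
  have sA: "\<Sum>A = \<Sum>(A - {M}) + M" using M fin by (simp add: sum.remove[of A M])
  have sk: "\<Sum>{..<Suc k} = \<Sum>{..<k} + k" by simp
  have cA: "card A = Suc k" using Suc.hyps(2) by simp
  have "A = {..<Suc k}" if "\<Sum>A = \<Sum>{..<Suc k}"
  proof -
    have "M = k" "\<Sum>(A - {M}) = \<Sum>{..<k}" using that sA sk kM IH by linarith+
    then have "A - {k} = {..<k}" "k \<in> A" using IH M by auto
    then show ?thesis by (auto simp: lessThan_Suc)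
  qed
  moreover have "\<Sum>{..<Suc k} \<le> \<Sum>A" using sA sk kM IH by linarith
  ultimately show ?case unfolding cA by blast
qed

lemma young_cells_Sigma: "young_cells \<mu> = Sigma {..<length \<mu>} (\<lambda>i. {..<\<mu> ! i})"
  by (auto simp: young_cells_def)

lemma finite_young_cells [simp]: "finite (young_cells \<mu>)"
  by (simp add: young_cells_Sigma)

lemma card_young_cells: "card (young_cells \<mu>) = sum_list \<mu>"
  by (simp add: young_cells_Sigma sum_list_sum_nth atLeast0LessThan)

lemma tableaux_nonempty: "tableaux \<mu> \<noteq> {}"
proof -
  have "\<exists>T. bij_betw T (young_cells \<mu>) {..<sum_list \<mu>}"
    using finite_same_card_bij[of "young_cells \<mu>" "{..<sum_list \<mu>}"]
    by (simp add: card_young_cells)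
  then show ?thesis by (auto simp: tableaux_def)
qed

lemma young_cells_down_closed:
  assumes "\<mu> \<in> int_partitions m" "(i, j) \<in> young_cells \<mu>" "i' \<le> i"
  shows "(i', j) \<in> young_cells \<mu>"
proof -
  have "sorted_wrt (\<ge>) \<mu>" using assms by (simp add: int_partitions_def)
  then have "\<mu> ! i' \<ge> \<mu> ! i"
    using assms by (cases "i' = i") (auto simp: young_cells_def sorted_wrt_iff_nth_less)
  then show ?thesis using assms by (auto simp: young_cells_def)
qed

text \<open>A diagram is closed under decreasing the row index, so each column fills consecutive
  rows from row 0 on. This is how the weak decrease of the parts enters the argument.\<close>

lemma young_column:
  assumes "\<mu> \<in> int_partitions m"
  shows "{i. (i, j) \<in> young_cells \<mu>} = {..<card {i. (i, j) \<in> young_cells \<mu>}}"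
proof -
  let ?A = "{i. (i, j) \<in> young_cells \<mu>}"
  have fin: "finite ?A" by (rule finite_subset[of _ "{..<length \<mu>}"]) (auto simp: young_cells_def)
  define k where "k = (LEAST i. i \<notin> ?A)"
  have ex: "\<exists>i. i \<notin> ?A" using fin ex_new_if_finite[of ?A] by auto
  have "?A = {..<k}"
  proof (intro equalityI subsetI)
    fix i assume "i \<in> ?A"
    then have "\<not> k \<le> i" using LeastI_ex[OF ex, folded k_def] young_cells_down_closed[OF assms] by auto
    then show "i \<in> {..<k}" by simp
  next
    fix i assume "i \<in> {..<k}"
    then show "i \<in> ?A" using not_less_Least[of i "\<lambda>i. i \<notin> ?A", folded k_def] by auto
  qed
  then show ?thesis by simp
qed

text \<open>\<open>f\<close> moves cells within their columns. In column j the old rows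
  \<open>A j\<close> form an initial segment, which has the least sum among all sets of rows of its
  size, and the new rows \<open>B j\<close> have the same size by injectivity. Equality of the
  totals forces equality in every column.\<close>

lemma row_sum_le:
  assumes \<mu>: "\<mu> \<in> int_partitions m"
    and inj: "inj_on f (young_cells \<mu>)" and snd: "\<And>c. c \<in> young_cells \<mu> \<Longrightarrow> snd (f c) = snd c"
  shows "(\<Sum>c\<in>young_cells \<mu>. fst c) \<le> (\<Sum>c\<in>young_cells \<mu>. fst (f c))"
    and "(\<Sum>c\<in>young_cells \<mu>. fst (f c)) = (\<Sum>c\<in>young_cells \<mu>. fst c) \<Longrightarrow>
      f ` young_cells \<mu> = young_cells \<mu>"
proof -
  define A where "A j = {i. (i, j) \<in> young_cells \<mu>}" for j
  define B where "B j = (\<lambda>i. fst (f (i, j))) ` A j" for j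
  define J where "J = snd ` young_cells \<mu>"
  have finJ: "finite J" by (simp add: J_def)
  have finA: "finite (A j)" for j
    unfolding A_def by (rule finite_subset[of _ "{..<length \<mu>}"]) (auto simp: young_cells_def)
  have injB: "inj_on (\<lambda>i. fst (f (i, j))) (A j)" for j
  proof (rule inj_onI)
    fix i i' assume "i \<in> A j" "i' \<in> A j" "fst (f (i, j)) = fst (f (i', j))"
    then have "f (i, j) = f (i', j)" using snd by (auto simp: A_def prod_eq_iff)
    then show "i = i'" using inj \<open>i \<in> A j\<close> \<open>i' \<in> A j\<close> by (auto simp: A_def inj_on_def)
  qed
  have cardB: "card (B j) = card (A j)" for j
    unfolding B_def by (rule card_image[OF injB])
  have split: "(\<Sum>c\<in>young_cells \<mu>. g c) = (\<Sum>j\<in>J. \<Sum>i\<in>A j. g (i, j))" for g :: "nat \<times> nat \<Rightarrow> nat"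
  proof -
    have "(\<Sum>c\<in>young_cells \<mu>. g c) = (\<Sum>(j, i)\<in>Sigma J A. g (i, j))"
      by (rule sum.reindex_bij_witness[of _ "\<lambda>(j, i). (i, j)" "\<lambda>(i, j). (j, i)"])
        (force simp: A_def J_def image_iff)+
    then show ?thesis by (simp add: sum.Sigma finJ finA)
  qed
  have sB: "(\<Sum>i\<in>A j. fst (f (i, j))) = \<Sum>(B j)" for j
    unfolding B_def by (simp add: sum.reindex[OF injB])
  have col: "A j = {..<card (A j)}" for j
    unfolding A_def by (rule young_column[OF \<mu>])
  have AB: "\<Sum>(A j) \<le> \<Sum>(B j)" and ABeq: "\<Sum>(B j) = \<Sum>(A j) \<Longrightarrow> B j = A j" for j
    using sum_card_le[of "B j"] col[of j] finA[of j] cardB[of j] by (auto simp: B_def)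
  have l: "(\<Sum>c\<in>young_cells \<mu>. fst c) = (\<Sum>j\<in>J. \<Sum>(A j))"
    and r: "(\<Sum>c\<in>young_cells \<mu>. fst (f c)) = (\<Sum>j\<in>J. \<Sum>(B j))"
    by (simp_all add: split sB)
  show "(\<Sum>c\<in>young_cells \<mu>. fst c) \<le> (\<Sum>c\<in>young_cells \<mu>. fst (f c))"
    unfolding l r by (rule sum_mono) (rule AB)
  assume "(\<Sum>c\<in>young_cells \<mu>. fst (f c)) = (\<Sum>c\<in>young_cells \<mu>. fst c)"
  then have eq: "(\<Sum>j\<in>J. \<Sum>(A j)) = (\<Sum>j\<in>J. \<Sum>(B j))" unfolding l r by simp
  have "\<Sum>(A j) = \<Sum>(B j)" if "j \<in> J" for j
    using sum_mono_inv[OF eq _ that finJ] AB by simp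
  then have BA: "B j = A j" if "j \<in> J" for j using that ABeq by simp
  have "f ` young_cells \<mu> \<subseteq> young_cells \<mu>"
  proof (rule image_subsetI)
    fix c assume "c \<in> young_cells \<mu>"
    then obtain i j where ij: "c = (i, j)" and c: "(i, j) \<in> young_cells \<mu>" by (cases c) auto
    then have "j \<in> J" by (force simp: J_def)
    have "fst (f (i, j)) \<in> B j" using c by (auto simp: B_def A_def)
    then have "(fst (f (i, j)), j) \<in> young_cells \<mu>" using BA[OF \<open>j \<in> J\<close>] by (simp add: A_def)
    moreover have "f (i, j) = (fst (f (i, j)), j)" using snd[OF c] by (simp add: prod_eq_iff)
    ultimately show "f c \<in> young_cells \<mu>" by (simp add: ij)
  qed
  then show "f ` young_cells \<mu> = young_cells \<mu>"
    using inj by (simp add: endo_inj_surj)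
qed

section \<open>Tabloids and polytabloids\<close>

definition act_tabloid :: "(nat \<Rightarrow> nat) \<Rightarrow> nat set list \<Rightarrow> nat set list" where
  "act_tabloid \<pi> X = map ((`) \<pi>) X"

lemma act_tabloid_of: "act_tabloid \<pi> (tabloid_of \<mu> T) = tabloid_of \<mu> (\<pi> \<circ> T)"
  by (simp add: act_tabloid_def tabloid_of_def image_comp)

lemma act_tabloid_comp: "act_tabloid \<pi> (act_tabloid \<sigma> X) = act_tabloid (\<pi> \<circ> \<sigma>) X"
  by (simp add: act_tabloid_def image_comp)

lemma act_tabloid_id [simp]: "act_tabloid id X = X"
  by (simp add: act_tabloid_def)

text \<open>The library notation for the inverse of a map clashes with the one for groups.\<close>

abbreviation pinv :: "(nat \<Rightarrow> nat) \<Rightarrow> nat \<Rightarrow> nat" where "pinv \<equiv> inv_into UNIV"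

lemma act_tabloid_inv:
  assumes "\<pi> permutes S"
  shows "act_tabloid (pinv \<pi>) (act_tabloid \<pi> X) = X" "act_tabloid \<pi> (act_tabloid (pinv \<pi>) X) = X"
  by (simp_all add: act_tabloid_comp permutes_inv_o[OF assms])

lemma comp_tableau:
  assumes "\<pi> permutes {..<sum_list \<mu>}" "T \<in> tableaux \<mu>"
  shows "\<pi> \<circ> T \<in> tableaux \<mu>"
  using assms bij_betw_trans[OF _ permutes_imp_bij] by (auto simp: tableaux_def)

lemma act_tabloid_closed:
  assumes "\<pi> permutes {..<sum_list \<mu>}" "X \<in> tabloids \<mu>"
  shows "act_tabloid \<pi> X \<in> tabloids \<mu>"
  using assms comp_tableau by (auto simp: tabloids_def act_tabloid_of)

lemma act_tabloid_bij:
  assumes "\<pi> permutes {..<sum_list \<mu>}"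
  shows "bij_betw (act_tabloid \<pi>) (tabloids \<mu>) (tabloids \<mu>)"
  by (rule bij_betw_byWitness[of _ "act_tabloid (pinv \<pi>)"])
    (auto simp: act_tabloid_inv[OF assms] intro!: act_tabloid_closed assms permutes_inv)

lemma int_partitions_sum: "\<mu> \<in> int_partitions m \<Longrightarrow> sum_list \<mu> = m"
  by (simp add: int_partitions_def)

lemma finite_int_partitions: "finite (int_partitions m)"
proof (rule finite_subset)
  have "length xs \<le> sum_list xs" if "0 \<notin> set xs" for xs :: "nat list"
    using that by (induction xs) auto
  then show "int_partitions m \<subseteq> {xs. set xs \<subseteq> {..m} \<and> length xs \<le> m}"
    by (auto simp: int_partitions_def member_le_sum_list)
qed (simp add: finite_lists_length_le)

text \<open>An entry determines its cell, so the setwise condition says that no entry is moved into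
  a different column; inclusion of a column in itself is equality because columns are
  finite.\<close>

lemma column_stabilizer_iff:
  assumes "T \<in> tableaux \<mu>"
  shows "\<pi> \<in> column_stabilizer \<mu> T \<longleftrightarrow> \<pi> permutes {..<sum_list \<mu>} \<and>
    (\<forall>c\<in>young_cells \<mu>. \<forall>d\<in>young_cells \<mu>. \<pi> (T c) = T d \<longrightarrow> snd c = snd d)" (is "?l \<longleftrightarrow> ?p \<and> ?r")
proof (cases ?p)
  case p: True
  have T: "inj_on T (young_cells \<mu>)" "T ` young_cells \<mu> = {..<sum_list \<mu>}"
    using assms by (auto simp: tableaux_def bij_betw_def)
  let ?C = "\<lambda>j. T ` {(i, j') \<in> young_cells \<mu>. j' = j}"
  have "(\<forall>j. \<pi> ` ?C j = ?C j) \<longleftrightarrow> ?r"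
  proof
    assume l: "\<forall>j. \<pi> ` ?C j = ?C j"
    show ?r
    proof (intro ballI impI)
      fix c d assume c: "c \<in> young_cells \<mu>" "d \<in> young_cells \<mu>" and e: "\<pi> (T c) = T d"
      then have "T c \<in> ?C (snd c)" by (intro imageI) auto
      then have "\<pi> (T c) \<in> \<pi> ` ?C (snd c)" by (rule imageI)
      then have "T d \<in> ?C (snd c)" unfolding e l[rule_format] .
      then obtain c' where "c' \<in> young_cells \<mu>" "snd c' = snd c" "T d = T c'" by auto
      then show "snd c = snd d" using T(1) c by (auto simp: inj_on_def)
    qed
  next
    assume r: ?r
    show "\<forall>j. \<pi> ` ?C j = ?C j"
    proof
      fix j
      have "\<pi> ` ?C j \<subseteq> ?C j"
      proof
        fix x assume "x \<in> \<pi> ` ?C j"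
        then obtain c where c: "c \<in> young_cells \<mu>" "snd c = j" "x = \<pi> (T c)" by auto
        have "T c \<in> {..<sum_list \<mu>}" using T(2) c(1) by blast
        then have "x \<in> {..<sum_list \<mu>}" using c(3) permutes_in_image[OF p] by simp
        then obtain d where d: "d \<in> young_cells \<mu>" "x = T d" using T(2) by blast
        then show "x \<in> ?C j" using r c by (auto intro!: image_eqI[of _ _ d])
      qed
      moreover have "finite (?C j)" by (rule finite_imageI, rule finite_subset[OF _ finite_young_cells]) auto
      ultimately show "\<pi> ` ?C j = ?C j"
        using inj_on_subset[OF permutes_inj[OF p] subset_UNIV] by (intro endo_inj_surj) simp_all
    qed
  qed
  then show ?thesis using p by (simp add: column_stabilizer_def)
qed (simp add: column_stabilizer_def)

section \<open>The column stabilizer as a group\<close>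

lemma column_stabilizer_permutes: "\<pi> \<in> column_stabilizer \<mu> T \<Longrightarrow> \<pi> permutes {..<sum_list \<mu>}"
  by (simp add: column_stabilizer_def)

lemma finite_column_stabilizer: "finite (column_stabilizer \<mu> T)"
  by (rule finite_subset[OF _ finite_permutations[of "{..<sum_list \<mu>}"]])
    (auto simp: column_stabilizer_def)

lemma column_stabilizer_comp:
  "\<lbrakk>\<pi> \<in> column_stabilizer \<mu> T; \<sigma> \<in> column_stabilizer \<mu> T\<rbrakk> \<Longrightarrow> \<pi> \<circ> \<sigma> \<in> column_stabilizer \<mu> T"
  unfolding column_stabilizer_def mem_Collect_eq image_comp[symmetric] by (simp add: permutes_compose)

lemma column_stabilizer_inv:
  assumes "\<pi> \<in> column_stabilizer \<mu> T"
  shows "pinv \<pi> \<in> column_stabilizer \<mu> T"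
proof -
  have p: "\<pi> permutes {..<sum_list \<mu>}" using assms by (rule column_stabilizer_permutes)
  have "pinv \<pi> ` S = S" if "\<pi> ` S = S" for S
    by (metis image_inv_f_f permutes_inj[OF p] that)
  then show ?thesis using assms permutes_inv[OF p] by (simp add: column_stabilizer_def)
qed

lemma column_stabilizer_id: "id \<in> column_stabilizer \<mu> T"
  by (simp add: column_stabilizer_def permutes_id)

text \<open>The permutation is T' after the inverse of T, extended by the identity. Agreement is
  claimed on cells only, since a tableau is arbitrary outside its diagram.\<close>

lemma tableaux_permutation:
  assumes "T \<in> tableaux \<mu>" "T' \<in> tableaux \<mu>"
  obtains \<pi> where "\<pi> permutes {..<sum_list \<mu>}" "\<And>c. c \<in> young_cells \<mu> \<Longrightarrow> \<pi> (T c) = T' c"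
proof -
  let ?C = "young_cells \<mu>" and ?S = "{..<sum_list \<mu>}"
  have T: "bij_betw T ?C ?S" and T': "bij_betw T' ?C ?S" using assms by (simp_all add: tableaux_def)
  define \<pi> where "\<pi> x = (if x \<in> ?S then (T' \<circ> inv_into ?C T) x else x)" for x
  have "bij_betw (T' \<circ> inv_into ?C T) ?S ?S"
    by (rule bij_betw_trans[OF bij_betw_inv_into[OF T] T'])
  then have "bij_betw \<pi> ?S ?S"
    using bij_betw_cong[of ?S \<pi> "T' \<circ> inv_into ?C T" ?S] by (simp add: \<pi>_def)
  then have "\<pi> permutes ?S" by (rule bij_imp_permutes) (simp add: \<pi>_def)
  moreover have "\<pi> (T c) = T' c" if "c \<in> ?C" for c
    using T that bij_betw_inv_into_left[OF T that] by (auto simp: \<pi>_def bij_betw_def)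
  ultimately show ?thesis by (rule that)
qed

text \<open>The coefficient of the tabloid \<open>Y\<close> in \<open>\<kappa>\<^sub>T X\<close>, where \<open>\<kappa>\<^sub>T\<close> is the signed sum over the column stabilizer.\<close>

definition column_sum ::
    "nat list \<Rightarrow> (nat \<times> nat \<Rightarrow> nat) \<Rightarrow> nat set list \<Rightarrow> nat set list \<Rightarrow> complex" where
  "column_sum \<mu> T X Y = (\<Sum>\<pi>\<in>column_stabilizer \<mu> T. of_int (sign \<pi>) * (if act_tabloid \<pi> X = Y then 1 else 0))"

lemma polytabloid_eq: "polytabloid \<mu> T X = column_sum \<mu> T (tabloid_of \<mu> T) X"
proof -
  have "polytabloid \<mu> T X = (\<Sum>\<pi>\<in>column_stabilizer \<mu> T.
      of_int (sign \<pi>) * ebasis (tabloid_of \<mu> (\<pi> \<circ> T)) X)"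
    using lin_ext_apply[of "column_stabilizer \<mu> T" "\<lambda>\<pi>. ebasis (tabloid_of \<mu> (\<pi> \<circ> T))"
        "\<lambda>\<pi>. of_int (sign \<pi>)" X]
    by (simp add: polytabloid_def lin_ext_def)
  then show ?thesis
    by (simp add: column_sum_def act_tabloid_of ebasis_def eq_commute)
qed

text \<open>The coefficients are integers. Hence the span of tensors of polytabloids is closed under
  conjugation, and a bilinear pairing can be used like an inner product.\<close>

lemma cnj_polytabloid: "cnj (polytabloid \<mu> T X) = polytabloid \<mu> T X"
  by (simp add: polytabloid_eq column_sum_def if_distrib cong: if_cong)

text \<open>The signed column sum is a symmetric operator: inversion preserves both the stabilizer
  and the sign.\<close>

lemma column_sum_sym: "column_sum \<mu> T X Y = column_sum \<mu> T Y X"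
proof -
  let ?S = "{..<sum_list \<mu>}"
  have p: "\<pi> permutes ?S" if "\<pi> \<in> column_stabilizer \<mu> T" for \<pi>
    using that by (rule column_stabilizer_permutes)
  have "act_tabloid \<pi> X = Y \<longleftrightarrow> act_tabloid (pinv \<pi>) Y = X" if "\<pi> \<in> column_stabilizer \<mu> T" for \<pi>
    using act_tabloid_inv[OF p[OF that]] by auto
  moreover have "sign (pinv \<pi>) = sign \<pi>" if "\<pi> \<in> column_stabilizer \<mu> T" for \<pi>
    using sign_inverse p[OF that] permutes_imp_permutation by blast
  moreover have "pinv (pinv \<pi>) = \<pi>" if "\<pi> \<in> column_stabilizer \<mu> T" for \<pi>
    using permutes_inv_inv[OF p[OF that]] .
  ultimately show ?thesis unfolding column_sum_def
    by (intro sum.reindex_bij_witness[of _ pinv pinv]) (auto simp: column_stabilizer_inv)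
qed

text \<open>Substituting \<pi> \<theta> for \<pi> costs the factor sign \<theta>, because the square
  of a sign is 1.\<close>

lemma column_sum_act:
  assumes "\<theta> \<in> column_stabilizer \<mu> T"
  shows "column_sum \<mu> T (act_tabloid \<theta> X) Y = of_int (sign \<theta>) * column_sum \<mu> T X Y"
proof -
  have \<theta>: "\<theta> permutes {..<sum_list \<mu>}" using assms by (rule column_stabilizer_permutes)
  have perm: "permutation \<pi>" if "\<pi> \<in> column_stabilizer \<mu> T" for \<pi>
    using column_stabilizer_permutes[OF that] permutes_imp_permutation by blast
  have s: "sign \<pi> = sign \<theta> * sign (\<pi> \<circ> \<theta>)" if "\<pi> \<in> column_stabilizer \<mu> T" for \<pi>
    using sign_compose[OF perm[OF that] perm[OF assms]] by (simp add: sign_def)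
  have i: "\<pi> \<circ> \<theta> \<circ> pinv \<theta> = \<pi>" "\<pi> \<circ> pinv \<theta> \<circ> \<theta> = \<pi>" for \<pi> :: "nat \<Rightarrow> nat"
    using permutes_inv_o[OF \<theta>] by (simp_all add: comp_assoc)
  have "column_sum \<mu> T (act_tabloid \<theta> X) Y = (\<Sum>\<pi>\<in>column_stabilizer \<mu> T.
      of_int (sign \<theta>) * (of_int (sign (\<pi> \<circ> \<theta>)) * (if act_tabloid (\<pi> \<circ> \<theta>) X = Y then 1 else 0)))"
    unfolding column_sum_def act_tabloid_comp
    by (rule sum.cong) (use s in \<open>auto simp: act_tabloid_comp simp flip: of_int_mult\<close>)
  also have "\<dots> = of_int (sign \<theta>) * (\<Sum>\<pi>\<in>column_stabilizer \<mu> T.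
      of_int (sign (\<pi> \<circ> \<theta>)) * (if act_tabloid (\<pi> \<circ> \<theta>) X = Y then 1 else 0))"
    by (simp add: sum_distrib_left)
  also have "(\<Sum>\<pi>\<in>column_stabilizer \<mu> T.
      of_int (sign (\<pi> \<circ> \<theta>)) * (if act_tabloid (\<pi> \<circ> \<theta>) X = Y then 1 else 0)) = column_sum \<mu> T X Y"
    unfolding column_sum_def
    by (rule sum.reindex_bij_witness[of _ "\<lambda>\<pi>. \<pi> \<circ> pinv \<theta>" "\<lambda>\<pi>. \<pi> \<circ> \<theta>"])
      (use i in \<open>auto intro!: column_stabilizer_comp column_stabilizer_inv assms\<close>)
  finally show ?thesis .
qed

lemma tabloid_of_nth: "i < length \<mu> \<Longrightarrow> tabloid_of \<mu> T ! i = T ` {c \<in> young_cells \<mu>. fst c = i}"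
  by (auto simp: tabloid_of_def young_cells_def intro!: arg_cong[where f = "\<lambda>S. T ` S"])

text \<open>The row counterpart of \<open>column_stabilizer_iff\<close>: tabloids agree exactly when
  every entry sits in the same row of both.\<close>

lemma act_tabloid_of_eq_iff:
  assumes "\<pi> permutes {..<sum_list \<mu>}" "T \<in> tableaux \<mu>" "T' \<in> tableaux \<mu>"
  shows "act_tabloid \<pi> (tabloid_of \<mu> T) = tabloid_of \<mu> T' \<longleftrightarrow>
    (\<forall>c\<in>young_cells \<mu>. \<forall>d\<in>young_cells \<mu>. \<pi> (T c) = T' d \<longrightarrow> fst c = fst d)" (is "?l \<longleftrightarrow> ?r")
proof
  have T': "inj_on T' (young_cells \<mu>)" "T' ` young_cells \<mu> = {..<sum_list \<mu>}"
    using assms by (auto simp: tableaux_def bij_betw_def)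
  have pT: "(\<pi> \<circ> T) ` young_cells \<mu> = {..<sum_list \<mu>}"
    using comp_tableau[OF assms(1,2)] by (auto simp: tableaux_def bij_betw_def)
  {
    assume l: ?l
    show ?r
    proof (intro ballI impI)
      fix c d assume c: "c \<in> young_cells \<mu>" and d: "d \<in> young_cells \<mu>" and e: "\<pi> (T c) = T' d"
      have i: "fst c < length \<mu>" using c by (auto simp: young_cells_def)
      have "tabloid_of \<mu> (\<pi> \<circ> T) ! fst c = tabloid_of \<mu> T' ! fst c"
        using l by (simp add: act_tabloid_of)
      then have "\<pi> (T c) \<in> T' ` {d \<in> young_cells \<mu>. fst d = fst c}"
        unfolding tabloid_of_nth[OF i] using c by auto
      then show "fst c = fst d" using e d T'(1) by (auto simp: inj_on_def)
    qed
  }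
  assume r: ?r
  show ?l unfolding act_tabloid_of
  proof (rule nth_equalityI)
    fix i assume "i < length (tabloid_of \<mu> (\<pi> \<circ> T))"
    then have i: "i < length \<mu>" by (simp add: tabloid_of_def)
    show "tabloid_of \<mu> (\<pi> \<circ> T) ! i = tabloid_of \<mu> T' ! i"
      unfolding tabloid_of_nth[OF i]
    proof (intro equalityI subsetI)
      fix x assume "x \<in> (\<pi> \<circ> T) ` {c \<in> young_cells \<mu>. fst c = i}"
      then obtain c where c: "c \<in> young_cells \<mu>" "fst c = i" "x = \<pi> (T c)" by auto
      then have "x \<in> T' ` young_cells \<mu>" using pT T' by auto
      then obtain d where "d \<in> young_cells \<mu>" "x = T' d" by auto
      then show "x \<in> T' ` {d \<in> young_cells \<mu>. fst d = i}" using r c by auto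
    next
      fix x assume "x \<in> T' ` {d \<in> young_cells \<mu>. fst d = i}"
      then obtain d where d: "d \<in> young_cells \<mu>" "fst d = i" "x = T' d" by auto
      then have "x \<in> (\<pi> \<circ> T) ` young_cells \<mu>" using pT T' by auto
      then obtain c where "c \<in> young_cells \<mu>" "x = \<pi> (T c)" by auto
      then show "x \<in> (\<pi> \<circ> T) ` {c \<in> young_cells \<mu>. fst c = i}" using r d by auto
    qed
  qed (simp add: tabloid_of_def)
qed

text \<open>A permutation that preserves both the column and the row of every entry of T is the
  identity, so only one term of the sum contributes. The value 1 later shows that certain sums of
  squares are nonzero.\<close>

lemma polytabloid_self:
  assumes T: "T \<in> tableaux \<mu>"
  shows "polytabloid \<mu> T (tabloid_of \<mu> T) = 1"
proof -
  have inj: "inj_on T (young_cells \<mu>)" and im: "T ` young_cells \<mu> = {..<sum_list \<mu>}"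
    using T by (auto simp: tableaux_def bij_betw_def)
  have "\<pi> = id" if \<pi>: "\<pi> \<in> column_stabilizer \<mu> T"
    and fx: "act_tabloid \<pi> (tabloid_of \<mu> T) = tabloid_of \<mu> T" for \<pi>
  proof
    have p: "\<pi> permutes {..<sum_list \<mu>}" using \<pi> by (rule column_stabilizer_permutes)
    fix x show "\<pi> x = id x"
    proof (cases "x \<in> {..<sum_list \<mu>}")
      case True
      then obtain c where c: "c \<in> young_cells \<mu>" "x = T c" using im by blast
      have "\<pi> x \<in> T ` young_cells \<mu>" using True permutes_in_image[OF p] im by auto
      then obtain d where d: "d \<in> young_cells \<mu>" "\<pi> x = T d" by auto
      have "snd c = snd d" using \<pi> c d unfolding column_stabilizer_iff[OF T] by auto
      moreover have "fst c = fst d"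
        using fx c d unfolding act_tabloid_of_eq_iff[OF p T T] by auto
      ultimately have "c = d" by (rule prod_eqI[rotated])
      then show ?thesis using c d by simp
    qed (simp add: permutes_not_in[OF p])
  qed
  then have "polytabloid \<mu> T (tabloid_of \<mu> T) =
      (\<Sum>\<pi>\<in>column_stabilizer \<mu> T. if \<pi> = id then 1 else 0)"
    unfolding polytabloid_eq column_sum_def by (intro sum.cong) (auto simp: sign_id)
  then show ?thesis by (simp add: finite_column_stabilizer column_stabilizer_id)
qed

text \<open>The classical statistic n(\<mu>), the sum of i times the i-th part with rows counted
  from 0. It reverses the dominance order and serves as a numerical substitute for it.\<close>

definition row_index_sum :: "nat list \<Rightarrow> nat" where
  "row_index_sum \<mu> = (\<Sum>c\<in>young_cells \<mu>. fst c)"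

text \<open>If two entries lie in one column of \<open>T\<close> and in one row of \<open>X\<close>, their transposition
  shows that the signed column sum kills \<open>X\<close>. Otherwise, moving every entry along its column of \<open>T\<close>
  to its row in \<open>X\<close> is an injection on cells.\<close>

lemma column_sum_cases:
  assumes \<mu>: "\<mu> \<in> int_partitions m" and \<nu>: "\<nu> \<in> int_partitions m"
    and T: "T \<in> tableaux \<mu>" and T': "T' \<in> tableaux \<nu>"
  obtains "\<And>Y. column_sum \<mu> T (tabloid_of \<nu> T') Y = 0"
  | f where "\<And>c. c \<in> young_cells \<mu> \<Longrightarrow> f c \<in> young_cells \<nu> \<and> T' (f c) = T c"
      "bij_betw f (young_cells \<mu>) (young_cells \<nu>)"
      "inj_on (\<lambda>c. (fst (f c), snd c)) (young_cells \<mu>)"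
proof -
  have m: "sum_list \<mu> = m" "sum_list \<nu> = m" using \<mu> \<nu> by (simp_all add: int_partitions_sum)
  have bT: "bij_betw T (young_cells \<mu>) {..<m}" and bT': "bij_betw T' (young_cells \<nu>) {..<m}"
    using T T' m by (auto simp: tableaux_def)
  define f where "f = inv_into (young_cells \<nu>) T' \<circ> T"
  have bf: "bij_betw f (young_cells \<mu>) (young_cells \<nu>)"
    unfolding f_def by (rule bij_betw_trans[OF bT bij_betw_inv_into[OF bT']])
  have f: "f c \<in> young_cells \<nu> \<and> T' (f c) = T c" if "c \<in> young_cells \<mu>" for c
  proof
    show "f c \<in> young_cells \<nu>" using bf that by (auto simp: bij_betw_def)
    have "T c \<in> T' ` young_cells \<nu>" using bT bT' that by (auto simp: bij_betw_def)
    then show "T' (f c) = T c" by (simp add: f_def f_inv_into_f)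
  qed
  show ?thesis
  proof (cases "inj_on (\<lambda>c. (fst (f c), snd c)) (young_cells \<mu>)")
    case True
    show ?thesis by (rule that(2)[OF f bf True])
  next
    case False
    then obtain c d where cd: "c \<in> young_cells \<mu>" "d \<in> young_cells \<mu>" "c \<noteq> d"
      "fst (f c) = fst (f d)" "snd c = snd d" by (auto simp: inj_on_def)
    define s where "s = transpose (T c) (T d)"
    have Tcd: "T c \<in> {..<m}" "T d \<in> {..<m}" "T c \<noteq> T d"
      using bT cd by (auto simp: bij_betw_def inj_on_def)
    have ps: "s permutes {..<m}" unfolding s_def by (rule permutes_swap_id) (use Tcd in auto)
    have sgn: "sign s = -1" using Tcd by (simp add: s_def sign_swap_id)
    have T_eq: "T a = T b \<longleftrightarrow> a = b" if "a \<in> young_cells \<mu>" "b \<in> young_cells \<mu>" for a b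
      using bT that by (auto simp: bij_betw_def inj_on_def)
    have T'_eq: "T' a = T' b \<longleftrightarrow> a = b" if "a \<in> young_cells \<nu>" "b \<in> young_cells \<nu>" for a b
      using bT' that by (auto simp: bij_betw_def inj_on_def)
    have "s \<in> column_stabilizer \<mu> T"
      unfolding column_stabilizer_iff[OF T] m using ps cd T_eq
      by (auto simp: s_def transpose_def split: if_splits)
    then have col: "column_sum \<mu> T (act_tabloid s (tabloid_of \<nu> T')) Y =
        - column_sum \<mu> T (tabloid_of \<nu> T') Y" for Y
      by (simp add: column_sum_act sgn)
    have "act_tabloid s (tabloid_of \<nu> T') = tabloid_of \<nu> T'"
    proof -
      have "s (T' a) = T' b \<longrightarrow> fst a = fst b" if "a \<in> young_cells \<nu>" "b \<in> young_cells \<nu>" for a b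
        using cd f[OF cd(1)] f[OF cd(2)] T'_eq that unfolding s_def transpose_def
        by (metis (mono_tags))
      then show ?thesis using act_tabloid_of_eq_iff[of s \<nu> T' T'] ps m T' by auto
    qed
    with col have z: "column_sum \<mu> T (tabloid_of \<nu> T') Y = 0" for Y
      by (metis eq_neg_iff_add_eq_0 mult_2 mult_eq_0_iff zero_neq_numeral)
    show ?thesis by (rule that(1)[OF z])
  qed
qed

text \<open>If the sum survives, the cell map \<open>g\<close>, which keeps the column in T and
  takes the row in X, is injective, so \<open>row_sum_le\<close> bounds the statistic of \<mu> by
  that of \<nu>. With the assumed opposite inequality \<open>g\<close> permutes the diagram of
  \<mu>, and then both shapes have the same row lengths.\<close>

lemma column_sum_eq_0:
  assumes \<mu>: "\<mu> \<in> int_partitions m" and \<nu>: "\<nu> \<in> int_partitions m"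
    and T: "T \<in> tableaux \<mu>" and X: "X \<in> tabloids \<nu>"
    and le: "row_index_sum \<nu> \<le> row_index_sum \<mu>" and ne: "\<mu> \<noteq> \<nu>"
  shows "column_sum \<mu> T X Y = 0"
proof -
  from X obtain T' where T': "T' \<in> tableaux \<nu>" and XT': "X = tabloid_of \<nu> T'"
    by (auto simp: tabloids_def)
  show ?thesis
  proof (cases rule: column_sum_cases[OF \<mu> \<nu> T T'])
    case 1
    then show ?thesis by (simp add: XT')
  next
    case (2 f)
    define g where "g = (\<lambda>c. (fst (f c), snd c))"
    have inj: "inj_on g (young_cells \<mu>)" using 2(3) by (simp add: g_def)
    have snd: "snd (g c) = snd c" for c by (simp add: g_def)
    have eq: "(\<Sum>c\<in>young_cells \<mu>. fst (g c)) = row_index_sum \<nu>"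
      unfolding row_index_sum_def g_def fst_conv
      by (rule sum.reindex_bij_betw[OF 2(2)])
    have "g ` young_cells \<mu> = young_cells \<mu>"
      using row_sum_le[OF \<mu> inj snd] eq le by (simp add: row_index_sum_def)
    then have bg: "bij_betw g (young_cells \<mu>) (young_cells \<mu>)" using inj by (simp add: bij_betw_def)
    \<comment> \<open>\<open>f\<close> and \<open>g\<close> have the same row component, but
      \<open>g\<close> is a bijection onto the diagram of \<mu> and \<open>f\<close> onto that of
      \<nu>.\<close>
    have row: "card {c \<in> young_cells \<mu>. fst c = i} = card {c \<in> young_cells \<nu>. fst c = i}" for i
    proof -
      have "card {c \<in> young_cells \<mu>. fst c = i} = (\<Sum>c\<in>young_cells \<mu>. of_bool (fst c = i))"
        by (simp add: Int_def)
      also have "\<dots> = (\<Sum>c\<in>young_cells \<mu>. of_bool (fst (g c) = i))"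
        using sum.reindex_bij_betw[OF bg, of "\<lambda>c. of_bool (fst c = i) :: nat"] by simp
      also have "\<dots> = (\<Sum>c\<in>young_cells \<mu>. of_bool (fst (f c) = i))" by (simp add: g_def)
      also have "\<dots> = (\<Sum>c\<in>young_cells \<nu>. of_bool (fst c = i))"
        by (rule sum.reindex_bij_betw[OF 2(2)])
      finally show ?thesis by (simp add: Int_def)
    qed
    have rl: "card {c \<in> young_cells \<kappa>. fst c = i} = (if i < length \<kappa> then \<kappa> ! i else 0)" for \<kappa> i
    proof -
      have "{c \<in> young_cells \<kappa>. fst c = i} = (if i < length \<kappa> then Pair i ` {..<\<kappa> ! i} else {})"
        by (auto simp: young_cells_def)
      then show ?thesis by (simp add: card_image inj_on_def)
    qed
    \<comment> \<open>Parts are nonzero, so the row lengths, read as 0 beyond the last row, also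
      determine the number of rows.\<close>
    have pos: "\<kappa> ! i \<noteq> 0" if "\<kappa> \<in> int_partitions m" "i < length \<kappa>" for \<kappa> i
      using that unfolding int_partitions_def by (metis (mono_tags, lifting) mem_Collect_eq nth_mem)
    have "\<not> length \<mu> < length \<nu>"
      using row[of "length \<mu>"] pos[OF \<nu>, of "length \<mu>"] unfolding rl by auto
    moreover have "\<not> length \<nu> < length \<mu>"
      using row[of "length \<nu>"] pos[OF \<mu>, of "length \<nu>"] unfolding rl by auto
    ultimately have "length \<mu> = length \<nu>" by simp
    then have "\<mu> = \<nu>" using row unfolding rl by (intro nth_equalityI) metis+
    then show ?thesis using ne by simp
  qed
qed

text \<open>James's lemma in coordinates. If the column sum does not kill X, then X is the image of
  the tabloid of T under some \<theta> in the column stabilizer, so the column sum of X is sign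
  \<theta> times the polytabloid; symmetry identifies that sign with the coefficient of X in the
  polytabloid.\<close>

lemma column_sum_rank_one:
  assumes \<mu>: "\<mu> \<in> int_partitions m" and T: "T \<in> tableaux \<mu>" and X: "X \<in> tabloids \<mu>"
  shows "column_sum \<mu> T X Y = polytabloid \<mu> T X * polytabloid \<mu> T Y"
proof -
  from X obtain T' where T': "T' \<in> tableaux \<mu>" and XT': "X = tabloid_of \<mu> T'"
    by (auto simp: tabloids_def)
  show ?thesis
  proof (cases rule: column_sum_cases[OF \<mu> \<mu> T T'])
    case 1
    then have "polytabloid \<mu> T X = 0" by (simp add: polytabloid_eq XT' column_sum_sym[of \<mu> T _ "tabloid_of \<mu> T'"])
    then show ?thesis using 1 by (simp add: XT')
  next
    case (2 f)
    define g where "g = (\<lambda>c. (fst (f c), snd c))"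
    have inj: "inj_on g (young_cells \<mu>)" using 2(3) by (simp add: g_def)
    have snd: "snd (g c) = snd c" for c by (simp add: g_def)
    have eq: "(\<Sum>c\<in>young_cells \<mu>. fst (g c)) = (\<Sum>c\<in>young_cells \<mu>. fst c)"
      unfolding g_def fst_conv by (rule sum.reindex_bij_betw[OF 2(2)])
    have img: "g ` young_cells \<mu> = young_cells \<mu>" by (rule row_sum_le(2)[OF \<mu> inj snd eq])
    have bT: "bij_betw T (young_cells \<mu>) {..<sum_list \<mu>}" using T by (simp add: tableaux_def)
    have Tg: "T \<circ> g \<in> tableaux \<mu>"
      unfolding tableaux_def using bij_betw_trans[OF _ bT] inj img by (auto simp: bij_betw_def)
    \<comment> \<open>\<open>\<theta>\<close> replaces the entry of T in the cell \<open>g c\<close>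
      by the entry \<open>T c\<close>, which lies in the same column of T and in row
      \<open>fst (g c)\<close> of X. So it stabilizes columns and carries the tabloid of T to
      X.\<close>
    obtain \<theta> where p: "\<theta> permutes {..<sum_list \<mu>}"
      and \<theta>: "\<And>c. c \<in> young_cells \<mu> \<Longrightarrow> \<theta> (T (g c)) = T c"
      using tableaux_permutation[OF Tg T] by (metis comp_apply)
    have T_eq: "T a = T b \<longleftrightarrow> a = b" if "a \<in> young_cells \<mu>" "b \<in> young_cells \<mu>" for a b
      using bT that by (auto simp: bij_betw_def inj_on_def)
    have col: "\<theta> \<in> column_stabilizer \<mu> T"
      unfolding column_stabilizer_iff[OF T]
    proof (intro conjI p ballI impI)
      fix c d assume cd: "c \<in> young_cells \<mu>" "d \<in> young_cells \<mu>" "\<theta> (T c) = T d"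
      then obtain c' where c': "c' \<in> young_cells \<mu>" "c = g c'" using img by blast
      then have "c' = d" using \<theta>[OF c'(1)] cd T_eq by auto
      then show "snd c = snd d" using c' snd by simp
    qed
    have act: "act_tabloid \<theta> (tabloid_of \<mu> T) = X"
      unfolding XT' act_tabloid_of_eq_iff[OF p T T']
    proof (intro ballI impI)
      fix c d assume cd: "c \<in> young_cells \<mu>" "d \<in> young_cells \<mu>" "\<theta> (T c) = T' d"
      then obtain c' where c': "c' \<in> young_cells \<mu>" "c = g c'" using img by blast
      then have "T c' = T' d" using \<theta>[OF c'(1)] cd by simp
      then have "T' (f c') = T' d" using 2(1)[OF c'(1)] by simp
      then have "f c' = d" using 2(1)[OF c'(1)] T' cd by (auto simp: tableaux_def bij_betw_def inj_on_def)
      then show "fst c = fst d" using c' by (simp add: g_def)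
    qed
    have "column_sum \<mu> T X Y = of_int (sign \<theta>) * polytabloid \<mu> T Y" for Y
      unfolding act[symmetric] column_sum_act[OF col] polytabloid_eq ..
    \<comment> \<open>Taking Y to be the tabloid of T gives the coefficient of X on the left by
      symmetry, and sign \<theta> times 1 on the right.\<close>
    moreover have "polytabloid \<mu> T X = of_int (sign \<theta>)"
      using calculation[of "tabloid_of \<mu> T"] polytabloid_self[OF T]
      by (simp add: polytabloid_eq column_sum_sym)
    ultimately show ?thesis by simp
  qed
qed

text \<open>The rule g e_T = e_(g T), coefficient by coefficient: conjugation by g carries the
  column stabilizer of T to that of g T and preserves signs.\<close>

lemma polytabloid_act:
  assumes g: "g permutes {..<sum_list \<mu>}" and T: "T \<in> tableaux \<mu>"
  shows "polytabloid \<mu> (g \<circ> T) (act_tabloid g X) = polytabloid \<mu> T X"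
proof -
  let ?S = "{..<sum_list \<mu>}"
  have gT: "g \<circ> T \<in> tableaux \<mu>" by (rule comp_tableau[OF g T])
  have gi: "g (pinv g x) = x" "pinv g (g x) = x" for x
    using permutes_inverses[OF g] by auto
  have "(g \<circ> \<pi> \<circ> pinv g \<in> column_stabilizer \<mu> (g \<circ> T)) \<longleftrightarrow> \<pi> \<in> column_stabilizer \<mu> T" for \<pi>
  proof -
    have "g \<circ> \<pi> \<circ> pinv g permutes ?S \<longleftrightarrow> \<pi> permutes ?S"
    proof
      assume "g \<circ> \<pi> \<circ> pinv g permutes ?S"
      from permutes_compose[OF g permutes_compose[OF this permutes_inv[OF g]]]
      have "pinv g \<circ> (g \<circ> \<pi> \<circ> pinv g) \<circ> g permutes ?S" .
      moreover have "pinv g \<circ> (g \<circ> \<pi> \<circ> pinv g) \<circ> g = \<pi>" by (simp add: fun_eq_iff gi)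
      ultimately show "\<pi> permutes ?S" by simp
    qed (use g permutes_inv[OF g] in \<open>intro permutes_compose\<close>)
    then show ?thesis unfolding column_stabilizer_iff[OF T] column_stabilizer_iff[OF gT]
      using gi by (metis comp_apply)
  qed
  note cs = this
  have sg: "sign (g \<circ> \<pi> \<circ> pinv g) = sign \<pi>" if "\<pi> permutes ?S" for \<pi>
  proof -
    have "permutation g" "permutation \<pi>" "permutation (pinv g)"
      using g that permutes_inv[OF g] permutes_imp_permutation by blast+
    then show ?thesis
      by (simp add: sign_compose permutation_compose sign_inverse)
  qed
  have ac: "act_tabloid (g \<circ> \<pi> \<circ> pinv g) (tabloid_of \<mu> (g \<circ> T)) = act_tabloid g X \<longleftrightarrow>
      act_tabloid \<pi> (tabloid_of \<mu> T) = X" for \<pi>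
  proof -
    have "act_tabloid (g \<circ> \<pi> \<circ> pinv g) (tabloid_of \<mu> (g \<circ> T)) = act_tabloid g (act_tabloid \<pi> (tabloid_of \<mu> T))"
      by (simp add: act_tabloid_of act_tabloid_comp comp_def gi)
    then show ?thesis using act_tabloid_inv(1)[OF g] by metis
  qed
  show ?thesis unfolding polytabloid_eq column_sum_def
  proof (rule sum.reindex_bij_witness[of _ "\<lambda>\<pi>. g \<circ> \<pi> \<circ> pinv g" "\<lambda>\<pi>. pinv g \<circ> \<pi> \<circ> g"])
    fix \<pi>
    have e: "g \<circ> (pinv g \<circ> \<pi> \<circ> g) \<circ> pinv g = \<pi>" by (simp add: fun_eq_iff gi)
    assume "\<pi> \<in> column_stabilizer \<mu> (g \<circ> T)"
    then show "g \<circ> (pinv g \<circ> \<pi> \<circ> g) \<circ> pinv g = \<pi>" "pinv g \<circ> \<pi> \<circ> g \<in> column_stabilizer \<mu> T"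
      using e cs[of "pinv g \<circ> \<pi> \<circ> g"] by simp_all
    then show "of_int (sign (pinv g \<circ> \<pi> \<circ> g)) * (if act_tabloid (pinv g \<circ> \<pi> \<circ> g) (tabloid_of \<mu> T) = X then 1 else 0)
       = of_int (sign \<pi>) * (if act_tabloid \<pi> (tabloid_of \<mu> (g \<circ> T)) = act_tabloid g X then 1 else 0)"
      using sg[of "pinv g \<circ> \<pi> \<circ> g"] ac[of "pinv g \<circ> \<pi> \<circ> g"] column_stabilizer_permutes by auto
  next
    fix \<pi> assume "\<pi> \<in> column_stabilizer \<mu> T"
    then show "pinv g \<circ> (g \<circ> \<pi> \<circ> pinv g) \<circ> g = \<pi>" "g \<circ> \<pi> \<circ> pinv g \<in> column_stabilizer \<mu> (g \<circ> T)"
      using cs[of \<pi>] by (simp_all add: fun_eq_iff gi)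
  qed
qed

section \<open>Cycle types\<close>

text \<open>Induction by splitting off the orbit of one point. Fixed points are kept as cycles of
  length 1, so that the lengths add up to the size of the whole set.\<close>

lemma cycle_lists:
  assumes "permutation \<sigma>" "finite A" "\<sigma> ` A \<subseteq> A"
  shows "\<exists>css. distinct (concat css) \<and> set (concat css) = A \<and> [] \<notin> set css \<and>
    (\<forall>c\<in>set css. \<forall>j<length c. \<sigma> (c ! j) = c ! (Suc j mod length c))"
  using assms(2,3)
proof (induction "card A" arbitrary: A rule: less_induct)
  case less
  show ?case
  proof (cases "A = {}")
    case True
    then show ?thesis by (intro exI[of _ "[]"]) auto
  next
    case False
    then obtain a where a: "a \<in> A" by auto
    define n where "n = least_power \<sigma> a"
    define c where "c = support \<sigma> a"
    have n: "(\<sigma> ^^ n) a = a" "n > 0"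
      unfolding n_def by (rule least_power_of_permutation[OF assms(1)])+
    have c: "length c = n" "\<And>j. j < n \<Longrightarrow> c ! j = (\<sigma> ^^ j) a"
      by (simp_all add: c_def n_def)
    have sc: "set c = range (\<lambda>i. (\<sigma> ^^ i) a)"
      unfolding c_def by (rule support_set[OF assms(1)])
    have dc: "distinct c" using cycle_of_permutation[OF assms(1), of a] by (simp add: c_def)
    have "(\<sigma> ^^ i) a \<in> A" for i by (induction i) (use a less.prems in auto)
    then have cA: "set c \<subseteq> A" using sc by auto
    have inj: "inj \<sigma>" using assms(1) permutation_bijective bij_is_inj by blast
    have "\<sigma> ` (A - set c) \<subseteq> A - set c"
    proof (rule image_subsetI)
      fix x assume x: "x \<in> A - set c"
      have "\<sigma> x \<notin> set c"
      proof
        assume "\<sigma> x \<in> set c"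
        then obtain i where i: "\<sigma> x = (\<sigma> ^^ i) a" using sc by auto
        \<comment> \<open>Every orbit point is the image of an orbit point; for \<open>a\<close>
          itself this uses the period \<open>n\<close>. By injectivity nothing outside the orbit is
          mapped into it.\<close>
        have "\<exists>k. \<sigma> x = (\<sigma> ^^ Suc k) a"
        proof (cases i)
          case 0
          then show ?thesis using i n by (intro exI[of _ "n - 1"]) simp
        qed (use i in blast)
        then obtain k where "\<sigma> x = \<sigma> ((\<sigma> ^^ k) a)" by auto
        then have "x = (\<sigma> ^^ k) a" using inj by (simp add: inj_eq)
        then show False using x sc by auto
      qed
      then show "\<sigma> x \<in> A - set c" using x less.prems by auto
    qed
    moreover have "card (A - set c) < card A"
      using less.prems(1) a sc by (intro psubset_card_mono) (auto intro: range_eqI[of _ _ 0])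
    ultimately obtain css where css: "distinct (concat css)" "set (concat css) = A - set c"
      "[] \<notin> set css" "\<forall>c\<in>set css. \<forall>j<length c. \<sigma> (c ! j) = c ! (Suc j mod length c)"
      using less.hyps[of "A - set c"] less.prems by blast
    have "\<sigma> (c ! j) = c ! (Suc j mod length c)" if "j < length c" for j
    proof (cases "Suc j = n")
      case True
      then show ?thesis using that c n by (auto simp flip: funpow.simps(2)[THEN fun_cong, unfolded comp_apply])
    next
      case False
      then show ?thesis using that c by simp
    qed
    then show ?thesis using css dc cA n c(1)
      by (intro exI[of _ "c # css"]) auto
  qed
qed

text \<open>The cycle type is recorded as a tableau: the rows are the cycles, listed along \<sigma>
  and sorted by decreasing length, so \<sigma> shifts each row cyclically.\<close>

lemma permutation_cycle_type:
  assumes "\<sigma> permutes {..<m}"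
  shows "\<exists>\<mu>\<in>int_partitions m. \<exists>T\<in>tableaux \<mu>. \<forall>(i, j)\<in>young_cells \<mu>.
    \<sigma> (T (i, j)) = T (i, Suc j mod \<mu> ! i)"
proof -
  have "permutation \<sigma>" using assms permutes_imp_permutation by blast
  from cycle_lists[OF this, of "{..<m}"] permutes_image[OF assms]
  obtain css where css: "distinct (concat css)" "set (concat css) = {..<m}" "[] \<notin> set css"
    "\<And>c j. \<lbrakk>c \<in> set css; j < length c\<rbrakk> \<Longrightarrow> \<sigma> (c ! j) = c ! (Suc j mod length c)"
    by auto
  define ds where "ds = rev (sort_key length css)"
  have set_ds: "set ds = set css" by (simp add: ds_def)
  have "mset (concat ds) = mset (concat css)"
    by (simp add: ds_def mset_concat flip: sum_mset_sum_list)
  then have dist: "distinct (concat ds)" using css(1) mset_eq_imp_distinct_iff by blast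
  have set_c: "set (concat ds) = {..<m}" using css(2) set_ds by simp
  define \<mu> where "\<mu> = map length ds"
  define T where "T = (\<lambda>(i, j). ds ! i ! j)"
  have len: "length (concat ds) = m"
    using distinct_card[OF dist] set_c by simp
  have "sorted_wrt (\<ge>) \<mu>"
    by (simp add: \<mu>_def ds_def sorted_wrt_rev flip: rev_map)
  then have \<mu>: "\<mu> \<in> int_partitions m"
    using css(3) set_ds len by (auto simp: int_partitions_def \<mu>_def length_concat)
  have sum: "sum_list \<mu> = m" using \<mu> by (rule int_partitions_sum)
  have "T ` young_cells \<mu> = set (concat ds)"
    by (fastforce simp: T_def young_cells_def \<mu>_def in_set_conv_nth image_iff)
  then have im: "T ` young_cells \<mu> = {..<m}" using set_c by simp
  moreover have "inj_on T (young_cells \<mu>)"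
    by (rule eq_card_imp_inj_on) (simp_all add: im card_young_cells sum)
  ultimately have T: "T \<in> tableaux \<mu>" by (simp add: tableaux_def bij_betw_def sum)
  have "\<forall>(i, j)\<in>young_cells \<mu>. \<sigma> (T (i, j)) = T (i, Suc j mod \<mu> ! i)"
    using css(4) nth_mem[of _ ds] unfolding set_ds by (auto simp: T_def young_cells_def \<mu>_def)
  then show ?thesis using \<mu> T by blast
qed

text \<open>The permutation that carries one cycle tableau to the other intertwines the two cyclic
  shifts of the rows.\<close>

lemma same_cycle_type_conjugate:
  assumes "\<sigma> permutes {..<m}" "\<sigma>' permutes {..<m}" "\<mu> \<in> int_partitions m"
    and T: "T \<in> tableaux \<mu>" and T': "T' \<in> tableaux \<mu>"
    and \<sigma>: "\<forall>(i, j)\<in>young_cells \<mu>. \<sigma> (T (i, j)) = T (i, Suc j mod \<mu> ! i)"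
    and \<sigma>': "\<forall>(i, j)\<in>young_cells \<mu>. \<sigma>' (T' (i, j)) = T' (i, Suc j mod \<mu> ! i)"
  shows "\<exists>\<kappa>. \<kappa> permutes {..<m} \<and> \<sigma>' \<circ> \<kappa> = \<kappa> \<circ> \<sigma>"
proof -
  have m: "sum_list \<mu> = m" by (rule int_partitions_sum) fact
  obtain \<kappa> where \<kappa>: "\<kappa> permutes {..<m}" "\<And>c. c \<in> young_cells \<mu> \<Longrightarrow> \<kappa> (T c) = T' c"
    using tableaux_permutation[OF T T'] m by auto
  have "\<sigma>' (\<kappa> x) = \<kappa> (\<sigma> x)" for x
  proof (cases "x \<in> {..<m}")
    case True
    then have "x \<in> T ` young_cells \<mu>" using T m by (auto simp: tableaux_def bij_betw_def)
    then obtain i j where ij: "(i, j) \<in> young_cells \<mu>" "x = T (i, j)" by auto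
    then have "(i, Suc j mod \<mu> ! i) \<in> young_cells \<mu>" by (auto simp: young_cells_def)
    then show ?thesis using ij \<kappa>(2) bspec[OF \<sigma> ij(1)] bspec[OF \<sigma>' ij(1)] by simp
  next
    case False
    then show ?thesis using permutes_not_in[OF \<kappa>(1)] permutes_not_in[OF assms(1)]
        permutes_not_in[OF assms(2)] by simp
  qed
  then show ?thesis using \<kappa>(1) by (auto simp: fun_eq_iff)
qed

section \<open>Linear algebra\<close>

text \<open>A square system. The trivial kernel makes the rows of \<open>h\<close> independent
  inside the span of as many unit vectors; a right-hand side outside their span would extend them to
  too large an independent set.\<close>

lemma solve_of_trivial_kernel:
  fixes h :: "'p \<Rightarrow> 'p \<Rightarrow> complex"
  assumes fin: "finite P"
    and ker: "\<And>c. (\<And>l. l \<in> P \<Longrightarrow> (\<Sum>k\<in>P. c k * h k l) = 0) \<Longrightarrow> \<forall>k\<in>P. c k = 0"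
  shows "\<exists>c. \<forall>l\<in>P. (\<Sum>k\<in>P. c k * h k l) = d l"
proof -
  \<comment> \<open>Functions on \<open>P\<close> are represented by functions on the whole type
    that vanish outside \<open>P\<close>.\<close>
  define r where "r f = (\<lambda>l. if l \<in> P then f l else 0)" for f :: "'p \<Rightarrow> complex"
  define E where "E = (ebasis ` P :: ('p \<Rightarrow> complex) set)"
  define B where "B = (\<lambda>k. r (h k)) ` P"
  have sumapp: "(\<Sum>k\<in>K. fscale (c k) (f k)) l = (\<Sum>k\<in>K. c k * f k l)"
    for K :: "'q set" and c and f :: "'q \<Rightarrow> 'p \<Rightarrow> complex" and l
    using lin_ext_apply[of K f c l] by (simp add: lin_ext_def)
  have rE: "r f \<in> cfun.span E" for f
  proof -
    have "r f = (\<Sum>k\<in>P. fscale (f k) (ebasis k))"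
    proof
      fix l show "r f l = (\<Sum>k\<in>P. fscale (f k) (ebasis k)) l"
        by (simp add: sumapp ebasis_def r_def fin if_distrib cong: if_cong)
    qed
    also have "\<dots> \<in> cfun.span E"
      by (intro cfun.span_sum cfun.span_scale cfun.span_base) (simp add: E_def)
    finally show ?thesis .
  qed
  have inj: "inj_on (\<lambda>k. r (h k)) P"
  proof (rule inj_onI, rule ccontr)
    fix k k' assume k: "k \<in> P" "k' \<in> P" "r (h k) = r (h k')" "k \<noteq> k'"
    \<comment> \<open>Two equal rows would put the difference of two unit vectors into the
      kernel.\<close>
    let ?c = "\<lambda>j. (if j = k then 1 else if j = k' then -1 else 0 :: complex)"
    have "(\<Sum>j\<in>P. ?c j * h j l) = 0" if "l \<in> P" for l
    proof -
      have "(\<Sum>j\<in>P. ?c j * h j l) = (\<Sum>j\<in>{k, k'}. ?c j * h j l)"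
        by (rule sum.mono_neutral_right) (use fin k in auto)
      also have "\<dots> = 0" using k(4) fun_cong[OF k(3), of l] that by (simp add: r_def)
      finally show ?thesis .
    qed
    from ker[OF this] k(1) show False by auto
  qed
  have ind: "cfun.independent B"
  proof (rule cfun.independent_if_scalars_zero)
    fix f x assume s: "(\<Sum>x\<in>B. fscale (f x) x) = 0" and x: "x \<in> B"
    have "(\<Sum>k\<in>P. f (r (h k)) * h k l) = 0" if "l \<in> P" for l
    proof -
      have "(\<Sum>k\<in>P. fscale (f (r (h k))) (r (h k))) = 0"
        using s unfolding B_def by (simp add: sum.reindex[OF inj])
      from fun_cong[OF this, of l] show ?thesis using that by (simp add: sumapp r_def)
    qed
    from ker[OF this] x show "f x = 0" by (auto simp: B_def)
  qed (simp add: B_def fin)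
  have cE: "card E \<le> card P" unfolding E_def by (rule card_image_le[OF fin])
  have cB: "card B = card P" unfolding B_def by (rule card_image[OF inj])
  have "r d \<in> cfun.span B"
  proof (rule ccontr)
    assume n: "r d \<notin> cfun.span B"
    then have "cfun.independent (insert (r d) B)" using ind by (simp add: cfun.independent_insert)
    moreover have "insert (r d) B \<subseteq> cfun.span E" using rE by (auto simp: B_def)
    ultimately have "card (insert (r d) B) \<le> card E"
      using cfun.independent_span_bound[of E] fin by (simp add: E_def)
    moreover have "r d \<notin> B" using n cfun.span_base by blast
    ultimately show False using cE cB fin by (simp add: B_def)
  qed
  then obtain u where u: "r d = (\<Sum>x\<in>B. fscale (u x) x)"
    using cfun.span_finite[of B] fin by (auto simp: B_def)
  have "r d = (\<Sum>k\<in>P. fscale (u (r (h k))) (r (h k)))"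
    unfolding u B_def by (simp add: sum.reindex[OF inj])
  have "(\<Sum>k\<in>P. u (r (h k)) * h k l) = d l" if "l \<in> P" for l
    using fun_cong[OF \<open>r d = (\<Sum>k\<in>P. fscale (u (r (h k))) (r (h k)))\<close>, of l] that
    unfolding sumapp by (simp add: r_def)
  then show ?thesis by (intro exI[of _ "\<lambda>k. u (r (h k))"]) simp
qed

section \<open>Matrix coefficients of Specht modules\<close>

text \<open>The tensor square of the Specht module, realized as functions on pairs of tabloids. The
  space of \<open>TVV\<close> consists of one copy for each shuffle.\<close>

definition specht_tensors :: "nat list \<Rightarrow> (nat set list \<times> nat set list \<Rightarrow> complex) set" where
  "specht_tensors \<mu> = cfun.span ((\<lambda>(T, T') (X, Y). polytabloid \<mu> T X * polytabloid \<mu> T' Y) `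
     (tableaux \<mu> \<times> tableaux \<mu>))"

lemma subspace_specht_tensors: "cfun.subspace (specht_tensors \<mu>)"
  by (simp add: specht_tensors_def)

lemma specht_tensors_base:
  "\<lbrakk>T \<in> tableaux \<mu>; T' \<in> tableaux \<mu>\<rbrakk> \<Longrightarrow>
    (\<lambda>(X, Y). polytabloid \<mu> T X * polytabloid \<mu> T' Y) \<in> specht_tensors \<mu>"
  unfolding specht_tensors_def by (rule cfun.span_base) (auto intro!: image_eqI[of _ _ "(T, T')"])

lemma specht_tensors_induct:
  assumes "G \<in> specht_tensors \<mu>" "cfun.subspace {G. Q G}"
    and "\<And>T T'. \<lbrakk>T \<in> tableaux \<mu>; T' \<in> tableaux \<mu>\<rbrakk> \<Longrightarrow>
      Q (\<lambda>(X, Y). polytabloid \<mu> T X * polytabloid \<mu> T' Y)"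
  shows "Q G"
proof -
  have "specht_tensors \<mu> \<subseteq> {G. Q G}"
    unfolding specht_tensors_def by (rule cfun.span_minimal) (use assms in auto)
  then show ?thesis using assms(1) by blast
qed

lemma polytabloid_support:
  assumes "T \<in> tableaux \<mu>" "X \<notin> tabloids \<mu>"
  shows "polytabloid \<mu> T X = 0"
proof -
  have "act_tabloid \<pi> (tabloid_of \<mu> T) \<noteq> X" if "\<pi> \<in> column_stabilizer \<mu> T" for \<pi>
    using act_tabloid_closed[OF column_stabilizer_permutes[OF that], of "tabloid_of \<mu> T"] assms
    by (auto simp: tabloids_def)
  then show ?thesis unfolding polytabloid_eq column_sum_def by (intro sum.neutral) auto
qed

lemma specht_tensors_support:
  assumes "G \<in> specht_tensors \<mu>" "X \<notin> tabloids \<mu> \<or> Y \<notin> tabloids \<mu>"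
  shows "G (X, Y) = 0"
  using assms(1)
  by (rule specht_tensors_induct) (use assms(2) in \<open>auto simp: cfun.subspace_def fscale_def polytabloid_support\<close>)

lemma specht_tensors_cnj:
  assumes "G \<in> specht_tensors \<mu>"
  shows "(\<lambda>p. cnj (G p)) \<in> specht_tensors \<mu>"
  using assms
proof (rule specht_tensors_induct)
  have "(\<lambda>p. cnj ((G + H) p)) = (\<lambda>p. cnj (G p)) + (\<lambda>p. cnj (H p))"
    "(\<lambda>p. cnj (fscale c G p)) = fscale (cnj c) (\<lambda>p. cnj (G p))"
    "(\<lambda>p. cnj ((0 :: nat set list \<times> nat set list \<Rightarrow> complex) p)) = 0" for G H :: "nat set list \<times> nat set list \<Rightarrow> complex" and c
    by (auto simp: fscale_def)
  then show "cfun.subspace {G. (\<lambda>p. cnj (G p)) \<in> specht_tensors \<mu>}"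
    using subspace_specht_tensors[of \<mu>] by (simp only: cfun.subspace_def mem_Collect_eq) blast
  fix T T' assume "T \<in> tableaux \<mu>" "T' \<in> tableaux \<mu>"
  then show "(\<lambda>p. cnj ((\<lambda>(X, Y). polytabloid \<mu> T X * polytabloid \<mu> T' Y) p)) \<in> specht_tensors \<mu>"
    using specht_tensors_base by (simp add: case_prod_unfold cnj_polytabloid)
qed

text \<open>By linearity G pairs to zero with the whole space, in particular with its own conjugate,
  and that pairing is the sum of the squared absolute values of G.\<close>

lemma specht_tensors_nondegenerate:
  assumes G: "G \<in> specht_tensors \<mu>"
    and zero: "\<And>T T'. \<lbrakk>T \<in> tableaux \<mu>; T' \<in> tableaux \<mu>\<rbrakk> \<Longrightarrow>
      (\<Sum>X\<in>tabloids \<mu>. \<Sum>Y\<in>tabloids \<mu>. G (X, Y) * (polytabloid \<mu> T X * polytabloid \<mu> T' Y)) = 0"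
  shows "G = 0"
proof -
  let ?I = "tabloids \<mu> \<times> tabloids \<mu>"
  have "(\<Sum>p\<in>?I. G p * H p) = 0" if "H \<in> specht_tensors \<mu>" for H
    using that
  proof (rule specht_tensors_induct)
    show "cfun.subspace {H. (\<Sum>p\<in>?I. G p * H p) = 0}"
      by (auto simp: cfun.subspace_def fscale_def algebra_simps sum.distrib simp flip: sum_distrib_left)
  qed (use zero in \<open>simp add: sum.cartesian_product case_prod_unfold\<close>)
  from this[OF specht_tensors_cnj[OF G]] have "(\<Sum>p\<in>?I. complex_of_real ((cmod (G p))\<^sup>2)) = 0"
    by (simp add: complex_norm_square del: of_real_power)
  then have "(\<Sum>p\<in>?I. (cmod (G p))\<^sup>2) = 0"
    unfolding of_real_sum[symmetric] by (simp only: of_real_eq_0_iff)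
  then have "\<forall>p\<in>?I. G p = 0"
    by (subst (asm) sum_nonneg_eq_0_iff) (auto simp: finite_tabloids)
  then show ?thesis using specht_tensors_support[OF G] by (auto simp: fun_eq_iff)
qed

text \<open>On a pure tensor v, w this sums v(X) w(\<sigma> X) over the tabloids X, which is the
  bilinear pairing of \<sigma> v with w. All partitions are added up, so independence across shapes
  is part of injectivity.\<close>

definition matrix_coeff ::
    "nat \<Rightarrow> (nat list \<Rightarrow> nat set list \<times> nat set list \<Rightarrow> complex) \<Rightarrow> (nat \<Rightarrow> nat) \<Rightarrow> complex" where
  "matrix_coeff m G \<sigma> = (\<Sum>\<mu>\<in>int_partitions m. \<Sum>X\<in>tabloids \<mu>. G \<mu> (X, act_tabloid \<sigma> X))"

text \<open>Two tableaux with equal cells may still differ as functions off the diagram; this lets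
  T' be replaced by \<pi> after T.\<close>

lemma polytabloid_cong:
  assumes "T \<in> tableaux \<mu>" "T' \<in> tableaux \<mu>" "\<And>c. c \<in> young_cells \<mu> \<Longrightarrow> T c = T' c"
  shows "polytabloid \<mu> T = polytabloid \<mu> T'"
proof -
  have "column_stabilizer \<mu> T = column_stabilizer \<mu> T'"
    unfolding set_eq_iff by (simp add: column_stabilizer_iff assms cong: ball_cong)
  moreover have "tabloid_of \<mu> T = tabloid_of \<mu> T'"
    using act_tabloid_of_eq_iff[OF permutes_id assms(1,2)] assms(2,3)
    by (auto simp: tableaux_def bij_betw_def inj_on_def)
  ultimately show ?thesis by (auto simp: fun_eq_iff polytabloid_eq column_sum_def)
qed

text \<open>Let \<nu> maximize the statistic among the nonzero components. Summing the vanishing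
  coefficients at \<pi> \<tau>, with the sign of \<tau> over the column stabilizer of T, kills the
  other components by \<open>column_sum_eq_0\<close>. On \<nu>, rank one leaves the pairing of G
  with the tensor of the polytabloids of T and \<pi> T. All pairs of tableaux arise in this way, so
  nondegeneracy contradicts the choice of \<nu>.\<close>

lemma matrix_coeff_inj:
  assumes G: "\<And>\<mu>. \<mu> \<in> int_partitions m \<Longrightarrow> G \<mu> \<in> specht_tensors \<mu>"
    and zero: "\<And>\<sigma>. \<sigma> permutes {..<m} \<Longrightarrow> matrix_coeff m G \<sigma> = 0"
    and \<mu>: "\<mu> \<in> int_partitions m"
  shows "G \<mu> = 0"
proof (rule ccontr)
  assume "G \<mu> \<noteq> 0"
  define A where "A = {\<mu> \<in> int_partitions m. G \<mu> \<noteq> 0}"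
  have "finite A" "A \<noteq> {}" using \<mu> \<open>G \<mu> \<noteq> 0\<close> by (auto simp: A_def finite_int_partitions)
  then have "Max (row_index_sum ` A) \<in> row_index_sum ` A" by simp
  then obtain \<nu> where \<nu>A: "\<nu> \<in> A" and M: "row_index_sum \<nu> = Max (row_index_sum ` A)" by auto
  have max: "row_index_sum \<kappa> \<le> row_index_sum \<nu>" if "\<kappa> \<in> A" for \<kappa>
    unfolding M using \<open>finite A\<close> that by simp
  from \<nu>A have \<nu>: "\<nu> \<in> int_partitions m" "G \<nu> \<noteq> 0" and m: "sum_list \<nu> = m"
    by (auto simp: A_def int_partitions_sum)
  have "G \<nu> = 0"
  proof (rule specht_tensors_nondegenerate[OF G[OF \<nu>(1)]])
    fix T T' assume T: "T \<in> tableaux \<nu>" and T': "T' \<in> tableaux \<nu>"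
    obtain \<pi> where \<pi>: "\<pi> permutes {..<m}" "\<And>c. c \<in> young_cells \<nu> \<Longrightarrow> \<pi> (T c) = T' c"
      using tableaux_permutation[OF T T'] m by auto
    have \<pi>\<nu>: "\<pi> permutes {..<sum_list \<nu>}" using \<pi> m by simp
    have e': "polytabloid \<nu> T' = polytabloid \<nu> (\<pi> \<circ> T)"
      by (rule polytabloid_cong[OF T' comp_tableau[OF \<pi>\<nu> T]]) (simp add: \<pi>)
    let ?C = "column_stabilizer \<nu> T"
    have C: "\<tau> permutes {..<m}" if "\<tau> \<in> ?C" for \<tau> using column_stabilizer_permutes[OF that] m by simp
    have tm: "(\<Sum>\<tau>\<in>?C. of_int (sign \<tau>) * (\<Sum>X\<in>tabloids \<kappa>. G \<kappa> (X, act_tabloid (\<pi> \<circ> \<tau>) X))) =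
        (if \<kappa> = \<nu> then \<Sum>X\<in>tabloids \<nu>. \<Sum>Y\<in>tabloids \<nu>.
          G \<nu> (X, Y) * (polytabloid \<nu> T X * polytabloid \<nu> T' Y) else 0)"
      (is "?l = _") if \<kappa>: "\<kappa> \<in> int_partitions m" for \<kappa>
    proof -
      have s\<kappa>: "sum_list \<kappa> = m" using \<kappa> by (rule int_partitions_sum)
      \<comment> \<open>A dummy sum over Y separates G from the dependence on \<tau>, so that the
        signed sum over \<tau> can be collected into \<open>column_sum\<close>.\<close>
      have pick: "G \<kappa> (X, act_tabloid \<pi> (act_tabloid \<tau> X)) = (\<Sum>Y\<in>tabloids \<kappa>.
          G \<kappa> (X, act_tabloid \<pi> Y) * (if act_tabloid \<tau> X = Y then 1 else 0))"
        if "X \<in> tabloids \<kappa>" "\<tau> \<in> ?C" for X \<tau>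
        using act_tabloid_closed[of \<tau> \<kappa> X] C[OF that(2)] that(1) s\<kappa>
        by (simp add: finite_tabloids if_distrib cong: if_cong)
      have "?l = (\<Sum>\<tau>\<in>?C. \<Sum>X\<in>tabloids \<kappa>. \<Sum>Y\<in>tabloids \<kappa>. G \<kappa> (X, act_tabloid \<pi> Y) *
          (of_int (sign \<tau>) * (if act_tabloid \<tau> X = Y then 1 else 0)))"
        by (simp add: pick sum_distrib_left mult_ac flip: act_tabloid_comp cong: sum.cong)
      also have "\<dots> = (\<Sum>X\<in>tabloids \<kappa>. \<Sum>Y\<in>tabloids \<kappa>. G \<kappa> (X, act_tabloid \<pi> Y) * column_sum \<nu> T X Y)"
        unfolding column_sum_def sum_distrib_left
        by (subst sum.swap, rule sum.cong[OF refl], rule sum.swap)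
      finally have l: "?l = \<dots>" .
      show ?thesis
      proof (cases "\<kappa> = \<nu>")
        case False
        have "G \<kappa> (X, act_tabloid \<pi> Y) * column_sum \<nu> T X Y = 0" if "X \<in> tabloids \<kappa>" for X Y
        proof (cases "\<kappa> \<in> A")
          case True
          then show ?thesis
            using column_sum_eq_0[OF \<nu>(1) \<kappa> T that max[OF True]] False by simp
        next
          case False
          then show ?thesis using \<kappa> by (simp add: A_def)
        qed
        then have "(\<Sum>X\<in>tabloids \<kappa>. \<Sum>Y\<in>tabloids \<kappa>. G \<kappa> (X, act_tabloid \<pi> Y) * column_sum \<nu> T X Y) = 0"
          by (intro sum.neutral ballI)
        then show ?thesis unfolding l using False by simp
      next
        case True
        \<comment> \<open>Reindexing Y by \<pi> turns the second polytabloid factor of T into that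
          of T'.\<close>
        have "(\<Sum>Y\<in>tabloids \<nu>. G \<nu> (X, act_tabloid \<pi> Y) * column_sum \<nu> T X Y) =
            (\<Sum>Y\<in>tabloids \<nu>. G \<nu> (X, Y) * (polytabloid \<nu> T X * polytabloid \<nu> T' Y))"
          if X: "X \<in> tabloids \<nu>" for X
        proof -
          have "(\<Sum>Y\<in>tabloids \<nu>. G \<nu> (X, act_tabloid \<pi> Y) * column_sum \<nu> T X Y) =
            (\<Sum>Y\<in>tabloids \<nu>. G \<nu> (X, act_tabloid \<pi> Y) * (polytabloid \<nu> T X * polytabloid \<nu> T' (act_tabloid \<pi> Y)))"
            by (simp add: column_sum_rank_one[OF \<nu>(1) T X] e' polytabloid_act[OF \<pi>\<nu> T])
          also have "\<dots> = (\<Sum>Y\<in>tabloids \<nu>. G \<nu> (X, Y) * (polytabloid \<nu> T X * polytabloid \<nu> T' Y))"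
            by (rule sum.reindex_bij_betw[OF act_tabloid_bij[OF \<pi>\<nu>]])
          finally show ?thesis .
        qed
        then show ?thesis using l unfolding True by simp
      qed
    qed
    have "0 = (\<Sum>\<tau>\<in>?C. of_int (sign \<tau>) * matrix_coeff m G (\<pi> \<circ> \<tau>))"
      using zero permutes_compose[OF C \<pi>(1)] by simp
    also have "\<dots> = (\<Sum>\<kappa>\<in>int_partitions m. \<Sum>\<tau>\<in>?C.
        of_int (sign \<tau>) * (\<Sum>X\<in>tabloids \<kappa>. G \<kappa> (X, act_tabloid (\<pi> \<circ> \<tau>) X)))"
      unfolding matrix_coeff_def sum_distrib_left by (rule sum.swap)
    also have "\<dots> = (\<Sum>X\<in>tabloids \<nu>. \<Sum>Y\<in>tabloids \<nu>.
        G \<nu> (X, Y) * (polytabloid \<nu> T X * polytabloid \<nu> T' Y))"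
      using \<nu>(1) by (simp add: tm finite_int_partitions cong: sum.cong)
    finally show "(\<Sum>X\<in>tabloids \<nu>. \<Sum>Y\<in>tabloids \<nu>.
        G \<nu> (X, Y) * (polytabloid \<nu> T X * polytabloid \<nu> T' Y)) = 0" by simp
  qed
  then show False using \<nu>(2) by simp
qed

text \<open>Translating the argument of the polytabloid of T by \<tau> gives the polytabloid of the
  translate of T by the inverse of \<tau>, so spanning tensors go to spanning tensors.\<close>

lemma specht_tensors_act:
  assumes \<tau>: "\<tau> permutes {..<sum_list \<mu>}" and \<tau>': "\<tau>' permutes {..<sum_list \<mu>}"
    and G: "G \<in> specht_tensors \<mu>"
  shows "(\<lambda>(X, Y). G (act_tabloid \<tau> X, act_tabloid \<tau>' Y)) \<in> specht_tensors \<mu>"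
  using G
proof (rule specht_tensors_induct)
  let ?f = "\<lambda>G (X, Y). G (act_tabloid \<tau> X, act_tabloid \<tau>' Y)"
  have "?f (G + H) = ?f G + ?f H" "?f (fscale c G) = fscale c (?f G)" "?f (0 :: nat set list \<times> nat set list \<Rightarrow> complex) = 0"
    for G H :: "nat set list \<times> nat set list \<Rightarrow> complex" and c
    by (auto simp: fscale_def)
  then show "cfun.subspace {G. ?f G \<in> specht_tensors \<mu>}"
    using subspace_specht_tensors[of \<mu>] by (simp only: cfun.subspace_def mem_Collect_eq) blast
  fix T T' assume T: "T \<in> tableaux \<mu>" "T' \<in> tableaux \<mu>"
  have "polytabloid \<mu> T (act_tabloid \<tau> X) = polytabloid \<mu> (pinv \<tau> \<circ> T) X"
    if "\<tau> permutes {..<sum_list \<mu>}" "T \<in> tableaux \<mu>" for \<tau> T X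
    using polytabloid_act[OF permutes_inv[OF that(1)] that(2), of "act_tabloid \<tau> X"]
    by (simp add: act_tabloid_inv[OF that(1)])
  then show "?f (\<lambda>(X, Y). polytabloid \<mu> T X * polytabloid \<mu> T' Y) \<in> specht_tensors \<mu>"
    using specht_tensors_base[OF comp_tableau[OF permutes_inv[OF \<tau>] T(1)] comp_tableau[OF permutes_inv[OF \<tau>'] T(2)]] T \<tau> \<tau>'
    by simp
qed

lemma specht_tensors_swap:
  assumes "G \<in> specht_tensors \<mu>"
  shows "(\<lambda>(X, Y). G (Y, X)) \<in> specht_tensors \<mu>"
  using assms
proof (rule specht_tensors_induct)
  let ?f = "\<lambda>G (X, Y). G (Y, X)"
  have "?f (G + H) = ?f G + ?f H" "?f (fscale c G) = fscale c (?f G)" "?f (0 :: nat set list \<times> nat set list \<Rightarrow> complex) = 0"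
    for G H :: "nat set list \<times> nat set list \<Rightarrow> complex" and c
    by (auto simp: fscale_def)
  then show "cfun.subspace {G. ?f G \<in> specht_tensors \<mu>}"
    using subspace_specht_tensors[of \<mu>] by (simp only: cfun.subspace_def mem_Collect_eq) blast
  fix T T' assume "T \<in> tableaux \<mu>" "T' \<in> tableaux \<mu>"
  then show "?f (\<lambda>(X, Y). polytabloid \<mu> T X * polytabloid \<mu> T' Y) \<in> specht_tensors \<mu>"
    using specht_tensors_base[of T' \<mu> T] by (simp add: mult.commute)
qed

lemma specht_tensors_sum:
  assumes "\<And>i. i \<in> I \<Longrightarrow> G i \<in> specht_tensors \<mu>"
  shows "(\<lambda>p. \<Sum>i\<in>I. c i * G i p) \<in> specht_tensors \<mu>"
proof -
  have "(\<lambda>p. \<Sum>i\<in>I. c i * G i p) = (\<Sum>i\<in>I. fscale (c i) (G i))"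
    using lin_ext_apply[of I G c] by (auto simp: lin_ext_def fun_eq_iff)
  also have "\<dots> \<in> specht_tensors \<mu>"
    using assms by (intro cfun.subspace_sum[OF subspace_specht_tensors]
        cfun.subspace_scale[OF subspace_specht_tensors])
  finally show ?thesis .
qed

text \<open>Averaging over conjugation gives one class function per partition. These are linearly
  independent, and there are at most as many conjugacy classes as partitions, so they span all
  class functions; in particular they yield the indicator function of the identity.\<close>

lemma matrix_coeff_delta:
  "\<exists>G. (\<forall>\<mu>\<in>int_partitions m. G \<mu> \<in> specht_tensors \<mu>) \<and>
    (\<forall>\<sigma>. \<sigma> permutes {..<m} \<longrightarrow> matrix_coeff m G \<sigma> = (if \<sigma> = id then 1 else 0))"
proof -
  let ?P = "int_partitions m" and ?S = "{g. g permutes {..<m}}"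
  have finS: "finite ?S" by (rule finite_permutations) simp
  define T0 where "T0 \<mu> = (SOME T. T \<in> tableaux \<mu>)" for \<mu>
  have T0: "T0 \<mu> \<in> tableaux \<mu>" for \<mu> unfolding T0_def by (rule some_in_eq[THEN iffD2, OF tableaux_nonempty])
  define e where "e \<mu> g = polytabloid \<mu> (g \<circ> T0 \<mu>)" for \<mu> g
  define a where "a \<mu> = (\<lambda>(X, Y). \<Sum>g\<in>?S. e \<mu> g X * e \<mu> g Y)" for \<mu>
  have sum: "sum_list \<mu> = m" if "\<mu> \<in> ?P" for \<mu> using that by (rule int_partitions_sum)
  have tab: "g \<circ> T0 \<mu> \<in> tableaux \<mu>" if "g \<in> ?S" "\<mu> \<in> ?P" for g \<mu>
    using that comp_tableau[OF _ T0] sum by auto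
  have a_mem: "a \<mu> \<in> specht_tensors \<mu>" if "\<mu> \<in> ?P" for \<mu>
    using specht_tensors_sum[of ?S "\<lambda>g (X, Y). e \<mu> g X * e \<mu> g Y" \<mu> "\<lambda>_. 1"]
      specht_tensors_base[OF tab tab] that
    by (simp add: a_def e_def case_prod_unfold)
  define h where "h \<mu> \<sigma> = (\<Sum>X\<in>tabloids \<mu>. a \<mu> (X, act_tabloid \<sigma> X))" for \<mu> \<sigma>
  have a_inv: "a \<mu> (act_tabloid \<kappa> X, act_tabloid \<kappa> Y) = a \<mu> (X, Y)" if \<kappa>: "\<kappa> \<in> ?S" and \<mu>: "\<mu> \<in> ?P" for \<mu> \<kappa> X Y
  proof -
    have k: "\<kappa> permutes {..<m}" using \<kappa> by simp
    have "e \<mu> (\<kappa> \<circ> g) (act_tabloid \<kappa> X) = e \<mu> g X" if "g \<in> ?S" for g X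
      using polytabloid_act[of \<kappa> \<mu> "g \<circ> T0 \<mu>" X] k tab[OF that \<mu>] sum[OF \<mu>]
      by (simp add: e_def comp_assoc)
    then have "a \<mu> (X, Y) = (\<Sum>g\<in>?S. e \<mu> (\<kappa> \<circ> g) (act_tabloid \<kappa> X) * e \<mu> (\<kappa> \<circ> g) (act_tabloid \<kappa> Y))"
      by (simp add: a_def)
    also have "\<dots> = a \<mu> (act_tabloid \<kappa> X, act_tabloid \<kappa> Y)"
      unfolding a_def prod.case
      by (rule sum.reindex_bij_witness[of _ "\<lambda>g. pinv \<kappa> \<circ> g" "\<lambda>g. \<kappa> \<circ> g"])
        (auto simp: permutes_inv_o[OF k] permutes_compose k permutes_inv simp flip: comp_assoc)
    finally show ?thesis ..
  qed
  have h_class: "h \<mu> \<sigma>' = h \<mu> \<sigma>" if "\<sigma>' \<circ> \<kappa> = \<kappa> \<circ> \<sigma>" "\<kappa> \<in> ?S" "\<mu> \<in> ?P" for \<mu> \<kappa> \<sigma> \<sigma>'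
  proof -
    have "h \<mu> \<sigma>' = (\<Sum>X\<in>tabloids \<mu>. a \<mu> (act_tabloid \<kappa> X, act_tabloid \<sigma>' (act_tabloid \<kappa> X)))"
      unfolding h_def
      by (rule sum.reindex_bij_betw[OF act_tabloid_bij, symmetric]) (use that sum in auto)
    also have "\<dots> = (\<Sum>X\<in>tabloids \<mu>. a \<mu> (act_tabloid \<kappa> X, act_tabloid \<kappa> (act_tabloid \<sigma> X)))"
      by (simp add: act_tabloid_comp that(1))
    also have "\<dots> = h \<mu> \<sigma>" by (simp add: a_inv[OF that(2,3)] h_def)
    finally show ?thesis .
  qed
  define cyc where "cyc \<mu> \<sigma> \<longleftrightarrow> \<sigma> \<in> ?S \<and> (\<exists>T\<in>tableaux \<mu>.
    \<forall>(i, j)\<in>young_cells \<mu>. \<sigma> (T (i, j)) = T (i, Suc j mod \<mu> ! i))" for \<mu> \<sigma>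
  have conj: "\<exists>\<kappa>\<in>?S. \<sigma>' \<circ> \<kappa> = \<kappa> \<circ> \<sigma>" if "\<mu> \<in> ?P" "cyc \<mu> \<sigma>" "cyc \<mu> \<sigma>'" for \<mu> \<sigma> \<sigma>'
    using that same_cycle_type_conjugate[of \<sigma> m \<sigma>' \<mu>] unfolding cyc_def by blast
  \<comment> \<open>\<open>rep l\<close> stands for the class of cycle type l. What enters below is
    that every permutation is conjugate to \<open>rep l\<close> for some partition l, so that a
    class function vanishing at all \<open>rep l\<close> vanishes everywhere.\<close>
  define rep where "rep \<mu> = (SOME \<sigma>. cyc \<mu> \<sigma>)" for \<mu>
  have repr: "\<exists>\<mu>\<in>?P. \<exists>\<kappa>\<in>?S. rep \<mu> \<circ> \<kappa> = \<kappa> \<circ> \<sigma>" if \<sigma>: "\<sigma> \<in> ?S" for \<sigma>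
  proof -
    obtain \<mu> where \<mu>: "\<mu> \<in> ?P" "cyc \<mu> \<sigma>"
      using permutation_cycle_type[of \<sigma> m] \<sigma> unfolding cyc_def by blast
    then have "cyc \<mu> (rep \<mu>)" unfolding rep_def by (intro someI[of "cyc \<mu>"])
    then show ?thesis using conj \<mu> by blast
  qed
  have mc: "matrix_coeff m (\<lambda>\<mu>. fscale (c \<mu>) (a \<mu>)) \<sigma> = (\<Sum>\<mu>\<in>?P. c \<mu> * h \<mu> \<sigma>)" for c \<sigma>
    by (simp add: matrix_coeff_def h_def fscale_def sum_distrib_left)
  have scale_mem: "fscale (c \<mu>) (a \<mu>) \<in> specht_tensors \<mu>" if "\<mu> \<in> ?P" for c \<mu>
    by (rule cfun.subspace_scale[OF subspace_specht_tensors a_mem[OF that]])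
  have "\<exists>c. \<forall>l\<in>?P. (\<Sum>\<mu>\<in>?P. c \<mu> * h \<mu> (rep l)) = (if rep l = id then 1 else 0)"
  proof (rule solve_of_trivial_kernel[OF finite_int_partitions])
    fix c assume z: "\<And>l. l \<in> ?P \<Longrightarrow> (\<Sum>\<mu>\<in>?P. c \<mu> * h \<mu> (rep l)) = 0"
    have "matrix_coeff m (\<lambda>\<mu>. fscale (c \<mu>) (a \<mu>)) \<sigma> = 0" if \<sigma>: "\<sigma> permutes {..<m}" for \<sigma>
    proof -
      obtain l \<kappa> where l: "l \<in> ?P" "\<kappa> \<in> ?S" "rep l \<circ> \<kappa> = \<kappa> \<circ> \<sigma>" using repr \<sigma> by blast
      have "matrix_coeff m (\<lambda>\<mu>. fscale (c \<mu>) (a \<mu>)) \<sigma> = (\<Sum>\<mu>\<in>?P. c \<mu> * h \<mu> (rep l))"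
        unfolding mc by (rule sum.cong) (use h_class[OF l(3,2)] in auto)
      then show ?thesis using z[OF l(1)] by simp
    qed
    then have 0: "fscale (c \<mu>) (a \<mu>) = 0" if "\<mu> \<in> ?P" for \<mu>
      using matrix_coeff_inj[of m "\<lambda>\<mu>. fscale (c \<mu>) (a \<mu>)"] scale_mem[where c = c] that by blast
    show "\<forall>\<mu>\<in>?P. c \<mu> = 0"
    proof
      fix \<mu> assume \<mu>: "\<mu> \<in> ?P"
      let ?X = "tabloid_of \<mu> (T0 \<mu>)"
      have "cnj (e \<mu> g ?X) = e \<mu> g ?X" for g by (simp add: e_def cnj_polytabloid)
      then have "e \<mu> g ?X * e \<mu> g ?X = complex_of_real ((cmod (e \<mu> g ?X))\<^sup>2)" for g
        using complex_norm_square[of "e \<mu> g ?X"] by simp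
      then have "a \<mu> (?X, ?X) = complex_of_real (\<Sum>g\<in>?S. (cmod (e \<mu> g ?X))\<^sup>2)"
        by (simp add: a_def)
      \<comment> \<open>The term of the identity is the square of \<open>polytabloid_self\<close>,
        that is 1, so the sum of squares is positive.\<close>
      moreover have "(cmod (e \<mu> id ?X))\<^sup>2 \<le> (\<Sum>g\<in>?S. (cmod (e \<mu> g ?X))\<^sup>2)"
        using finS by (intro member_le_sum) (simp_all add: permutes_id[unfolded id_def] id_def)
      then have "(\<Sum>g\<in>?S. (cmod (e \<mu> g ?X))\<^sup>2) \<noteq> 0"
        by (simp add: e_def polytabloid_self[OF T0])
      ultimately have "a \<mu> (?X, ?X) \<noteq> 0" by (simp only: of_real_eq_0_iff not_False_eq_True)
      then show "c \<mu> = 0" using fun_cong[OF 0[OF \<mu>], of "(?X, ?X)"] by (simp add: fscale_def)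
    qed
  qed
  then obtain c where c: "\<And>l. l \<in> ?P \<Longrightarrow>
      (\<Sum>\<mu>\<in>?P. c \<mu> * h \<mu> (rep l)) = (if rep l = id then 1 else 0)" by blast
  have "matrix_coeff m (\<lambda>\<mu>. fscale (c \<mu>) (a \<mu>)) \<sigma> = (if \<sigma> = id then 1 else 0)"
    if \<sigma>: "\<sigma> permutes {..<m}" for \<sigma>
  proof -
    obtain l \<kappa> where l: "l \<in> ?P" "\<kappa> \<in> ?S" "rep l \<circ> \<kappa> = \<kappa> \<circ> \<sigma>" using repr \<sigma> by blast
    have \<kappa>: "\<kappa> permutes {..<m}" using l by simp
    have "matrix_coeff m (\<lambda>\<mu>. fscale (c \<mu>) (a \<mu>)) \<sigma> = (\<Sum>\<mu>\<in>?P. c \<mu> * h \<mu> (rep l))"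
      unfolding mc by (rule sum.cong) (use h_class[OF l(3,2)] in auto)
    moreover have "rep l = id \<longleftrightarrow> \<sigma> = id"
    proof
      assume "rep l = id"
      then have "\<kappa> (\<sigma> x) = \<kappa> x" for x using fun_cong[OF l(3), of x] by simp
      then show "\<sigma> = id" using permutes_inj[OF \<kappa>] by (auto simp: inj_eq)
    next
      assume "\<sigma> = id"
      then have "rep l (\<kappa> x) = \<kappa> x" for x using fun_cong[OF l(3), of x] by simp
      then have "rep l y = y" for y using permutes_inverses(1)[OF \<kappa>, of y] by metis
      then show "rep l = id" by auto
    qed
    ultimately show ?thesis using c[OF l(1)] by simp
  qed
  then show ?thesis using scale_mem by (intro exI[of _ "\<lambda>\<mu>. fscale (c \<mu>) (a \<mu>)"]) simp
qed

text \<open>Translating the first tensor factor by \<tau> moves the indicator of the identity to the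
  indicator of \<tau>, and the indicators span all functions on the group.\<close>

lemma matrix_coeff_surj:
  "\<exists>G. (\<forall>\<mu>\<in>int_partitions m. G \<mu> \<in> specht_tensors \<mu>) \<and>
    (\<forall>\<sigma>. \<sigma> permutes {..<m} \<longrightarrow> matrix_coeff m G \<sigma> = f \<sigma>)"
proof -
  let ?P = "int_partitions m" and ?S = "{g. g permutes {..<m}}"
  have finS: "finite ?S" by (rule finite_permutations) simp
  obtain D where D: "\<And>\<mu>. \<mu> \<in> ?P \<Longrightarrow> D \<mu> \<in> specht_tensors \<mu>"
    and delta: "\<And>\<sigma>. \<sigma> permutes {..<m} \<Longrightarrow> matrix_coeff m D \<sigma> = (if \<sigma> = id then 1 else 0)"
    using matrix_coeff_delta[of m] by auto
  define E where "E \<tau> \<mu> = (\<lambda>(X, Y). D \<mu> (act_tabloid \<tau> X, Y))" for \<tau> \<mu>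
  define G where "G \<mu> = (\<lambda>p. \<Sum>\<tau>\<in>?S. f \<tau> * E \<tau> \<mu> p)" for \<mu>
  have "G \<mu> \<in> specht_tensors \<mu>" if "\<mu> \<in> ?P" for \<mu>
    unfolding G_def E_def
    using specht_tensors_act[OF _ permutes_id D[OF that]] int_partitions_sum[OF that]
    by (intro specht_tensors_sum) simp
  moreover have "matrix_coeff m G \<sigma> = f \<sigma>" if \<sigma>: "\<sigma> permutes {..<m}" for \<sigma>
  proof -
    have E: "matrix_coeff m (E \<tau>) \<sigma> = (if \<tau> = \<sigma> then 1 else 0)" if \<tau>: "\<tau> permutes {..<m}" for \<tau>
    proof -
      have "(\<Sum>X\<in>tabloids \<mu>. E \<tau> \<mu> (X, act_tabloid \<sigma> X)) =
          (\<Sum>X\<in>tabloids \<mu>. D \<mu> (X, act_tabloid (\<sigma> \<circ> pinv \<tau>) X))" if "\<mu> \<in> ?P" for \<mu>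
      proof -
        have t: "\<tau> permutes {..<sum_list \<mu>}" using \<tau> int_partitions_sum[OF that] by simp
        have "(\<Sum>X\<in>tabloids \<mu>. E \<tau> \<mu> (X, act_tabloid \<sigma> X)) =
            (\<Sum>X\<in>tabloids \<mu>. D \<mu> (act_tabloid \<tau> X, act_tabloid (\<sigma> \<circ> pinv \<tau>) (act_tabloid \<tau> X)))"
          by (simp add: E_def act_tabloid_comp comp_assoc permutes_inv_o[OF t])
        also have "\<dots> = (\<Sum>X\<in>tabloids \<mu>. D \<mu> (X, act_tabloid (\<sigma> \<circ> pinv \<tau>) X))"
          by (rule sum.reindex_bij_betw[OF act_tabloid_bij[OF t]])
        finally show ?thesis .
      qed
      then have "matrix_coeff m (E \<tau>) \<sigma> = matrix_coeff m D (\<sigma> \<circ> pinv \<tau>)"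
        by (simp add: matrix_coeff_def)
      moreover have "\<sigma> \<circ> pinv \<tau> permutes {..<m}"
        by (rule permutes_compose[OF permutes_inv[OF \<tau>] \<sigma>])
      moreover have "\<sigma> \<circ> pinv \<tau> = id \<longleftrightarrow> \<tau> = \<sigma>"
      proof
        assume "\<sigma> \<circ> pinv \<tau> = id"
        then have "\<sigma> \<circ> (pinv \<tau> \<circ> \<tau>) = \<tau>" by (simp flip: comp_assoc)
        then show "\<tau> = \<sigma>" by (simp add: permutes_inv_o[OF \<tau>])
      qed (use permutes_inv_o[OF \<tau>] in auto)
      ultimately show ?thesis using delta by simp
    qed
    have "matrix_coeff m G \<sigma> = (\<Sum>\<tau>\<in>?S. f \<tau> * matrix_coeff m (E \<tau>) \<sigma>)"
      unfolding matrix_coeff_def G_def sum_distrib_left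
      by (rule trans[OF sum.cong[OF refl sum.swap] sum.swap])
    also have "\<dots> = (\<Sum>\<tau>\<in>?S. if \<tau> = \<sigma> then f \<tau> else 0)"
      by (rule sum.cong) (auto simp: E)
    also have "\<dots> = f \<sigma>" using \<sigma> finS by simp
    finally show ?thesis .
  qed
  ultimately show ?thesis by blast
qed

section \<open>Signed permutations\<close>

definition sgn_int :: "bit \<Rightarrow> int" where
  "sgn_int b = (if b = 0 then 1 else -1)"

lemma sgn_int_neq_0 [simp]: "sgn_int b \<noteq> 0"
  by (simp add: sgn_int_def)

lemma sgn_bit_add: "sgn_bit (a + b) = sgn_bit a * sgn_bit b"
  by (cases a; cases b) (simp_all add: sgn_bit_def)

lemma sgn_bit_square [simp]: "sgn_bit a * sgn_bit a = 1" "sgn_bit a * (sgn_bit a * c) = c"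
  by (simp_all add: sgn_bit_def)

lemma sgn_bit_neq_0 [simp]: "sgn_bit b \<noteq> 0"
  by (simp add: sgn_bit_def)

lemma bit_add_self [simp]: "(a :: bit) + a = 0" "a + (a + b) = b"
  by (cases a; cases b; simp)+

text \<open>Coordinates on B_n, inverse to \<open>perm_of\<close> and \<open>colour\<close>. With
  \<open>Bgrp_eqI\<close> they turn matrix identities into statements about permutations and
  colours.\<close>

definition signed_perm :: "nat \<Rightarrow> (nat \<Rightarrow> nat) \<Rightarrow> (nat \<Rightarrow> bit) \<Rightarrow> int mat" where
  "signed_perm n \<sigma> z = mat n n (\<lambda>(j, k). if k = \<sigma> j then sgn_int (z j) else 0)"

lemma signed_perm_dim [simp]: "dim_row (signed_perm n \<sigma> z) = n" "dim_col (signed_perm n \<sigma> z) = n"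
  by (simp_all add: signed_perm_def)

lemma signed_perm_cong:
  "\<lbrakk>\<And>j. j < n \<Longrightarrow> \<sigma> j = \<tau> j; \<And>j. j < n \<Longrightarrow> z j = y j\<rbrakk> \<Longrightarrow> signed_perm n \<sigma> z = signed_perm n \<tau> y"
  unfolding signed_perm_def by (rule cong_mat) auto

context
  fixes n :: nat and \<sigma> :: "nat \<Rightarrow> nat"
  assumes \<sigma>: "\<sigma> permutes {..<n}"
begin

lemma permutes_less: "\<sigma> j < n \<longleftrightarrow> j < n"
  using permutes_in_image[OF \<sigma>, of j] by simp

lemma signed_perm_closed: "signed_perm n \<sigma> z \<in> carrier (Bgrp n)"
proof -
  have nz: "j < n \<Longrightarrow> k < n \<Longrightarrow> signed_perm n \<sigma> z $$ (j, k) \<noteq> 0 \<longleftrightarrow> k = \<sigma> j" for j k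
    by (simp add: signed_perm_def)
  have "\<exists>!k. k < n \<and> signed_perm n \<sigma> z $$ (j, k) \<noteq> 0" if j: "j < n" for j
  proof (rule ex1I[of _ "\<sigma> j"])
    have "\<sigma> j < n" using j by (simp only: permutes_less)
    then show "\<sigma> j < n \<and> signed_perm n \<sigma> z $$ (j, \<sigma> j) \<noteq> 0" using nz[OF j] by blast
  qed (use nz[OF j] in blast)
  moreover have "\<exists>!j. j < n \<and> signed_perm n \<sigma> z $$ (j, k) \<noteq> 0" if "k < n" for k
  proof (rule ex1I[of _ "pinv \<sigma> k"])
    have "pinv \<sigma> k < n" using permutes_in_image[OF permutes_inv[OF \<sigma>], of k] that by simp
    then show "pinv \<sigma> k < n \<and> signed_perm n \<sigma> z $$ (pinv \<sigma> k, k) \<noteq> 0"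
      using nz[of "pinv \<sigma> k" k] that permutes_inverses(1)[OF \<sigma>] by simp
    fix j assume "j < n \<and> signed_perm n \<sigma> z $$ (j, k) \<noteq> 0"
    then have "k = \<sigma> j" using nz that by blast
    then show "j = pinv \<sigma> k" using permutes_inverses(2)[OF \<sigma>] by simp
  qed
  moreover have "signed_perm n \<sigma> z $$ (j, k) \<in> {-1, 0, 1}" if "j < n" "k < n" for j k
    unfolding signed_perm_def using that by (simp, simp add: sgn_int_def)
  moreover have "signed_perm n \<sigma> z \<in> carrier_mat n n" by (simp add: signed_perm_def)
  ultimately show ?thesis unfolding Bgrp_def partial_object.simps mem_Collect_eq by blast
qed

lemma perm_of_signed_perm: "perm_of (signed_perm n \<sigma> z) = \<sigma>"
proof
  fix j show "perm_of (signed_perm n \<sigma> z) j = \<sigma> j"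
  proof (cases "j < n")
    case True
    have "(THE k. k < n \<and> signed_perm n \<sigma> z $$ (j, k) \<noteq> 0) = \<sigma> j"
    proof (rule the_equality)
      have "\<sigma> j < n" using True by (simp only: permutes_less)
      then show "\<sigma> j < n \<and> signed_perm n \<sigma> z $$ (j, \<sigma> j) \<noteq> 0"
        using True by (simp add: signed_perm_def)
    qed (use True in \<open>auto simp: signed_perm_def split: if_splits\<close>)
    then show ?thesis using True by (simp add: perm_of_def)
  next
    case False
    then show ?thesis using permutes_not_in[OF \<sigma>, of j] by (simp add: perm_of_def)
  qed
qed

lemma colour_signed_perm: "j < n \<Longrightarrow> colour (signed_perm n \<sigma> z) j = z j"
  unfolding colour_def perm_of_signed_perm
  by (cases "z j") (simp_all add: signed_perm_def sgn_int_def permutes_less)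

end

context
  fixes n :: nat and g :: "int mat"
  assumes g: "g \<in> carrier (Bgrp n)"
begin

lemma Bgrp_carrier_mat: "g \<in> carrier_mat n n"
  using g by (simp add: Bgrp_def)

lemma Bgrp_dim: "dim_row g = n" "dim_col g = n"
  using Bgrp_carrier_mat by auto

lemma perm_of_unique:
  assumes "j < n"
  shows "perm_of g j < n" "k < n \<Longrightarrow> g $$ (j, k) \<noteq> 0 \<longleftrightarrow> k = perm_of g j"
proof -
  have ex: "\<exists>!k. k < n \<and> g $$ (j, k) \<noteq> 0" using g assms by (simp add: Bgrp_def)
  have "perm_of g j < n \<and> g $$ (j, perm_of g j) \<noteq> 0"
    using theI'[OF ex] assms by (simp add: perm_of_def Bgrp_dim)
  then show "perm_of g j < n" "k < n \<Longrightarrow> g $$ (j, k) \<noteq> 0 \<longleftrightarrow> k = perm_of g j" using ex by blast+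
qed

lemma perm_of_permutes: "perm_of g permutes {..<n}"
proof (rule inj_imp_permutes)
  show "inj_on (perm_of g) {..<n}"
  proof (rule inj_onI)
    fix i j assume ij: "i \<in> {..<n}" "j \<in> {..<n}" "perm_of g i = perm_of g j"
    then have "g $$ (i, perm_of g i) \<noteq> 0" "g $$ (j, perm_of g i) \<noteq> 0" "perm_of g i < n"
      using perm_of_unique[of i] perm_of_unique[of j] by auto
    then show "i = j" using g ij unfolding Bgrp_def by auto
  qed
qed (use perm_of_unique in \<open>auto simp: perm_of_def Bgrp_dim\<close>)

lemma signed_perm_eq: "signed_perm n (perm_of g) (colour g) = g"
proof (rule eq_matI)
  fix j k assume jk: "j < dim_row g" "k < dim_col g"
  then have jk': "j < n" "k < n" by (simp_all add: Bgrp_dim)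
  have "g $$ (j, k) \<in> {-1, 0, 1}" using g jk' by (simp add: Bgrp_def)
  then show "signed_perm n (perm_of g) (colour g) $$ (j, k) = g $$ (j, k)"
    using perm_of_unique(2)[OF jk'] jk' jk
    by (auto simp: signed_perm_def colour_def sgn_int_def)
qed (simp_all add: Bgrp_dim)

end

lemma Bgrp_eqI:
  assumes "g \<in> carrier (Bgrp n)" "h \<in> carrier (Bgrp n)"
    "\<And>j. j < n \<Longrightarrow> perm_of g j = perm_of h j" "\<And>j. j < n \<Longrightarrow> colour g j = colour h j"
  shows "g = h"
proof -
  have "g = signed_perm n (perm_of g) (colour g)" by (rule signed_perm_eq[OF assms(1), symmetric])
  also have "\<dots> = signed_perm n (perm_of h) (colour h)" by (rule signed_perm_cong) (fact assms)+
  also have "\<dots> = h" by (rule signed_perm_eq[OF assms(2)])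
  finally show ?thesis .
qed

text \<open>The group law is reversed matrix multiplication, so row j first meets \<tau> and then
  \<sigma>; the colours met along the path from j through \<tau> j add up.\<close>

lemma signed_perm_mult:
  assumes "\<sigma> permutes {..<n}" "\<tau> permutes {..<n}"
  shows "signed_perm n \<sigma> z \<otimes>\<^bsub>Bgrp n\<^esub> signed_perm n \<tau> y = signed_perm n (\<sigma> \<circ> \<tau>) (\<lambda>j. y j + z (\<tau> j))"
proof (rule eq_matI)
  fix j k assume "j < dim_row (signed_perm n (\<sigma> \<circ> \<tau>) (\<lambda>j. y j + z (\<tau> j)))"
    "k < dim_col (signed_perm n (\<sigma> \<circ> \<tau>) (\<lambda>j. y j + z (\<tau> j)))"
  then have jk: "j < n" "k < n" by simp_all
  have \<tau>j: "\<tau> j < n" using jk permutes_in_image[OF assms(2), of j] by simp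
  have "(signed_perm n \<sigma> z \<otimes>\<^bsub>Bgrp n\<^esub> signed_perm n \<tau> y) $$ (j, k) =
      (\<Sum>i<n. signed_perm n \<tau> y $$ (j, i) * signed_perm n \<sigma> z $$ (i, k))"
    using jk by (simp add: Bgrp_def scalar_prod_def atLeast0LessThan)
  also have "\<dots> = (\<Sum>i<n. if i = \<tau> j then sgn_int (y j) * signed_perm n \<sigma> z $$ (\<tau> j, k) else 0)"
    by (rule sum.cong) (use jk in \<open>auto simp: signed_perm_def\<close>)
  also have "\<dots> = sgn_int (y j) * signed_perm n \<sigma> z $$ (\<tau> j, k)" using \<tau>j by simp
  also have "\<dots> = signed_perm n (\<sigma> \<circ> \<tau>) (\<lambda>j. y j + z (\<tau> j)) $$ (j, k)"
    using jk \<tau>j by (cases "y j"; cases "z (\<tau> j)") (simp_all add: signed_perm_def sgn_int_def)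
  finally show "(signed_perm n \<sigma> z \<otimes>\<^bsub>Bgrp n\<^esub> signed_perm n \<tau> y) $$ (j, k) =
      signed_perm n (\<sigma> \<circ> \<tau>) (\<lambda>j. y j + z (\<tau> j)) $$ (j, k)" .
qed (simp_all add: Bgrp_def)

section \<open>Products, inverses, absolute values and negatives in coordinates\<close>

context
  fixes n :: nat and g h :: "int mat"
  assumes g: "g \<in> carrier (Bgrp n)" and h: "h \<in> carrier (Bgrp n)"
begin

lemma Bgrp_mult_eq:
  "g \<otimes>\<^bsub>Bgrp n\<^esub> h = signed_perm n (perm_of g \<circ> perm_of h) (\<lambda>j. colour h j + colour g (perm_of h j))"
  using signed_perm_mult[OF perm_of_permutes[OF g] perm_of_permutes[OF h], of "colour g" "colour h"]
  by (simp add: signed_perm_eq g h)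

lemma Bgrp_mult_closed: "g \<otimes>\<^bsub>Bgrp n\<^esub> h \<in> carrier (Bgrp n)"
  unfolding Bgrp_mult_eq
  by (intro signed_perm_closed permutes_compose perm_of_permutes g h)

lemma perm_of_mult: "perm_of (g \<otimes>\<^bsub>Bgrp n\<^esub> h) = perm_of g \<circ> perm_of h"
  unfolding Bgrp_mult_eq by (intro perm_of_signed_perm permutes_compose perm_of_permutes g h)

lemma colour_mult: "j < n \<Longrightarrow> colour (g \<otimes>\<^bsub>Bgrp n\<^esub> h) j = colour h j + colour g (perm_of h j)"
  unfolding Bgrp_mult_eq
  by (rule colour_signed_perm[OF permutes_compose[OF perm_of_permutes[OF h] perm_of_permutes[OF g]]])

end

lemma Bgrp_one_eq: "\<one>\<^bsub>Bgrp n\<^esub> = signed_perm n id (\<lambda>_. 0)"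
  by (auto simp: Bgrp_def signed_perm_def sgn_int_def intro!: eq_matI)

lemma one_in_Bgrp [simp]: "\<one>\<^bsub>Bgrp n\<^esub> \<in> carrier (Bgrp n)"
  unfolding Bgrp_one_eq by (rule signed_perm_closed[OF permutes_id])

lemma perm_of_one: "perm_of \<one>\<^bsub>Bgrp n\<^esub> = id"
  unfolding Bgrp_one_eq by (rule perm_of_signed_perm[OF permutes_id])

lemma colour_one: "j < n \<Longrightarrow> colour \<one>\<^bsub>Bgrp n\<^esub> j = 0"
  unfolding Bgrp_one_eq by (rule colour_signed_perm[OF permutes_id])

lemma group_Bgrp: "group (Bgrp n)"
proof (rule groupI)
  fix x y z assume x: "x \<in> carrier (Bgrp n)" and y: "y \<in> carrier (Bgrp n)" and z: "z \<in> carrier (Bgrp n)"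
  show "x \<otimes>\<^bsub>Bgrp n\<^esub> y \<otimes>\<^bsub>Bgrp n\<^esub> z = x \<otimes>\<^bsub>Bgrp n\<^esub> (y \<otimes>\<^bsub>Bgrp n\<^esub> z)"
    using assoc_mult_mat[OF Bgrp_carrier_mat[OF z] Bgrp_carrier_mat[OF y] Bgrp_carrier_mat[OF x]]
    by (simp add: Bgrp_def)
next
  fix x assume x: "x \<in> carrier (Bgrp n)"
  show "\<one>\<^bsub>Bgrp n\<^esub> \<otimes>\<^bsub>Bgrp n\<^esub> x = x" using Bgrp_carrier_mat[OF x] by (simp add: Bgrp_def)
  let ?p = "perm_of x"
  have p: "?p permutes {..<n}" by (rule perm_of_permutes[OF x])
  \<comment> \<open>The inverse must cancel at position p(j) the colour that \<open>x\<close> has at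
    j, hence the colours are read back along the inverse permutation.\<close>
  let ?y = "signed_perm n (pinv ?p) (\<lambda>j. colour x (pinv ?p j))"
  have "?y \<otimes>\<^bsub>Bgrp n\<^esub> x = \<one>\<^bsub>Bgrp n\<^esub>"
    using signed_perm_mult[OF permutes_inv[OF p] p, of "\<lambda>j. colour x (pinv ?p j)" "colour x"]
    by (simp add: signed_perm_eq[OF x] Bgrp_one_eq permutes_inv_o[OF p] permutes_inverses[OF p])
  then show "\<exists>y\<in>carrier (Bgrp n). y \<otimes>\<^bsub>Bgrp n\<^esub> x = \<one>\<^bsub>Bgrp n\<^esub>"
    using signed_perm_closed[OF permutes_inv[OF p]] by blast
qed (simp_all add: Bgrp_mult_closed)

context
  fixes n :: nat and g :: "int mat"
  assumes g: "g \<in> carrier (Bgrp n)"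
begin

lemma perm_of_inv: "perm_of (inv\<^bsub>Bgrp n\<^esub> g) = pinv (perm_of g)"
proof -
  interpret group "Bgrp n" by (rule group_Bgrp)
  have "perm_of (inv\<^bsub>Bgrp n\<^esub> g \<otimes>\<^bsub>Bgrp n\<^esub> g) = id" using g by (simp add: perm_of_one)
  then have "perm_of (inv\<^bsub>Bgrp n\<^esub> g) \<circ> perm_of g = id"
    unfolding perm_of_mult[OF inv_closed[OF g] g] .
  then have "perm_of (inv\<^bsub>Bgrp n\<^esub> g) \<circ> (perm_of g \<circ> pinv (perm_of g)) = pinv (perm_of g)"
    by (simp flip: comp_assoc)
  then show ?thesis by (simp add: permutes_inv_o[OF perm_of_permutes[OF g]])
qed

lemma colour_inv: "j < n \<Longrightarrow> colour (inv\<^bsub>Bgrp n\<^esub> g) (perm_of g j) = colour g j"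
proof -
  assume j: "j < n"
  interpret group "Bgrp n" by (rule group_Bgrp)
  have "colour (inv\<^bsub>Bgrp n\<^esub> g \<otimes>\<^bsub>Bgrp n\<^esub> g) j = 0" using g j by (simp add: colour_one)
  then have "colour g j + colour (inv\<^bsub>Bgrp n\<^esub> g) (perm_of g j) = 0"
    unfolding colour_mult[OF inv_closed[OF g] g j] .
  then show ?thesis by (cases "colour g j"; cases "colour (inv\<^bsub>Bgrp n\<^esub> g) (perm_of g j)") auto
qed

lemma total_colour_eq: "total_colour g = (\<Sum>j<n. colour g j)"
  by (simp add: total_colour_def Bgrp_dim[OF g])

lemma Bgrp_entry: "j < n \<Longrightarrow> k < n \<Longrightarrow> g $$ (j, k) = (if k = perm_of g j then sgn_int (colour g j) else 0)"
  using arg_cong[OF signed_perm_eq[OF g], of "\<lambda>m. m $$ (j, k)"] by (simp add: signed_perm_def)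

lemma abs_mat_eq: "abs_mat g = signed_perm n (perm_of g) (\<lambda>_. 0)"
  by (rule eq_matI) (simp_all add: abs_mat_def Bgrp_dim[OF g] Bgrp_entry signed_perm_def sgn_int_def)

lemma abs_mat_closed: "abs_mat g \<in> carrier (Bgrp n)"
  unfolding abs_mat_eq by (rule signed_perm_closed[OF perm_of_permutes[OF g]])

lemma perm_of_abs_mat: "perm_of (abs_mat g) = perm_of g"
  unfolding abs_mat_eq by (rule perm_of_signed_perm[OF perm_of_permutes[OF g]])

lemma colour_abs_mat: "j < n \<Longrightarrow> colour (abs_mat g) j = 0"
  unfolding abs_mat_eq by (rule colour_signed_perm[OF perm_of_permutes[OF g]])

lemma uminus_eq: "- g = signed_perm n (perm_of g) (\<lambda>j. colour g j + 1)"
  by (rule eq_matI) (simp_all add: Bgrp_dim[OF g] Bgrp_entry signed_perm_def sgn_int_def)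

lemma uminus_closed: "- g \<in> carrier (Bgrp n)"
  unfolding uminus_eq by (rule signed_perm_closed[OF perm_of_permutes[OF g]])

lemma perm_of_uminus: "perm_of (- g) = perm_of g"
  unfolding uminus_eq by (rule perm_of_signed_perm[OF perm_of_permutes[OF g]])

lemma colour_uminus: "j < n \<Longrightarrow> colour (- g) j = colour g j + 1"
  unfolding uminus_eq by (rule colour_signed_perm[OF perm_of_permutes[OF g]])

lemma perm_mats_iff: "g \<in> perm_mats n \<longleftrightarrow> (\<forall>j<n. colour g j = 0)"
proof
  assume "g \<in> perm_mats n"
  then have "abs_mat g = g" by (simp add: perm_mats_def)
  then show "\<forall>j<n. colour g j = 0" using colour_abs_mat by simp
next
  assume "\<forall>j<n. colour g j = 0"
  then have "abs_mat g = g"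
    using g abs_mat_closed by (intro Bgrp_eqI[of _ n]) (simp_all add: perm_of_abs_mat colour_abs_mat)
  then show "g \<in> perm_mats n" using g by (simp add: perm_mats_def)
qed

lemma transpose_eq:
  "transpose_mat g = signed_perm n (pinv (perm_of g)) (\<lambda>j. colour g (pinv (perm_of g) j))"
proof (rule eq_matI)
  let ?p = "perm_of g"
  have p: "?p permutes {..<n}" by (rule perm_of_permutes[OF g])
  have iff: "j = ?p k \<longleftrightarrow> k = pinv ?p j" for j k using permutes_inverses[OF p] by auto
  show "transpose_mat g $$ (j, k) = signed_perm n (pinv ?p) (\<lambda>j. colour g (pinv ?p j)) $$ (j, k)"
    if "j < dim_row (signed_perm n (pinv ?p) (\<lambda>j. colour g (pinv ?p j)))"
      "k < dim_col (signed_perm n (pinv ?p) (\<lambda>j. colour g (pinv ?p j)))" for j k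
    using that by (auto simp: signed_perm_def Bgrp_dim[OF g] Bgrp_entry iff)
qed (simp_all add: Bgrp_dim[OF g])

end

lemma total_colour_mult:
  assumes g: "g \<in> carrier (Bgrp n)" and h: "h \<in> carrier (Bgrp n)"
  shows "total_colour (g \<otimes>\<^bsub>Bgrp n\<^esub> h) = total_colour g + total_colour h"
proof -
  have "total_colour (g \<otimes>\<^bsub>Bgrp n\<^esub> h) = (\<Sum>j<n. colour h j) + (\<Sum>j<n. colour g (perm_of h j))"
    unfolding total_colour_eq[OF Bgrp_mult_closed[OF g h]] sum.distrib[symmetric]
    by (rule sum.cong) (simp_all only: colour_mult[OF g h] lessThan_iff)
  also have "(\<Sum>j<n. colour g (perm_of h j)) = (\<Sum>j<n. colour g j)"
    by (rule sum.permute[OF perm_of_permutes[OF h], symmetric, unfolded comp_def])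
  finally show ?thesis by (simp only: total_colour_eq[OF g] total_colour_eq[OF h] add.commute)
qed

lemma group_Dgrp: "group (Dgrp n)"
proof -
  interpret group "Bgrp n" by (rule group_Bgrp)
  have one: "total_colour \<one>\<^bsub>Bgrp n\<^esub> = 0" by (simp add: total_colour_eq[OF one_in_Bgrp] colour_one)
  have "subgroup {g \<in> carrier (Bgrp n). total_colour g = 0} (Bgrp n)"
  proof (rule subgroupI)
    fix a assume "a \<in> {g \<in> carrier (Bgrp n). total_colour g = 0}"
    then show "inv\<^bsub>Bgrp n\<^esub> a \<in> {g \<in> carrier (Bgrp n). total_colour g = 0}"
      using total_colour_mult[of "inv\<^bsub>Bgrp n\<^esub> a" n a] one by simp
  qed (use one in \<open>auto simp: total_colour_mult\<close>)
  then show ?thesis unfolding Dgrp_def by (rule subgroup.subgroup_is_group[OF _ group_Bgrp])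
qed

lemma Dgrp_simps:
  "carrier (Dgrp n) = {g \<in> carrier (Bgrp n). total_colour g = 0}"
  "g \<otimes>\<^bsub>Dgrp n\<^esub> h = g \<otimes>\<^bsub>Bgrp n\<^esub> h" "\<one>\<^bsub>Dgrp n\<^esub> = \<one>\<^bsub>Bgrp n\<^esub>"
  by (simp_all add: Dgrp_def)

section \<open>Antisymmetric involutions\<close>

definition antisym_lifts :: "nat \<Rightarrow> int mat set" where
  "antisym_lifts n = {w \<in> carrier (Bgrp n). transpose_mat w = - w}"

lemma antisym_lifts_closed: "w \<in> antisym_lifts n \<Longrightarrow> w \<in> carrier (Bgrp n)"
  by (simp add: antisym_lifts_def)

text \<open>The transpose has the inverse permutation with the colours carried along, while -w keeps
  the permutation and flips all colours. Antisymmetry therefore means an involution that matches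
  positions of colour 0 with positions of colour 1.\<close>

lemma antisym_lifts_iff:
  assumes w: "w \<in> carrier (Bgrp n)"
  shows "w \<in> antisym_lifts n \<longleftrightarrow> (\<forall>j<n. perm_of w (perm_of w j) = j \<and> colour w (perm_of w j) = colour w j + 1)"
proof -
  let ?p = "perm_of w"
  have p: "?p permutes {..<n}" by (rule perm_of_permutes[OF w])
  have T: "transpose_mat w \<in> carrier (Bgrp n)" unfolding transpose_eq[OF w]
    by (rule signed_perm_closed[OF permutes_inv[OF p]])
  have pT: "perm_of (transpose_mat w) = pinv ?p" unfolding transpose_eq[OF w]
    by (rule perm_of_signed_perm[OF permutes_inv[OF p]])
  have cT: "colour (transpose_mat w) j = colour w (pinv ?p j)" if "j < n" for j
    unfolding transpose_eq[OF w] by (rule colour_signed_perm[OF permutes_inv[OF p] that])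
  have less: "pinv ?p j < n \<longleftrightarrow> j < n" "?p j < n \<longleftrightarrow> j < n" for j
    using permutes_less[OF permutes_inv[OF p]] permutes_less[OF p] by auto
  have "transpose_mat w = - w \<longleftrightarrow> (\<forall>j<n. pinv ?p j = ?p j \<and> colour w (pinv ?p j) = colour w j + 1)"
  proof
    assume "transpose_mat w = - w"
    then show "\<forall>j<n. pinv ?p j = ?p j \<and> colour w (pinv ?p j) = colour w j + 1"
      using pT cT perm_of_uminus[OF w] colour_uminus[OF w] by metis
  next
    assume a: "\<forall>j<n. pinv ?p j = ?p j \<and> colour w (pinv ?p j) = colour w j + 1"
    show "transpose_mat w = - w"
    proof (rule Bgrp_eqI[OF T uminus_closed[OF w]])
      fix j assume j: "j < n"
      show "perm_of (transpose_mat w) j = perm_of (- w) j"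
        using a j by (simp add: pT perm_of_uminus[OF w])
      show "colour (transpose_mat w) j = colour (- w) j"
        unfolding cT[OF j] colour_uminus[OF w j] using a j by blast
    qed
  qed
  also have "\<dots> \<longleftrightarrow> (\<forall>j<n. ?p (?p j) = j \<and> colour w (?p j) = colour w j + 1)"
    using permutes_inverses[OF p] by metis
  finally show ?thesis using w by (simp add: antisym_lifts_def)
qed

lemma antisym_liftsD:
  assumes "w \<in> antisym_lifts n" "j < n"
  shows "perm_of w (perm_of w j) = j" "colour w (perm_of w j) = colour w j + 1" "perm_of w j < n"
  using assms antisym_lifts_iff[OF antisym_lifts_closed[OF assms(1)]]
    perm_of_unique(1)[OF antisym_lifts_closed[OF assms(1)]] by auto

lemma uminus_antisym_lifts: "w \<in> antisym_lifts n \<Longrightarrow> - w \<in> antisym_lifts n"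
  by (auto simp: antisym_lifts_iff[OF uminus_closed[OF antisym_lifts_closed]]
      perm_of_uminus[OF antisym_lifts_closed] colour_uminus[OF antisym_lifts_closed] antisym_liftsD)

lemma uminus_mult_Bgrp:
  assumes "g \<in> carrier (Bgrp n)" "h \<in> carrier (Bgrp n)"
  shows "(- g) \<otimes>\<^bsub>Bgrp n\<^esub> h = - (g \<otimes>\<^bsub>Bgrp n\<^esub> h)" "g \<otimes>\<^bsub>Bgrp n\<^esub> (- h) = - (g \<otimes>\<^bsub>Bgrp n\<^esub> h)"
  using Bgrp_carrier_mat[OF assms(1)] Bgrp_carrier_mat[OF assms(2)] by (simp_all add: Bgrp_def)

text \<open>For an antisymmetric lift the permutation squares to the identity and the two colours
  along each pair add to 1, so w w = -I, which lies in the identity coset.\<close>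

lemma c1_eq: "c1 n = (\<lambda>w. {w, - w}) ` antisym_lifts n"
proof -
  interpret group "Bgrp n" by (rule group_Bgrp)
  have one: "1\<^sub>m n = \<one>\<^bsub>Bgrp n\<^esub>" by (simp add: Bgrp_def)
  have coset: "{\<one>\<^bsub>Bgrp n\<^esub>, - \<one>\<^bsub>Bgrp n\<^esub>} #>\<^bsub>Bgrp n\<^esub> w = {w, - w}" if "w \<in> carrier (Bgrp n)" for w
    using that by (auto simp: r_coset_def uminus_mult_Bgrp)
  then have car: "carrier (PBgrp n) = (\<lambda>w. {w, - w}) ` carrier (Bgrp n)"
    unfolding PBgrp_def one FactGroup_def RCOSETS_def by auto
  have anti: "antisymmetric {w, - w} \<longleftrightarrow> w \<in> antisym_lifts n" if w: "w \<in> carrier (Bgrp n)" for w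
  proof
    assume "antisymmetric {w, - w}"
    then show "w \<in> antisym_lifts n" using w by (auto simp: antisymmetric_def antisym_lifts_def)
  next
    assume "w \<in> antisym_lifts n"
    then have "w \<in> antisym_lifts n" "- w \<in> antisym_lifts n" by (auto intro: uminus_antisym_lifts)
    then show "antisymmetric {w, - w}" by (auto simp: antisymmetric_def antisym_lifts_def)
  qed
  have sq: "{w, - w} \<otimes>\<^bsub>PBgrp n\<^esub> {w, - w} = \<one>\<^bsub>PBgrp n\<^esub>" if wa: "w \<in> antisym_lifts n" for w
  proof -
    have w: "w \<in> carrier (Bgrp n)" by (rule antisym_lifts_closed[OF wa])
    have "w \<otimes>\<^bsub>Bgrp n\<^esub> w = - \<one>\<^bsub>Bgrp n\<^esub>"
      by (rule Bgrp_eqI[OF Bgrp_mult_closed[OF w w] uminus_closed[OF one_in_Bgrp]])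
        (simp_all add: perm_of_mult[OF w w] colour_mult[OF w w] perm_of_uminus[OF one_in_Bgrp]
          colour_uminus[OF one_in_Bgrp] antisym_liftsD[OF wa] perm_of_one colour_one)
    then show ?thesis
      unfolding PBgrp_def one FactGroup_def set_mult_def
      using w uminus_closed[OF w] by (auto simp: uminus_mult_Bgrp)
  qed
  show ?thesis unfolding c1_def car using anti sq antisym_lifts_closed by blast
qed

lemma conj_closed:
  assumes h: "h \<in> carrier (Bgrp n)" and w: "w \<in> carrier (Bgrp n)"
  shows "h \<otimes>\<^bsub>Bgrp n\<^esub> w \<otimes>\<^bsub>Bgrp n\<^esub> inv\<^bsub>Bgrp n\<^esub> h \<in> carrier (Bgrp n)"
  using group_Bgrp h w by (simp add: group.is_monoid monoid.m_closed group.inv_closed)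

text \<open>Conjugation relabels positions by h. Evaluating at the position h(j) makes the inverse
  cancel; for unsigned h the colours move along in the same way.\<close>

lemma perm_of_conj:
  assumes h: "h \<in> carrier (Bgrp n)" and w: "w \<in> carrier (Bgrp n)"
  shows "perm_of (h \<otimes>\<^bsub>Bgrp n\<^esub> w \<otimes>\<^bsub>Bgrp n\<^esub> inv\<^bsub>Bgrp n\<^esub> h) (perm_of h j) = perm_of h (perm_of w j)"
  using h w group.inv_closed[OF group_Bgrp h] permutes_inverses[OF perm_of_permutes[OF h]]
  by (simp add: perm_of_mult Bgrp_mult_closed perm_of_inv)

lemma colour_conj:
  assumes h: "h \<in> perm_mats n" and w: "w \<in> carrier (Bgrp n)" and j: "j < n"
  shows "colour (h \<otimes>\<^bsub>Bgrp n\<^esub> w \<otimes>\<^bsub>Bgrp n\<^esub> inv\<^bsub>Bgrp n\<^esub> h) (perm_of h j) = colour w j"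
proof -
  have hB: "h \<in> carrier (Bgrp n)" using h by (simp add: perm_mats_def)
  have c: "colour h i = 0" if "i < n" for i using h perm_mats_iff[OF hB] that by simp
  have less: "perm_of h j < n" "perm_of w j < n" using perm_of_unique(1) hB w j by blast+
  show ?thesis
    using hB w j c less group.inv_closed[OF group_Bgrp hB] permutes_inverses[OF perm_of_permutes[OF hB]]
    by (simp add: colour_mult Bgrp_mult_closed perm_of_inv colour_inv)
qed

lemma conj_coset_eq:
  assumes h: "h \<in> carrier (Bgrp n)" and w: "w \<in> carrier (Bgrp n)"
  shows "conj_coset n h {w, - w} = {h \<otimes>\<^bsub>Bgrp n\<^esub> w \<otimes>\<^bsub>Bgrp n\<^esub> inv\<^bsub>Bgrp n\<^esub> h,
    - (h \<otimes>\<^bsub>Bgrp n\<^esub> w \<otimes>\<^bsub>Bgrp n\<^esub> inv\<^bsub>Bgrp n\<^esub> h)}"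
  using h w group.inv_closed[OF group_Bgrp h]
  by (simp add: conj_coset_def uminus_mult_Bgrp Bgrp_mult_closed)

lemma conj_antisym_lifts:
  assumes h: "h \<in> perm_mats n" and w: "w \<in> antisym_lifts n"
  shows "h \<otimes>\<^bsub>Bgrp n\<^esub> w \<otimes>\<^bsub>Bgrp n\<^esub> inv\<^bsub>Bgrp n\<^esub> h \<in> antisym_lifts n"
proof -
  have hB: "h \<in> carrier (Bgrp n)" using h by (simp add: perm_mats_def)
  have wB: "w \<in> carrier (Bgrp n)" by (rule antisym_lifts_closed[OF w])
  show ?thesis unfolding antisym_lifts_iff[OF conj_closed[OF hB wB]]
  proof (intro allI impI)
    fix j assume "j < n"
    then obtain i where i: "i < n" "j = perm_of h i"
      using permutes_image[OF perm_of_permutes[OF hB]] by (metis imageE lessThan_iff)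
    show "perm_of (h \<otimes>\<^bsub>Bgrp n\<^esub> w \<otimes>\<^bsub>Bgrp n\<^esub> inv\<^bsub>Bgrp n\<^esub> h) (perm_of (h \<otimes>\<^bsub>Bgrp n\<^esub> w \<otimes>\<^bsub>Bgrp n\<^esub> inv\<^bsub>Bgrp n\<^esub> h) j) = j \<and>
        colour (h \<otimes>\<^bsub>Bgrp n\<^esub> w \<otimes>\<^bsub>Bgrp n\<^esub> inv\<^bsub>Bgrp n\<^esub> h) (perm_of (h \<otimes>\<^bsub>Bgrp n\<^esub> w \<otimes>\<^bsub>Bgrp n\<^esub> inv\<^bsub>Bgrp n\<^esub> h) j) =
        colour (h \<otimes>\<^bsub>Bgrp n\<^esub> w \<otimes>\<^bsub>Bgrp n\<^esub> inv\<^bsub>Bgrp n\<^esub> h) j + 1"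
      unfolding i(2) perm_of_conj[OF hB wB]
      using antisym_liftsD[OF w i(1)] colour_conj[OF h wB] i(1) by simp
  qed
qed

section \<open>Shuffles and the decomposition of signed permutations\<close>

lemma strict_mono_on_image_unique:
  fixes f g :: "nat \<Rightarrow> nat"
  assumes "strict_mono_on {a..<b} f" "strict_mono_on {a..<b} g" "f ` {a..<b} = g ` {a..<b}"
    and i: "i \<in> {a..<b}"
  shows "f i = g i"
proof -
  have "sorted (map h [a..<b]) \<and> distinct (map h [a..<b])" if "strict_mono_on {a..<b} h" for h :: "nat \<Rightarrow> nat"
  proof
    show "sorted (map h [a..<b])"
      unfolding sorted_map by (rule sorted_wrt_mono_rel[OF _ sorted_upt])
        (use strict_mono_on_leD[OF that] in auto)
    show "distinct (map h [a..<b])"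
      using strict_mono_on_imp_inj_on[OF that] by (simp add: distinct_map)
  qed
  then have "map f [a..<b] = map g [a..<b]"
    using assms by (intro sorted_distinct_set_unique) auto
  then show ?thesis using i by simp
qed

context
  fixes m :: nat
begin

lemma ThetaD:
  assumes "t \<in> Theta m"
  shows "t \<in> carrier (Bgrp (2 * m))" "perm_of t permutes {..<2 * m}" "j < 2 * m \<Longrightarrow> colour t j = 0"
    "strict_mono_on {0..<m} (perm_of t)" "strict_mono_on {m..<2 * m} (perm_of t)"
proof -
  show c: "t \<in> carrier (Bgrp (2 * m))" using assms by (simp add: Theta_def perm_mats_def)
  then show "perm_of t permutes {..<2 * m}" by (rule perm_of_permutes)
  show "j < 2 * m \<Longrightarrow> colour t j = 0" using assms perm_mats_iff[OF c] by (simp add: Theta_def)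
  show "strict_mono_on {0..<m} (perm_of t)" "strict_mono_on {m..<2 * m} (perm_of t)"
    using assms by (simp_all add: Theta_def lessThan_atLeast0)
qed

lemma ThetaI:
  assumes "\<sigma> permutes {..<2 * m}" "strict_mono_on {0..<m} \<sigma>" "strict_mono_on {m..<2 * m} \<sigma>"
  shows "signed_perm (2 * m) \<sigma> (\<lambda>_. 0) \<in> Theta m"
  using assms unfolding Theta_def
  by (simp add: perm_mats_iff signed_perm_closed colour_signed_perm perm_of_signed_perm lessThan_atLeast0)

lemma permutes_upper_half:
  assumes "\<sigma> permutes {..<2 * m}"
  shows "\<sigma> ` {m..<2 * m} = {..<2 * m} - \<sigma> ` {0..<m}"
proof -
  have "{m..<2 * m} = {..<2 * m} - {0..<m}" by auto
  then show ?thesis using permutes_image[OF assms] permutes_inj[OF assms]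
    by (simp add: image_set_diff)
qed

text \<open>A shuffle increases on both halves, so it is the sorted listing of the image of the
  lower half followed by the sorted listing of the complement. Shuffles thus correspond to subsets
  of size m.\<close>

lemma Theta_eqI:
  assumes t: "t \<in> Theta m" and u: "u \<in> Theta m" and eq: "perm_of t ` {0..<m} = perm_of u ` {0..<m}"
  shows "t = u"
proof (rule Bgrp_eqI[OF ThetaD(1)[OF t] ThetaD(1)[OF u]])
  fix j assume j: "j < 2 * m"
  show "colour t j = colour u j" using ThetaD(3) t u j by simp
  show "perm_of t j = perm_of u j"
  proof (cases "j < m")
    case True
    then show ?thesis
      using strict_mono_on_image_unique[OF ThetaD(4)[OF t] ThetaD(4)[OF u] eq] by simp
  next
    case False
    have "perm_of t ` {m..<2 * m} = perm_of u ` {m..<2 * m}"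
      using permutes_upper_half[OF ThetaD(2)[OF t]] permutes_upper_half[OF ThetaD(2)[OF u]] eq by simp
    then show ?thesis
      using strict_mono_on_image_unique[OF ThetaD(5)[OF t] ThetaD(5)[OF u]] False j by simp
  qed
qed

lemma Theta_ex:
  assumes A: "A \<subseteq> {..<2 * m}" "card A = m"
  shows "\<exists>t\<in>Theta m. perm_of t ` {0..<m} = A"
proof -
  have fA: "finite A" using A(1) finite_subset by auto
  let ?B = "{..<2 * m} - A"
  have cB: "card ?B = m" using A by (simp add: card_Diff_subset fA)
  have fB: "finite ?B" by simp
  define l1 where "l1 = sorted_list_of_set A"
  define l2 where "l2 = sorted_list_of_set ?B"
  have l1: "length l1 = m" "set l1 = A" "sorted_wrt (<) l1"
    and l2: "length l2 = m" "set l2 = ?B" "sorted_wrt (<) l2"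
    using fA cB A(2) by (simp_all add: l1_def l2_def)
  define \<sigma> where "\<sigma> i = (if i < m then l1 ! i else if i < 2 * m then l2 ! (i - m) else i)" for i
  have im1: "\<sigma> ` {0..<m} = A"
  proof -
    have "\<sigma> ` {0..<m} = (!) l1 ` {0..<m}" by (rule image_cong) (auto simp: \<sigma>_def)
    then show ?thesis using l1 by (simp add: nth_image[of m l1, simplified])
  qed
  have im2: "\<sigma> ` {m..<2 * m} = ?B"
  proof -
    have "\<sigma> ` {m..<2 * m} = (!) l2 ` {0..<m}"
    proof (intro equalityI subsetI)
      fix x assume "x \<in> \<sigma> ` {m..<2 * m}"
      then obtain i where "m \<le> i" "i < 2 * m" "x = l2 ! (i - m)" by (auto simp: \<sigma>_def)
      then show "x \<in> (!) l2 ` {0..<m}" by auto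
    next
      fix x assume "x \<in> (!) l2 ` {0..<m}"
      then obtain i where "i < m" "x = l2 ! i" by auto
      then have "x = \<sigma> (m + i)" "m + i \<in> {m..<2 * m}" by (auto simp: \<sigma>_def)
      then show "x \<in> \<sigma> ` {m..<2 * m}" by blast
    qed
    then show ?thesis using l2 by (simp add: nth_image[of m l2, simplified])
  qed
  have "{..<2 * m} = {0..<m} \<union> {m..<2 * m}" by auto
  then have im: "\<sigma> ` {..<2 * m} = {..<2 * m}" using im1 im2 A(1) by (simp add: image_Un Un_absorb1)
  then have "inj_on \<sigma> {..<2 * m}" by (intro eq_card_imp_inj_on) simp_all
  then have p: "\<sigma> permutes {..<2 * m}"
    using im by (intro bij_imp_permutes) (auto simp: bij_betw_def \<sigma>_def)
  have "strict_mono_on {0..<m} \<sigma>"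
    using l1 by (intro strict_mono_onI) (auto simp: \<sigma>_def sorted_wrt_iff_nth_less)
  moreover have "strict_mono_on {m..<2 * m} \<sigma>"
  proof (rule strict_mono_onI)
    fix i j assume ij: "i \<in> {m..<2 * m}" "j \<in> {m..<2 * m}" "i < j"
    then have "i - m < j - m" "j - m < m" by auto
    then have "l2 ! (i - m) < l2 ! (j - m)" using l2 by (simp add: sorted_wrt_iff_nth_less)
    then show "\<sigma> i < \<sigma> j" using ij by (simp add: \<sigma>_def)
  qed
  ultimately have "signed_perm (2 * m) \<sigma> (\<lambda>_. 0) \<in> Theta m" by (rule ThetaI[OF p])
  then show ?thesis by (rule bexI[rotated]) (simp add: perm_of_signed_perm[OF p] im1)
qed

text \<open>The permutation underlying diag(x1, x2), continued by the identity so that it permutes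
  the set of 2m positions.\<close>

definition block_perm :: "(nat \<Rightarrow> nat) \<Rightarrow> (nat \<Rightarrow> nat) \<Rightarrow> nat \<Rightarrow> nat" where
  "block_perm p q i = (if i < m then p i else if i < 2 * m then m + q (i - m) else i)"

lemma half_cases:
  assumes "j < 2 * m"
  obtains "j < m" | i where "i < m" "j = m + i"
proof (cases "j < m")
  case False
  then have "j - m < m" "j = m + (j - m)" using assms by auto
  then show ?thesis using that(2) by blast
qed (use that(1) in blast)

lemma block_perm_permutes:
  assumes p: "p permutes {..<m}" and q: "q permutes {..<m}"
  shows "block_perm p q permutes {..<2 * m}"
proof (rule inj_imp_permutes)
  have less: "p i < m" "q i < m" if "i < m" for i
    using permutes_in_image[OF p, of i] permutes_in_image[OF q, of i] that by simp_all
  show "block_perm p q i \<in> {..<2 * m}" if "i \<in> {..<2 * m}" for i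
  proof -
    have "i < 2 * m" using that by simp
    then show ?thesis by (cases rule: half_cases) (use less in \<open>force simp: block_perm_def\<close>)+
  qed
  show "inj_on (block_perm p q) {..<2 * m}"
  proof (rule inj_onI)
    fix i j assume "i \<in> {..<2 * m}" "j \<in> {..<2 * m}" and eq: "block_perm p q i = block_perm p q j"
    then have i: "i < 2 * m" and j: "j < 2 * m" by simp_all
    show "i = j"
      using i
    proof (cases rule: half_cases)
      case 1
      with j show ?thesis
        by (cases rule: half_cases)
          (use less eq 1 in \<open>force simp: block_perm_def permutes_inj[OF p, THEN injD]\<close>)+
    next
      case (2 i')
      with j show ?thesis
        by (cases rule: half_cases)
          (use less eq 2 in \<open>force simp: block_perm_def inj_eq[OF permutes_inj[OF q]]\<close>)+
    qed
  qed
qed (auto simp: block_perm_def)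

lemma diag2_eq:
  assumes x: "x \<in> carrier (Bgrp m)" and y: "y \<in> carrier (Bgrp m)"
  shows "diag2 m x y = signed_perm (2 * m) (block_perm (perm_of x) (perm_of y))
    (\<lambda>j. if j < m then colour x j else colour y (j - m))"
proof (rule eq_matI)
  fix j k
  assume "j < dim_row (signed_perm (2 * m) (block_perm (perm_of x) (perm_of y))
    (\<lambda>j. if j < m then colour x j else colour y (j - m)))"
    and "k < dim_col (signed_perm (2 * m) (block_perm (perm_of x) (perm_of y))
    (\<lambda>j. if j < m then colour x j else colour y (j - m)))"
  then have jk: "j < 2 * m" "k < 2 * m" by simp_all
  have lx: "perm_of x i < m" "perm_of y i < m" if "i < m" for i
    using perm_of_unique(1)[OF x that] perm_of_unique(1)[OF y that] .
  show "diag2 m x y $$ (j, k) = signed_perm (2 * m) (block_perm (perm_of x) (perm_of y))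
    (\<lambda>j. if j < m then colour x j else colour y (j - m)) $$ (j, k)"
    using jk(1)
  proof (cases rule: half_cases)
    case 1
    have "diag2 m x y $$ (j, k) = (if k < m then x $$ (j, k) else 0)"
      using 1 jk by (simp add: diag2_def Bgrp_dim[OF x] Bgrp_dim[OF y])
    then show ?thesis using 1 jk lx[OF 1]
      by (auto simp: signed_perm_def block_perm_def Bgrp_entry[OF x])
  next
    case (2 i)
    have "diag2 m x y $$ (j, k) = (if k < m then 0 else y $$ (i, k - m))"
      using 2 jk by (simp add: diag2_def Bgrp_dim[OF x] Bgrp_dim[OF y])
    then show ?thesis using 2 jk lx(2)[OF 2(1)]
      by (auto simp: signed_perm_def block_perm_def Bgrp_entry[OF y])
  qed
qed (simp_all add: diag2_def Bgrp_dim[OF x] Bgrp_dim[OF y])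

text \<open>The identity x t = t' diag(x1, x2) position by position. Shuffles have colour 0
  throughout, so the colours of x1 and x2 are those of x read along the two halves of t.\<close>

definition is_decomp :: "int mat \<Rightarrow> int mat \<Rightarrow> int mat \<Rightarrow> int mat \<Rightarrow> int mat \<Rightarrow> bool" where
  "is_decomp x t t' x1 x2 \<longleftrightarrow> t' \<in> Theta m \<and> x1 \<in> carrier (Bgrp m) \<and> x2 \<in> carrier (Bgrp m) \<and>
    (\<forall>i<m. perm_of x (perm_of t i) = perm_of t' (perm_of x1 i) \<and>
      perm_of x (perm_of t (m + i)) = perm_of t' (m + perm_of x2 i) \<and>
      colour x1 i = colour x (perm_of t i) \<and> colour x2 i = colour x (perm_of t (m + i)))"

lemma is_decomp_iff:
  assumes x: "x \<in> carrier (Bgrp (2 * m))" and t: "t \<in> Theta m" and t': "t' \<in> Theta m"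
    and x1: "x1 \<in> carrier (Bgrp m)" and x2: "x2 \<in> carrier (Bgrp m)"
  shows "x \<otimes>\<^bsub>Bgrp (2 * m)\<^esub> t = t' \<otimes>\<^bsub>Bgrp (2 * m)\<^esub> diag2 m x1 x2 \<longleftrightarrow> is_decomp x t t' x1 x2"
proof -
  let ?d = "diag2 m x1 x2"
  have b: "block_perm (perm_of x1) (perm_of x2) permutes {..<2 * m}"
    by (rule block_perm_permutes[OF perm_of_permutes[OF x1] perm_of_permutes[OF x2]])
  have d: "?d \<in> carrier (Bgrp (2 * m))" "perm_of ?d = block_perm (perm_of x1) (perm_of x2)"
    and cd: "\<And>j. j < 2 * m \<Longrightarrow> colour ?d j = (if j < m then colour x1 j else colour x2 (j - m))"
    unfolding diag2_eq[OF x1 x2]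
    by (simp_all only: signed_perm_closed[OF b] perm_of_signed_perm[OF b] colour_signed_perm[OF b])
  note tB = ThetaD(1)[OF t] and tB' = ThetaD(1)[OF t']
  have less: "perm_of ?d j < 2 * m" if "j < 2 * m" for j using perm_of_unique(1)[OF d(1) that] .
  let ?P = "\<lambda>j. perm_of x (perm_of t j) = perm_of t' (perm_of ?d j) \<and> colour x (perm_of t j) = colour ?d j"
  have "x \<otimes>\<^bsub>Bgrp (2 * m)\<^esub> t = t' \<otimes>\<^bsub>Bgrp (2 * m)\<^esub> ?d \<longleftrightarrow>
      (\<forall>j<2 * m. perm_of (x \<otimes>\<^bsub>Bgrp (2 * m)\<^esub> t) j = perm_of (t' \<otimes>\<^bsub>Bgrp (2 * m)\<^esub> ?d) j \<and>
        colour (x \<otimes>\<^bsub>Bgrp (2 * m)\<^esub> t) j = colour (t' \<otimes>\<^bsub>Bgrp (2 * m)\<^esub> ?d) j)"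
    using Bgrp_eqI[OF Bgrp_mult_closed[OF x tB] Bgrp_mult_closed[OF tB' d(1)]] by auto
  also have "\<dots> \<longleftrightarrow> (\<forall>j<2 * m. ?P j)"
  proof -
    have "colour (x \<otimes>\<^bsub>Bgrp (2 * m)\<^esub> t) j = colour x (perm_of t j)"
      "colour (t' \<otimes>\<^bsub>Bgrp (2 * m)\<^esub> ?d) j = colour ?d j" if "j < 2 * m" for j
      using that less[OF that]
      by (simp_all only: colour_mult[OF x tB] colour_mult[OF tB' d(1)] ThetaD(3)[OF t] ThetaD(3)[OF t']
          add_0_left add_0_right)
    then show ?thesis by (simp add: perm_of_mult[OF x tB] perm_of_mult[OF tB' d(1)])
  qed
  also have "\<dots> \<longleftrightarrow> (\<forall>i<m. ?P i \<and> ?P (m + i))"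
  proof
    assume a: "\<forall>i<m. ?P i \<and> ?P (m + i)"
    show "\<forall>j<2 * m. ?P j"
    proof (intro allI impI)
      fix j assume "j < 2 * m" then show "?P j"
        by (cases rule: half_cases) (use a in blast)+
    qed
  qed simp
  also have "\<dots> \<longleftrightarrow> is_decomp x t t' x1 x2"
    unfolding is_decomp_def using t' x1 x2 by (auto simp: d(2) cd block_perm_def)
  finally show ?thesis .
qed

lemma is_decomp_image:
  assumes d: "is_decomp x t t' x1 x2"
  shows "perm_of t' ` {0..<m} = perm_of x ` perm_of t ` {0..<m}"
proof -
  have "x1 \<in> carrier (Bgrp m)" using d by (simp add: is_decomp_def)
  then have "perm_of x1 ` {0..<m} = {0..<m}"
    using permutes_image[OF perm_of_permutes] by (simp add: lessThan_atLeast0)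
  then have "perm_of t' ` {0..<m} = (\<lambda>i. perm_of t' (perm_of x1 i)) ` {0..<m}" by (metis image_image)
  also have "\<dots> = (\<lambda>i. perm_of x (perm_of t i)) ` {0..<m}"
    by (rule image_cong) (use d in \<open>auto simp: is_decomp_def\<close>)
  finally show ?thesis by (simp add: image_image)
qed

text \<open>The image of the lower half determines t'; injectivity of t' then determines both
  blocks.\<close>

lemma is_decomp_unique:
  assumes "is_decomp x t t' x1 x2" "is_decomp x t u y1 y2"
  shows "t' = u \<and> x1 = y1 \<and> x2 = y2"
proof -
  have u: "t' \<in> Theta m" "u \<in> Theta m" using assms by (simp_all add: is_decomp_def)
  have tu: "t' = u" by (rule Theta_eqI[OF u]) (simp add: is_decomp_image[OF assms(1)] is_decomp_image[OF assms(2)])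
  have inj: "perm_of t' i = perm_of t' j \<longleftrightarrow> i = j" for i j
    using permutes_inj[OF ThetaD(2)[OF u(1)]] by (simp add: inj_eq)
  have "x1 = y1"
  proof (rule Bgrp_eqI[of _ m])
    fix j assume "j < m"
    then have "perm_of t' (perm_of x1 j) = perm_of t' (perm_of y1 j)"
      using assms unfolding is_decomp_def tu by metis
    then show "perm_of x1 j = perm_of y1 j" using inj by simp
  qed (use assms in \<open>auto simp: is_decomp_def\<close>)
  moreover have "x2 = y2"
  proof (rule Bgrp_eqI[of _ m])
    fix j assume "j < m"
    then have "perm_of t' (m + perm_of x2 j) = perm_of t' (m + perm_of y2 j)"
      using assms unfolding is_decomp_def tu by metis
    then show "perm_of x2 j = perm_of y2 j" using inj by simp
  qed (use assms in \<open>auto simp: is_decomp_def\<close>)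
  ultimately show ?thesis using tu by simp
qed

lemma decomp_eqI:
  assumes x: "x \<in> carrier (Bgrp (2 * m))" and t: "t \<in> Theta m" and d: "is_decomp x t t' x1 x2"
  shows "decomp m x t = (t', x1, x2)"
  unfolding decomp_def
proof (rule the_equality)
  show "case (t', x1, x2) of (t', x1, x2) \<Rightarrow> t' \<in> Theta m \<and> x1 \<in> carrier (Bgrp m) \<and>
      x2 \<in> carrier (Bgrp m) \<and> x \<otimes>\<^bsub>Bgrp (2 * m)\<^esub> t = t' \<otimes>\<^bsub>Bgrp (2 * m)\<^esub> diag2 m x1 x2"
    using is_decomp_iff[OF x t] d by (auto simp: is_decomp_def)
next
  fix p assume p: "case p of (t', x1, x2) \<Rightarrow> t' \<in> Theta m \<and> x1 \<in> carrier (Bgrp m) \<and>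
      x2 \<in> carrier (Bgrp m) \<and> x \<otimes>\<^bsub>Bgrp (2 * m)\<^esub> t = t' \<otimes>\<^bsub>Bgrp (2 * m)\<^esub> diag2 m x1 x2"
  obtain u y1 y2 where u: "p = (u, y1, y2)" by (cases p) auto
  then have "is_decomp x t u y1 y2" using p is_decomp_iff[OF x t] by auto
  then show "p = (t', x1, x2)" using is_decomp_unique[OF d] u by auto
qed

text \<open>Shuffles represent the cosets of the product of two symmetric groups of degree m. The
  image of the lower half under \<sigma> selects t, and the blocks are t^(-1) \<sigma> restricted to
  the halves.\<close>

lemma shuffle_factorization:
  assumes \<sigma>: "\<sigma> permutes {..<2 * m}"
  obtains t p q where "t \<in> Theta m" "p permutes {..<m}" "q permutes {..<m}"
    "\<And>i. i < m \<Longrightarrow> \<sigma> i = perm_of t (p i)" "\<And>i. i < m \<Longrightarrow> \<sigma> (m + i) = perm_of t (m + q i)"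
proof -
  have inj: "inj \<sigma>" by (rule permutes_inj[OF \<sigma>])
  have "\<sigma> ` {0..<m} \<subseteq> \<sigma> ` {..<2 * m}" by (rule image_mono) auto
  then have "\<sigma> ` {0..<m} \<subseteq> {..<2 * m}" using permutes_image[OF \<sigma>] by simp
  moreover have "card (\<sigma> ` {0..<m}) = m" using inj_on_subset[OF inj] by (simp add: card_image)
  ultimately obtain t where t: "t \<in> Theta m" and lo: "perm_of t ` {0..<m} = \<sigma> ` {0..<m}"
    using Theta_ex by blast
  let ?t = "perm_of t"
  have tp: "?t permutes {..<2 * m}" by (rule ThetaD(2)[OF t])
  have hi: "?t ` {m..<2 * m} = \<sigma> ` {m..<2 * m}"
    using permutes_upper_half[OF \<sigma>] permutes_upper_half[OF tp] lo by simp
  have ti: "pinv ?t (?t j) = j" "?t (pinv ?t j) = j" for j using permutes_inverses[OF tp] by auto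
  have lo': "pinv ?t (\<sigma> i) < m" if "i < m" for i
  proof -
    have "\<sigma> i \<in> ?t ` {0..<m}" unfolding lo using that by auto
    then show ?thesis using ti by auto
  qed
  have hi': "m \<le> pinv ?t (\<sigma> (m + i)) \<and> pinv ?t (\<sigma> (m + i)) < 2 * m" if "i < m" for i
  proof -
    have "\<sigma> (m + i) \<in> ?t ` {m..<2 * m}" unfolding hi using that by auto
    then show ?thesis using ti by auto
  qed
  have inj2: "pinv ?t (\<sigma> i) = pinv ?t (\<sigma> j) \<longleftrightarrow> i = j" for i j
    using inj ti by (metis injD)
  define p where "p i = (if i < m then pinv ?t (\<sigma> i) else i)" for i
  define q where "q i = (if i < m then pinv ?t (\<sigma> (m + i)) - m else i)" for i
  have p: "p permutes {..<m}"
    by (rule inj_imp_permutes) (use lo' inj2 in \<open>auto simp: p_def inj_on_def\<close>)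
  have q: "q permutes {..<m}"
  proof (rule inj_imp_permutes)
    show "inj_on q {..<m}"
    proof (rule inj_onI)
      fix i j assume ij: "i \<in> {..<m}" "j \<in> {..<m}" "q i = q j"
      then have "pinv ?t (\<sigma> (m + i)) = pinv ?t (\<sigma> (m + j))"
        using hi'[of i] hi'[of j] by (simp add: q_def eq_diff_iff)
      then show "i = j" unfolding inj2 by simp
    qed
    show "q i \<in> {..<m}" if "i \<in> {..<m}" for i using that hi'[of i] by (auto simp: q_def)
  qed (auto simp: q_def)
  show thesis
  proof (rule that[OF t p q])
    fix i assume i: "i < m"
    show "\<sigma> i = ?t (p i)" using i by (simp add: p_def ti)
    have "m + q i = pinv ?t (\<sigma> (m + i))" using i hi'[OF i] by (simp add: q_def)
    then show "\<sigma> (m + i) = ?t (m + q i)" by (simp add: ti)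
  qed
qed

lemma decompE:
  assumes x: "x \<in> carrier (Bgrp (2 * m))" and t: "t \<in> Theta m"
  obtains t' x1 x2 where "decomp m x t = (t', x1, x2)" "is_decomp x t t' x1 x2"
proof -
  have xt: "perm_of x \<circ> perm_of t permutes {..<2 * m}"
    by (rule permutes_compose[OF ThetaD(2)[OF t] perm_of_permutes[OF x]])
  obtain t' p q where t': "t' \<in> Theta m" "p permutes {..<m}" "q permutes {..<m}"
    "\<And>i. i < m \<Longrightarrow> perm_of x (perm_of t i) = perm_of t' (p i)"
    "\<And>i. i < m \<Longrightarrow> perm_of x (perm_of t (m + i)) = perm_of t' (m + q i)"
    using shuffle_factorization[OF xt] unfolding comp_apply by metis
  have "is_decomp x t t' (signed_perm m p (\<lambda>i. colour x (perm_of t i)))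
      (signed_perm m q (\<lambda>i. colour x (perm_of t (m + i))))"
    unfolding is_decomp_def using t'
    by (simp add: signed_perm_closed perm_of_signed_perm colour_signed_perm)
  then show ?thesis using decomp_eqI[OF x t] that by blast
qed

lemma total_colour_decomp:
  assumes "is_decomp x t t' x1 x2"
  shows "total_colour x2 = (\<Sum>i<m. colour x (perm_of t (m + i)))"
proof -
  have "(\<Sum>i<m. colour x2 i) = (\<Sum>i<m. colour x (perm_of t (m + i)))"
    by (rule sum.cong) (use assms in \<open>auto simp: is_decomp_def\<close>)
  then show ?thesis using assms total_colour_eq[of x2 m] by (simp add: is_decomp_def)
qed

section \<open>Exchanging the two halves of a shuffle\<close>

definition swap_halves :: "nat \<Rightarrow> nat" where
  "swap_halves j = (if j < m then m + j else if j < 2 * m then j - m else j)"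

lemma swap_halves_permutes: "swap_halves permutes {..<2 * m}"
  by (rule inj_imp_permutes) (auto simp: inj_on_def swap_halves_def split: if_splits)

lemma hat_perm:
  assumes t: "t \<in> Theta m"
  shows "hat_perm m t \<in> Theta m"
    "i < m \<Longrightarrow> perm_of (hat_perm m t) i = perm_of t (m + i)"
    "i < m \<Longrightarrow> perm_of (hat_perm m t) (m + i) = perm_of t i"
proof -
  \<comment> \<open>The formula inside \<open>hat_perm\<close> is not the identity from position 2m
    on; this version is, as \<open>permutes\<close> demands, and it gives the same matrix.\<close>
  define \<sigma> where "\<sigma> j = (if j < m then perm_of t (m + j) else if j < 2 * m then perm_of t (j - m) else j)" for j
  have "\<sigma> = perm_of t \<circ> swap_halves"
    using permutes_not_in[OF ThetaD(2)[OF t]] by (auto simp: \<sigma>_def swap_halves_def fun_eq_iff)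
  then have p: "\<sigma> permutes {..<2 * m}"
    using permutes_compose[OF swap_halves_permutes ThetaD(2)[OF t]] by simp
  have eq: "hat_perm m t = signed_perm (2 * m) \<sigma> (\<lambda>_. 0)"
    unfolding hat_perm_def perm_mat_def signed_perm_def
    by (rule cong_mat) (auto simp: \<sigma>_def sgn_int_def add.commute)
  have "strict_mono_on {0..<m} \<sigma>"
    using ThetaD(5)[OF t] by (auto simp: strict_mono_on_def \<sigma>_def)
  moreover have "strict_mono_on {m..<2 * m} \<sigma>"
  proof (rule strict_mono_onI)
    fix i j assume ij: "i \<in> {m..<2 * m}" "j \<in> {m..<2 * m}" "i < j"
    then have "i - m < j - m" "j - m < m" by auto
    then have "perm_of t (i - m) < perm_of t (j - m)"
      using strict_mono_onD[OF ThetaD(4)[OF t]] by simp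
    then show "\<sigma> i < \<sigma> j" using ij by (simp add: \<sigma>_def)
  qed
  ultimately show "hat_perm m t \<in> Theta m" unfolding eq by (rule ThetaI[OF p])
  show "i < m \<Longrightarrow> perm_of (hat_perm m t) i = perm_of t (m + i)"
    "i < m \<Longrightarrow> perm_of (hat_perm m t) (m + i) = perm_of t i"
    unfolding eq perm_of_signed_perm[OF p] by (simp_all add: \<sigma>_def)
qed

lemma hat_perm_hat:
  assumes t: "t \<in> Theta m"
  shows "hat_perm m (hat_perm m t) = t"
proof (rule Theta_eqI[OF hat_perm(1)[OF hat_perm(1)[OF t]] t])
  show "perm_of (hat_perm m (hat_perm m t)) ` {0..<m} = perm_of t ` {0..<m}"
    by (rule image_cong) (simp_all add: hat_perm t)
qed

text \<open>Exchanging the halves of both shuffles exchanges the two blocks. This drives the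
  commutation of S with the action.\<close>

lemma is_decomp_hat:
  "\<lbrakk>t \<in> Theta m; is_decomp x t t' x1 x2\<rbrakk> \<Longrightarrow> is_decomp x (hat_perm m t) (hat_perm m t') x2 x1"
  unfolding is_decomp_def using perm_of_unique(1)[of _ m] by (auto simp: hat_perm)

end

section \<open>Antisymmetric lifts as shuffles with a permutation\<close>

lemma sum_halves: "sum f {..<2 * m} = (\<Sum>i<m. f i) + (\<Sum>i<m. f (m + i))"
  for f :: "nat \<Rightarrow> 'a::comm_monoid_add"
proof -
  have "sum f {..<m + k} = (\<Sum>i<m. f i) + (\<Sum>i<k. f (m + i))" for k
    by (induction k) (simp_all add: add.assoc)
  then show ?thesis by (simp add: mult_2)
qed

text \<open>The shuffle t lists the positions of colour 0 and then those of colour 1, both in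
  increasing order, and w matches the i-th of the former with the s(i)-th of the latter. Only the
  lower half of w is recorded; antisymmetry gives the other half in
  \<open>is_pair_upper\<close>.\<close>

definition is_pair :: "nat \<Rightarrow> int mat \<Rightarrow> int mat \<Rightarrow> (nat \<Rightarrow> nat) \<Rightarrow> bool" where
  "is_pair m w t s \<longleftrightarrow> t \<in> Theta m \<and> s permutes {..<m} \<and>
    (\<forall>i<m. perm_of w (perm_of t i) = perm_of t (m + s i) \<and> colour w (perm_of t i) = 0 \<and>
      colour w (perm_of t (m + i)) = 1)"

lemma is_pairD:
  assumes "is_pair m w t s"
  shows "t \<in> Theta m" "s permutes {..<m}" "i < m \<Longrightarrow> perm_of w (perm_of t i) = perm_of t (m + s i)"
    "i < m \<Longrightarrow> colour w (perm_of t i) = 0" "i < m \<Longrightarrow> colour w (perm_of t (m + i)) = 1"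
  using assms by (simp_all add: is_pair_def)

lemma Theta_less:
  assumes "t \<in> Theta m"
  shows "perm_of t j < 2 * m \<longleftrightarrow> j < 2 * m"
  using permutes_in_image[OF ThetaD(2)[OF assms], of j] by simp

lemma Theta_surj:
  assumes "t \<in> Theta m" "j < 2 * m"
  obtains i where "i < m" "j = perm_of t i" | i where "i < m" "j = perm_of t (m + i)"
proof -
  obtain k where k: "k < 2 * m" "j = perm_of t k"
    using permutes_image[OF ThetaD(2)[OF assms(1)]] assms(2) by (metis imageE lessThan_iff)
  then show ?thesis using half_cases[OF k(1)] that by metis
qed

lemma Theta_inj: "t \<in> Theta m \<Longrightarrow> perm_of t i = perm_of t j \<longleftrightarrow> i = j"
  using permutes_inj[OF ThetaD(2)] by (auto simp: inj_eq)

text \<open>The permutation of w exchanges the two colour classes, so each has m elements; t is then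
  the shuffle attached to the class of colour 0.\<close>

lemma is_pair_ex:
  assumes w: "w \<in> antisym_lifts (2 * m)"
  shows "\<exists>t s. is_pair m w t s"
proof -
  let ?N = "{..<2 * m}" and ?p = "perm_of w"
  define A where "A = {j \<in> ?N. colour w j = 0}"
  have p: "?p permutes ?N" by (rule perm_of_permutes[OF antisym_lifts_closed[OF w]])
  have c: "colour w (?p j) = 0 \<longleftrightarrow> colour w j = 1" if "j < 2 * m" for j
    using antisym_liftsD(2)[OF w that] by (cases "colour w j") auto
  have im: "?p ` A = ?N - A"
  proof (intro equalityI subsetI)
    fix x assume "x \<in> ?p ` A"
    then obtain j where j: "j < 2 * m" "colour w j = 0" "x = ?p j" by (auto simp: A_def)
    then show "x \<in> ?N - A" using c antisym_liftsD(3)[OF w] by (simp add: A_def)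
  next
    fix x assume "x \<in> ?N - A"
    then have x: "x < 2 * m" "colour w x = 1" by (auto simp: A_def)
    then have "?p x \<in> A" using c antisym_liftsD(3)[OF w] by (simp add: A_def)
    then show "x \<in> ?p ` A" using antisym_liftsD(1)[OF w x(1)] by (metis imageI)
  qed
  have fA: "finite A" by (simp add: A_def)
  have "card (?N - A) = card A"
    unfolding im[symmetric] by (rule card_image) (use permutes_inj[OF p] inj_on_subset in blast)
  moreover have "card (?N - A) = 2 * m - card A"
    by (subst card_Diff_subset[OF fA]) (auto simp: A_def)
  moreover have "card A \<le> card ?N" by (rule card_mono) (auto simp: A_def)
  ultimately have "card A = m" by simp
  then obtain t where t: "t \<in> Theta m" and tA: "perm_of t ` {0..<m} = A"
    using Theta_ex[of A m] by (auto simp: A_def)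
  let ?t = "perm_of t"
  have ti: "pinv ?t (?t j) = j" "?t (pinv ?t j) = j" for j
    using permutes_inverses[OF ThetaD(2)[OF t]] by auto
  have hi: "?t ` {m..<2 * m} = ?N - A"
    using permutes_upper_half[OF ThetaD(2)[OF t]] tA by simp
  have wt: "m \<le> pinv ?t (?p (?t i)) \<and> pinv ?t (?p (?t i)) < 2 * m" if "i < m" for i
  proof -
    have "?p (?t i) \<in> ?p ` A" using tA that by auto
    then have "?p (?t i) \<in> ?t ` {m..<2 * m}" using im hi by simp
    then show ?thesis using ti by auto
  qed
  define s where "s i = (if i < m then pinv ?t (?p (?t i)) - m else i)" for i
  have "s permutes {..<m}"
  proof (rule inj_imp_permutes)
    show "inj_on s {..<m}"
    proof (rule inj_onI)
      fix i j assume ij: "i \<in> {..<m}" "j \<in> {..<m}" "s i = s j"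
      then have "pinv ?t (?p (?t i)) = pinv ?t (?p (?t j))"
        using wt[of i] wt[of j] by (simp add: s_def eq_diff_iff)
      then have "?p (?t i) = ?p (?t j)" using ti by metis
      then show "i = j" using permutes_inj[OF p] Theta_inj[OF t] by (simp add: inj_eq)
    qed
    show "s i \<in> {..<m}" if "i \<in> {..<m}" for i using that wt[of i] by (auto simp: s_def)
  qed (auto simp: s_def)
  moreover have "?p (?t i) = ?t (m + s i)" if "i < m" for i
  proof -
    have "m + s i = pinv ?t (?p (?t i))" using wt[OF that] that by (simp add: s_def)
    then show ?thesis by (simp add: ti)
  qed
  moreover have "colour w (?t i) = 0" if "i < m" for i
    using tA that by (auto simp: A_def)
  moreover have "colour w (?t (m + i)) = 1" if "i < m" for i
  proof -
    have "?t (m + i) \<in> ?N - A" using hi that by auto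
    then show ?thesis by (auto simp: A_def)
  qed
  ultimately have "is_pair m w t s" using t unfolding is_pair_def by blast
  then show ?thesis by blast
qed

lemma is_pair_unique:
  assumes p: "is_pair m w t s" and p': "is_pair m w t' s'"
  shows "t = t' \<and> s = s'"
proof -
  have lo: "perm_of u ` {0..<m} = {j. j < 2 * m \<and> colour w j = 0}" if "is_pair m w u v" for u v
  proof (intro equalityI subsetI)
    fix j assume "j \<in> perm_of u ` {0..<m}"
    then show "j \<in> {j. j < 2 * m \<and> colour w j = 0}"
      using is_pairD(4)[OF that] Theta_less[OF is_pairD(1)[OF that]] by auto
  next
    fix j assume j: "j \<in> {j. j < 2 * m \<and> colour w j = 0}"
    then have "j < 2 * m" by simp
    with is_pairD(1)[OF that] show "j \<in> perm_of u ` {0..<m}"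
      by (rule Theta_surj) (use j is_pairD(5)[OF that] in auto)
  qed
  have t: "t = t'"
    by (rule Theta_eqI[OF is_pairD(1)[OF p] is_pairD(1)[OF p']]) (use lo[OF p] lo[OF p'] in simp)
  have "s i = s' i" for i
  proof (cases "i < m")
    case True
    then have "perm_of t (m + s i) = perm_of t (m + s' i)"
      using is_pairD(3)[OF p] is_pairD(3)[OF p'] t by simp
    then show ?thesis using Theta_inj[OF is_pairD(1)[OF p]] by simp
  next
    case False
    then show ?thesis using permutes_not_in[OF is_pairD(2)[OF p]] permutes_not_in[OF is_pairD(2)[OF p']]
      by simp
  qed
  then show ?thesis using t by auto
qed

lemma is_pair_upper:
  assumes w: "w \<in> antisym_lifts (2 * m)" and p: "is_pair m w t s" and i: "i < m"
  shows "perm_of w (perm_of t (m + s i)) = perm_of t i"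
    "perm_of w (perm_of t (m + i)) = perm_of t (pinv s i)"
proof -
  have *: "perm_of w (perm_of t (m + s i)) = perm_of t i" if "i < m" for i
    using antisym_liftsD(1)[OF w, of "perm_of t i"] is_pairD(3)[OF p that] Theta_less[OF is_pairD(1)[OF p]] that
    by simp
  show "perm_of w (perm_of t (m + s i)) = perm_of t i" by (rule *[OF i])
  have s: "s permutes {..<m}" by (rule is_pairD(2)[OF p])
  have "pinv s i < m" using permutes_in_image[OF permutes_inv[OF s], of i] i by simp
  from *[OF this] show "perm_of w (perm_of t (m + i)) = perm_of t (pinv s i)"
    using permutes_inverses[OF s] by simp
qed

lemma is_pair_exists_lift:
  assumes t: "t \<in> Theta m" and s: "s permutes {..<m}"
  shows "\<exists>w\<in>antisym_lifts (2 * m). is_pair m w t s"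
proof -
  let ?t = "perm_of t"
  have tp: "?t permutes {..<2 * m}" by (rule ThetaD(2)[OF t])
  \<comment> \<open>The wanted permutation in the coordinates given by t: it sends i to m + s(i),
    and m + i to the preimage of i under s. It is an involution.\<close>
  define q where "q = swap_halves m \<circ> block_perm m s (pinv s)"
  have q: "q permutes {..<2 * m}" unfolding q_def
    by (rule permutes_compose[OF block_perm_permutes[OF s permutes_inv[OF s]] swap_halves_permutes])
  have sl: "s i < m" "pinv s i < m" if "i < m" for i
    using permutes_in_image[OF s, of i] permutes_in_image[OF permutes_inv[OF s], of i] that by simp_all
  have q_lo: "q i = m + s i" and q_hi: "q (m + i) = pinv s i" if "i < m" for i
    using sl[OF that] that by (simp_all add: q_def block_perm_def swap_halves_def)
  define p where "p = ?t \<circ> q \<circ> pinv ?t"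
  have p: "p permutes {..<2 * m}" unfolding p_def
    by (rule permutes_compose[OF permutes_inv[OF tp] permutes_compose[OF q tp]])
  have pt: "p (?t j) = ?t (q j)" for j using permutes_inverses[OF tp] by (simp add: p_def)
  \<comment> \<open>Colour 1 exactly on the positions that t lists in its upper half.\<close>
  define z :: "nat \<Rightarrow> bit" where "z j = (if pinv ?t j < m then 0 else 1)" for j
  have zt: "z (?t j) = (if j < m then 0 else 1)" for j using permutes_inverses[OF tp] by (simp add: z_def)
  define w where "w = signed_perm (2 * m) p z"
  have wB: "w \<in> carrier (Bgrp (2 * m))" unfolding w_def by (rule signed_perm_closed[OF p])
  have wp: "perm_of w = p" unfolding w_def by (rule perm_of_signed_perm[OF p])
  have wc: "colour w j = z j" if "j < 2 * m" for j unfolding w_def by (rule colour_signed_perm[OF p that])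
  have "w \<in> antisym_lifts (2 * m)"
    unfolding antisym_lifts_iff[OF wB] wp
  proof (intro allI impI)
    fix j assume j: "j < 2 * m"
    show "p (p j) = j \<and> colour w (p j) = colour w j + 1"
    proof (cases rule: Theta_surj[OF t j])
      case (1 i)
      then show ?thesis using sl[OF 1(1)] Theta_less[OF t] permutes_inverses[OF s]
        by (simp add: wc pt q_lo q_hi zt)
    next
      case (2 i)
      then show ?thesis using sl[OF 2(1)] Theta_less[OF t] permutes_inverses[OF s]
        by (simp add: wc pt q_lo q_hi zt)
    qed
  qed
  moreover have "is_pair m w t s"
    unfolding is_pair_def using t s Theta_less[OF t] by (auto simp: wp wc pt q_lo zt)
  ultimately show ?thesis by blast
qed

lemma is_pair_lift_unique:
  assumes w: "w \<in> antisym_lifts (2 * m)" and w': "w' \<in> antisym_lifts (2 * m)"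
    and p: "is_pair m w t s" and p': "is_pair m w' t s"
  shows "w = w'"
proof (rule Bgrp_eqI[OF antisym_lifts_closed[OF w] antisym_lifts_closed[OF w']])
  fix j assume j: "j < 2 * m"
  show "perm_of w j = perm_of w' j"
    by (cases rule: Theta_surj[OF is_pairD(1)[OF p] j])
      (simp_all add: is_pairD(3)[OF p] is_pairD(3)[OF p'] is_pair_upper(2)[OF w p] is_pair_upper(2)[OF w' p'])
  show "colour w j = colour w' j"
    by (cases rule: Theta_surj[OF is_pairD(1)[OF p] j])
      (simp_all add: is_pairD(4)[OF p] is_pairD(4)[OF p'] is_pairD(5)[OF p] is_pairD(5)[OF p'])
qed

text \<open>Negation exchanges the colour classes, so the halves of t are swapped and the matching
  is read backwards. On labels this is the effect of S.\<close>

lemma is_pair_uminus: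
  assumes w: "w \<in> antisym_lifts (2 * m)" and p: "is_pair m w t s"
  shows "is_pair m (- w) (hat_perm m t) (pinv s)"
proof -
  note wB = antisym_lifts_closed[OF w] and t = is_pairD(1)[OF p]
  have "pinv s i < m" if "i < m" for i
    using permutes_in_image[OF permutes_inv[OF is_pairD(2)[OF p]], of i] that by simp
  then show ?thesis
    unfolding is_pair_def using hat_perm[OF t] permutes_inv[OF is_pairD(2)[OF p]] Theta_less[OF t]
    by (simp add: perm_of_uminus[OF wB] colour_uminus[OF wB] is_pair_upper[OF w p] is_pairD[OF p])
qed

abbreviation abs_conj :: "nat \<Rightarrow> int mat \<Rightarrow> int mat \<Rightarrow> int mat" where
  "abs_conj n g w \<equiv> abs_mat g \<otimes>\<^bsub>Bgrp n\<^esub> w \<otimes>\<^bsub>Bgrp n\<^esub> inv\<^bsub>Bgrp n\<^esub> abs_mat g"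

lemma abs_mat_perm_mats:
  assumes "g \<in> carrier (Bgrp n)"
  shows "abs_mat g \<in> perm_mats n"
  using perm_mats_iff[OF abs_mat_closed[OF assms]] colour_abs_mat[OF assms] by simp

lemma abs_conj:
  assumes g: "g \<in> carrier (Bgrp n)" and w: "w \<in> antisym_lifts n"
  shows "abs_conj n g w \<in> antisym_lifts n"
    "perm_of (abs_conj n g w) (perm_of g j) = perm_of g (perm_of w j)"
    "j < n \<Longrightarrow> colour (abs_conj n g w) (perm_of g j) = colour w j"
  using conj_antisym_lifts[OF abs_mat_perm_mats[OF g] w]
    perm_of_conj[OF abs_mat_closed[OF g] antisym_lifts_closed[OF w], of j]
    colour_conj[OF abs_mat_perm_mats[OF g] antisym_lifts_closed[OF w], of j]
  by (simp_all add: perm_of_abs_mat[OF g])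

text \<open>Conjugation by |x| carries the colour classes of w along, so the new shuffle is the t'
  of the factorization of x t. The two blocks relabel the two ends of the matching, which gives the
  two-sided action x2 s x1^(-1).\<close>

lemma is_pair_conj:
  assumes x: "x \<in> carrier (Bgrp (2 * m))" and w: "w \<in> antisym_lifts (2 * m)"
    and p: "is_pair m w t s" and d: "is_decomp m x t t' x1 x2"
  shows "is_pair m (abs_conj (2 * m) x w) t' (perm_of x2 \<circ> s \<circ> pinv (perm_of x1))"
proof -
  have x1: "x1 \<in> carrier (Bgrp m)" and x2: "x2 \<in> carrier (Bgrp m)" and t': "t' \<in> Theta m"
    and d1: "\<And>i. i < m \<Longrightarrow> perm_of t' (perm_of x1 i) = perm_of x (perm_of t i)"
    and d2: "\<And>i. i < m \<Longrightarrow> perm_of t' (m + perm_of x2 i) = perm_of x (perm_of t (m + i))"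
    using d by (simp_all add: is_decomp_def)
  note p1 = perm_of_permutes[OF x1] and p2 = perm_of_permutes[OF x2] and s = is_pairD(2)[OF p]
  have less: "pinv (perm_of x1) i < m" "pinv (perm_of x2) i < m" "s i < m" if "i < m" for i
    using permutes_in_image[OF permutes_inv[OF p1], of i] permutes_in_image[OF permutes_inv[OF p2], of i]
      permutes_in_image[OF s, of i] that by simp_all
  have e1: "perm_of t' i = perm_of x (perm_of t (pinv (perm_of x1) i))"
    and e2: "perm_of t' (m + i) = perm_of x (perm_of t (m + pinv (perm_of x2) i))" if "i < m" for i
    using d1[OF less(1)[OF that]] d2[OF less(2)[OF that]] permutes_inverses[OF p1] permutes_inverses[OF p2]
    by simp_all
  have tl: "perm_of t i < 2 * m" "perm_of t (m + i) < 2 * m" if "i < m" for i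
    using Theta_less[OF is_pairD(1)[OF p]] that by simp_all
  show ?thesis unfolding is_pair_def
  proof (intro conjI allI impI t')
    show "perm_of x2 \<circ> s \<circ> pinv (perm_of x1) permutes {..<m}"
      by (intro permutes_compose permutes_inv p1 p2 s)
    fix i assume i: "i < m"
    note l = less[OF i]
    show "perm_of (abs_conj (2 * m) x w) (perm_of t' i) =
        perm_of t' (m + (perm_of x2 \<circ> s \<circ> pinv (perm_of x1)) i)"
      using d2[OF less(3)[OF l(1)]] is_pairD(3)[OF p l(1)] by (simp add: e1[OF i] abs_conj(2)[OF x w])
    show "colour (abs_conj (2 * m) x w) (perm_of t' i) = 0"
      using abs_conj(3)[OF x w tl(1)[OF l(1)]] is_pairD(4)[OF p l(1)] by (simp add: e1[OF i])
    show "colour (abs_conj (2 * m) x w) (perm_of t' (m + i)) = 1"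
      using abs_conj(3)[OF x w tl(2)[OF l(2)]] is_pairD(5)[OF p l(2)] by (simp add: e2[OF i])
  qed
qed

text \<open>The colours of w are 0 on the lower and 1 on the upper half of t, so the pairing
  collects the colours of x on the upper half. It matches the sign \<delta>(x2) of the tensor action
  with the sign in M(c1).\<close>

lemma pairing_eq_total_colour:
  assumes p: "is_pair m w t s" and d: "is_decomp m x t t' x1 x2"
  shows "(\<Sum>j<2 * m. colour x j * colour w j) = total_colour x2"
proof -
  let ?t = "perm_of t"
  have "(\<Sum>j<2 * m. colour x j * colour w j) = (\<Sum>j<2 * m. colour x (?t j) * colour w (?t j))"
    using sum.permute[OF ThetaD(2)[OF is_pairD(1)[OF p]], of "\<lambda>j. colour x j * colour w j"]
    by (simp only: comp_def)
  also have "\<dots> = (\<Sum>i<m. colour x (?t i) * colour w (?t i)) + (\<Sum>i<m. colour x (?t (m + i)) * colour w (?t (m + i)))"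
    by (rule sum_halves)
  also have "(\<Sum>i<m. colour x (?t i) * colour w (?t i)) = 0"
    by (rule sum.neutral) (use is_pairD(4)[OF p] in auto)
  also have "(\<Sum>i<m. colour x (?t (m + i)) * colour w (?t (m + i))) = (\<Sum>i<m. colour x (?t (m + i)))"
    by (rule sum.cong) (use is_pairD(5)[OF p] in auto)
  finally show ?thesis by (simp only: total_colour_decomp[OF d] add_0_left)
qed

section \<open>The representation on \<open>T \<otimes> V \<otimes> V\<close>\<close>

lemma act_tabloid_eq_iff:
  assumes "\<pi> permutes S"
  shows "act_tabloid \<pi> X = act_tabloid \<pi> Y \<longleftrightarrow> X = Y"
  using act_tabloid_inv(1)[OF assms] by metis

lemma specht_act_ebasis:
  "a \<in> tabloids \<mu> \<Longrightarrow> rep_act (specht \<mu>) x (ebasis a) = ebasis (act_tabloid (perm_of x) a)"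
  by (simp add: specht_def lin_ext_unit finite_tabloids act_tabloid_def)

context
  fixes m :: nat and \<mu> :: "nat list"
  assumes \<mu>: "sum_list \<mu> = m"
begin

lemma tensor_ebasis: "tensor t (ebasis a) (ebasis b) p = (if p = (t, a, b) then 1 else 0)"
  by (cases p) (auto simp: tensor_def ebasis_def)

text \<open>On basis labels x acts as a signed permutation, so only one label contributes to the
  value at the image label. The formula holds for every function F, inside the Specht part or
  not.\<close>

lemma TVV_act_apply:
  assumes x: "x \<in> carrier (Bgrp (2 * m))" and t: "t \<in> Theta m" and d: "is_decomp m x t t' x1 x2"
    and a: "a \<in> tabloids \<mu>" and b: "b \<in> tabloids \<mu>"
  shows "rep_act (TVV m \<mu>) x F (t', act_tabloid (perm_of x1) a, act_tabloid (perm_of x2) b) =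
    sgn_bit (total_colour x2) * F (t, a, b)"
proof -
  let ?\<phi> = "\<lambda>(t, a, b). case decomp m x t of (t', x1, x2) \<Rightarrow>
    fscale (sgn_bit (total_colour x2))
      (tensor t' (rep_act (specht \<mu>) x1 (ebasis a)) (rep_act (specht \<mu>) x2 (ebasis b)))"
  let ?p = "(t', act_tabloid (perm_of x1) a, act_tabloid (perm_of x2) b)"
  have fin: "finite (TVV_labels m \<mu>)" by (simp add: TVV_labels_def finite_Theta finite_tabloids)
  have "?\<phi> l ?p = (if l = (t, a, b) then sgn_bit (total_colour x2) else 0)" if "l \<in> TVV_labels m \<mu>" for l
  proof -
    obtain u c e where l: "l = (u, c, e)" and u: "u \<in> Theta m" and ce: "c \<in> tabloids \<mu>" "e \<in> tabloids \<mu>"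
      using \<open>l \<in> TVV_labels m \<mu>\<close> by (auto simp: TVV_labels_def)
    obtain u' y1 y2 where u': "decomp m x u = (u', y1, y2)" and du: "is_decomp m x u u' y1 y2"
      by (rule decompE[OF x u])
    have \<phi>: "?\<phi> l ?p = sgn_bit (total_colour y2) *
        (if ?p = (u', act_tabloid (perm_of y1) c, act_tabloid (perm_of y2) e) then 1 else 0)"
      unfolding l prod.case u' specht_act_ebasis[OF ce(1)] specht_act_ebasis[OF ce(2)] fscale_def tensor_ebasis ..
    \<comment> \<open>The image of the lower half under t' is that under t moved by the injective
      |x|, so t' determines t.\<close>
    have "u = t" if "u' = t'"
    proof (rule Theta_eqI[OF u t])
      have "perm_of x ` perm_of u ` {0..<m} = perm_of x ` perm_of t ` {0..<m}"
        using is_decomp_image[OF du] is_decomp_image[OF d] that by simp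
      then show "perm_of u ` {0..<m} = perm_of t ` {0..<m}"
        using permutes_inj[OF perm_of_permutes[OF x]] by (simp add: inj_image_eq_iff)
    qed
    note inj = this
    have px: "perm_of x1 permutes {..<m}" "perm_of x2 permutes {..<m}"
      using d by (auto simp: is_decomp_def intro: perm_of_permutes)
    show ?thesis
    proof (cases "u = t")
      case True
      have "u' = t' \<and> y1 = x1 \<and> y2 = x2" using is_decomp_unique[OF du[unfolded True] d] by simp
      then show ?thesis unfolding \<phi> unfolding l using True
        by (simp add: act_tabloid_eq_iff[OF px(1)] act_tabloid_eq_iff[OF px(2)])
    next
      case False
      then show ?thesis unfolding \<phi> unfolding l using inj by auto
    qed
  qed
  then have "rep_act (TVV m \<mu>) x F ?p = (\<Sum>l\<in>TVV_labels m \<mu>. if l = (t, a, b) then F l * sgn_bit (total_colour x2) else 0)"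
    unfolding TVV_def rep.simps lin_ext_apply by (intro sum.cong) simp_all
  also have "\<dots> = sgn_bit (total_colour x2) * F (t, a, b)"
    using fin t a b by (simp add: TVV_labels_def)
  finally show ?thesis .
qed

text \<open>Factor the inverse of |x| times t' into a shuffle t and two blocks; the inverses of the
  blocks, coloured by x along t, give the factorization of x t.\<close>

lemma TVV_label_surj:
  assumes x: "x \<in> carrier (Bgrp (2 * m))" and l: "t' \<in> Theta m"
  obtains t x1 x2 where "t \<in> Theta m" "is_decomp m x t t' x1 x2"
proof -
  have "perm_of (inv\<^bsub>Bgrp (2 * m)\<^esub> x) \<circ> perm_of t' permutes {..<2 * m}"
    using permutes_compose[OF ThetaD(2)[OF l] perm_of_permutes] x group.inv_closed[OF group_Bgrp] by blast
  then have xt: "pinv (perm_of x) \<circ> perm_of t' permutes {..<2 * m}" by (simp add: perm_of_inv[OF x])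
  obtain t p q where t: "t \<in> Theta m" "p permutes {..<m}" "q permutes {..<m}"
    "\<And>i. i < m \<Longrightarrow> pinv (perm_of x) (perm_of t' i) = perm_of t (p i)"
    "\<And>i. i < m \<Longrightarrow> pinv (perm_of x) (perm_of t' (m + i)) = perm_of t (m + q i)"
    using shuffle_factorization[OF xt] unfolding comp_apply by metis
  have less: "pinv p i < m" "pinv q i < m" if "i < m" for i
    using permutes_in_image[OF permutes_inv[OF t(2)], of i] permutes_in_image[OF permutes_inv[OF t(3)], of i] that
    by simp_all
  have "perm_of x (perm_of t i) = perm_of t' (pinv p i)"
    "perm_of x (perm_of t (m + i)) = perm_of t' (m + pinv q i)" if "i < m" for i
    using t(4)[OF less(1)[OF that]] t(5)[OF less(2)[OF that]] permutes_inverses[OF t(2)]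
      permutes_inverses[OF t(3)] permutes_inverses[OF perm_of_permutes[OF x]] by (metis, metis)
  then have "is_decomp m x t t' (signed_perm m (pinv p) (\<lambda>i. colour x (perm_of t i)))
      (signed_perm m (pinv q) (\<lambda>i. colour x (perm_of t (m + i))))"
    unfolding is_decomp_def using l permutes_inv[OF t(2)] permutes_inv[OF t(3)]
    by (simp add: signed_perm_closed perm_of_signed_perm colour_signed_perm)
  then show ?thesis using t(1) that by blast
qed

lemma TVV_act_outside:
  assumes x: "x \<in> carrier (Bgrp (2 * m))" and p: "p \<notin> TVV_labels m \<mu>"
  shows "rep_act (TVV m \<mu>) x F p = 0"
  unfolding TVV_def rep.simps lin_ext_apply
proof (rule sum.neutral, rule ballI)
  fix l assume "l \<in> TVV_labels m \<mu>"
  then obtain u c e where l: "l = (u, c, e)" and u: "u \<in> Theta m" and ce: "c \<in> tabloids \<mu>" "e \<in> tabloids \<mu>"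
    by (auto simp: TVV_labels_def)
  obtain u' y1 y2 where u': "decomp m x u = (u', y1, y2)" and du: "is_decomp m x u u' y1 y2"
    by (rule decompE[OF x u])
  have "perm_of y1 permutes {..<sum_list \<mu>}" "perm_of y2 permutes {..<sum_list \<mu>}" "u' \<in> Theta m"
    using du \<mu> by (auto simp: is_decomp_def intro: perm_of_permutes)
  then have "(u', act_tabloid (perm_of y1) c, act_tabloid (perm_of y2) e) \<in> TVV_labels m \<mu>"
    using ce act_tabloid_closed by (simp add: TVV_labels_def)
  then show "F l * (case l of (t, a, b) \<Rightarrow> case decomp m x t of (t', x1, x2) \<Rightarrow>
      fscale (sgn_bit (total_colour x2))
        (tensor t' (rep_act (specht \<mu>) x1 (ebasis a)) (rep_act (specht \<mu>) x2 (ebasis b)))) p = 0"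
    unfolding l prod.case u' specht_act_ebasis[OF ce(1)] specht_act_ebasis[OF ce(2)] fscale_def tensor_ebasis
    using p by auto
qed

lemma TVV_swap_apply:
  assumes t: "t \<in> Theta m" and a: "a \<in> tabloids \<mu>" and b: "b \<in> tabloids \<mu>"
  shows "TVV_swap m \<mu> F (hat_perm m t, b, a) = F (t, a, b)"
proof -
  have fin: "finite (TVV_labels m \<mu>)" by (simp add: TVV_labels_def finite_Theta finite_tabloids)
  have "TVV_swap m \<mu> F (hat_perm m t, b, a) = (\<Sum>l\<in>TVV_labels m \<mu>. if l = (t, a, b) then F l else 0)"
    unfolding TVV_swap_def lin_ext_apply
  proof (rule sum.cong[OF refl])
    fix l assume "l \<in> TVV_labels m \<mu>"
    then obtain u c e where l: "l = (u, c, e)" and u: "u \<in> Theta m" by (auto simp: TVV_labels_def)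
    have "hat_perm m u = hat_perm m t \<longleftrightarrow> u = t" using hat_perm_hat u t by metis
    then show "F l * (case l of (t, a, b) \<Rightarrow> tensor (hat_perm m t) (ebasis b) (ebasis a)) (hat_perm m t, b, a) =
        (if l = (t, a, b) then F l else 0)"
      unfolding l prod.case tensor_ebasis by auto
  qed
  then show ?thesis using fin t a b by (simp add: TVV_labels_def)
qed

lemma TVV_swap_outside:
  assumes "p \<notin> TVV_labels m \<mu>"
  shows "TVV_swap m \<mu> F p = 0"
  unfolding TVV_swap_def lin_ext_apply
proof (rule sum.neutral, rule ballI)
  fix l assume "l \<in> TVV_labels m \<mu>"
  then obtain u c e where l: "l = (u, c, e)" and u: "u \<in> Theta m" "c \<in> tabloids \<mu>" "e \<in> tabloids \<mu>"
    by (auto simp: TVV_labels_def)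
  then have "(hat_perm m u, e, c) \<in> TVV_labels m \<mu>" by (simp add: TVV_labels_def hat_perm)
  then show "F l * (case l of (t, a, b) \<Rightarrow> tensor (hat_perm m t) (ebasis b) (ebasis a)) p = 0"
    unfolding l prod.case tensor_ebasis using assms by auto
qed

lemma tensor_in_specht_tensors:
  assumes "v \<in> rep_space (specht \<mu>)" "w \<in> rep_space (specht \<mu>)"
  shows "(\<lambda>(X, Y). v X * w Y) \<in> specht_tensors \<mu>"
proof -
  note S = subspace_specht_tensors[of \<mu>]
  have 1: "(\<lambda>(X, Y). polytabloid \<mu> T X * w Y) \<in> specht_tensors \<mu>" if T: "T \<in> tableaux \<mu>" for T
  proof -
    let ?f = "\<lambda>w (X, Y). polytabloid \<mu> T X * w Y"
    have "?f (u + v) = ?f u + ?f v" "?f (fscale c u) = fscale c (?f u)"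
      "?f (0 :: nat set list \<Rightarrow> complex) = (0 :: nat set list \<times> nat set list \<Rightarrow> complex)"
      for u v :: "nat set list \<Rightarrow> complex" and c
      by (auto simp: fscale_def algebra_simps)
    then have "cfun.subspace {w. ?f w \<in> specht_tensors \<mu>}"
      using S by (simp only: cfun.subspace_def mem_Collect_eq) blast
    then have "cfun.span (polytabloid \<mu> ` tableaux \<mu>) \<subseteq> {w. ?f w \<in> specht_tensors \<mu>}"
      by (rule cfun.span_minimal[rotated]) (use specht_tensors_base[OF T] in auto)
    then show ?thesis using assms(2) by (auto simp: specht_def)
  qed
  let ?f = "\<lambda>v (X, Y). v X * w Y"
  have "?f (u + v) = ?f u + ?f v" "?f (fscale c u) = fscale c (?f u)"
    "?f (0 :: nat set list \<Rightarrow> complex) = (0 :: nat set list \<times> nat set list \<Rightarrow> complex)"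
    for u v :: "nat set list \<Rightarrow> complex" and c
    by (auto simp: fscale_def algebra_simps)
  then have "cfun.subspace {v. ?f v \<in> specht_tensors \<mu>}"
    using S by (simp only: cfun.subspace_def mem_Collect_eq) blast
  then have "cfun.span (polytabloid \<mu> ` tableaux \<mu>) \<subseteq> {v. ?f v \<in> specht_tensors \<mu>}"
    by (rule cfun.span_minimal[rotated]) (use 1 in auto)
  then show ?thesis using assms(1) by (auto simp: specht_def)
qed

text \<open>T is a permutation basis, so the space is that of families of elements of the tensor
  square of V indexed by shuffles. The matrix coefficient lemmas can then be applied to one shuffle
  at a time.\<close>

lemma TVV_space_iff:
  "F \<in> rep_space (TVV m \<mu>) \<longleftrightarrow> (\<forall>t\<in>Theta m. (\<lambda>p. F (t, p)) \<in> specht_tensors \<mu>) \<and>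
    (\<forall>t p. t \<notin> Theta m \<longrightarrow> F (t, p) = 0)" (is "_ \<longleftrightarrow> ?R F")
proof
  note S = subspace_specht_tensors[of \<mu>]
  let ?T = "{tensor t v w |t v w. t \<in> Theta m \<and> v \<in> rep_space (specht \<mu>) \<and> w \<in> rep_space (specht \<mu>)}"
  assume "F \<in> rep_space (TVV m \<mu>)"
  moreover have "cfun.span ?T \<subseteq> {F. ?R F}"
  proof (rule cfun.span_minimal)
    show "?T \<subseteq> {F. ?R F}"
    proof clarify
      fix t v w assume t: "t \<in> Theta m" and vw: "v \<in> rep_space (specht \<mu>)" "w \<in> rep_space (specht \<mu>)"
      have "(\<lambda>p. tensor t v w (u, p)) = (if u = t then (\<lambda>(X, Y). v X * w Y) else 0)" for u
        by (auto simp: tensor_def ebasis_def fun_eq_iff)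
      then show "?R (tensor t v w)"
        using tensor_in_specht_tensors[OF vw] cfun.subspace_0[OF S] t
        by (auto simp: tensor_def ebasis_def)
    qed
    have "?R 0" using cfun.subspace_0[OF S] unfolding zero_fun_def by simp
    moreover have "?R (u + v)" if "?R u" "?R v" for u v
      using that cfun.subspace_add[OF S] unfolding plus_fun_def by simp
    moreover have "?R (fscale c u)" if "?R u" for c u
      using that cfun.subspace_scale[OF S] unfolding fscale_def by simp
    ultimately show "cfun.subspace {F. ?R F}" unfolding cfun.subspace_def by blast
  qed
  ultimately show "?R F" by (auto simp: TVV_def)
next
  assume R: "?R F"
  have TVV: "cfun.subspace (rep_space (TVV m \<mu>))" by (simp add: TVV_def)
  define E where "E t G = (\<lambda>(s, X, Y). ebasis t s * G (X, Y))"
    for t :: "int mat" and G :: "nat set list \<times> nat set list \<Rightarrow> complex"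
  have E: "E t G \<in> rep_space (TVV m \<mu>)" if t: "t \<in> Theta m" and G: "G \<in> specht_tensors \<mu>" for t G
    using G
  proof (rule specht_tensors_induct)
    have "E t (u + v) = E t u + E t v" "E t (fscale c u) = fscale c (E t u)" "E t 0 = 0" for u v c
      by (auto simp: E_def fscale_def algebra_simps)
    then show "cfun.subspace {G. E t G \<in> rep_space (TVV m \<mu>)}"
      using TVV by (simp only: cfun.subspace_def mem_Collect_eq) blast
    fix T T' assume T: "T \<in> tableaux \<mu>" "T' \<in> tableaux \<mu>"
    have "E t (\<lambda>(X, Y). polytabloid \<mu> T X * polytabloid \<mu> T' Y) = tensor t (polytabloid \<mu> T) (polytabloid \<mu> T')"
      by (auto simp: E_def tensor_def)
    moreover have "polytabloid \<mu> T \<in> rep_space (specht \<mu>)" "polytabloid \<mu> T' \<in> rep_space (specht \<mu>)"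
      using T by (auto simp: specht_def intro: cfun.span_base)
    ultimately show "E t (\<lambda>(X, Y). polytabloid \<mu> T X * polytabloid \<mu> T' Y) \<in> rep_space (TVV m \<mu>)"
      using t by (auto simp: TVV_def intro!: cfun.span_base)
  qed
  have "F = (\<Sum>t\<in>Theta m. E t (\<lambda>p. F (t, p)))"
  proof
    fix p :: "int mat \<times> nat set list \<times> nat set list"
    obtain s X Y where p: "p = (s, X, Y)" by (cases p) auto
    have "(\<Sum>t\<in>Theta m. E t (\<lambda>p. F (t, p))) p = (\<Sum>t\<in>Theta m. E t (\<lambda>p. F (t, p)) p)"
      using lin_ext_apply[of "Theta m" "\<lambda>t. E t (\<lambda>p. F (t, p))" "\<lambda>_. 1" p]
      by (simp add: lin_ext_def fscale_def)
    also have "\<dots> = (\<Sum>t\<in>Theta m. if t = s then F (s, X, Y) else 0)"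
      by (rule sum.cong) (auto simp: E_def p ebasis_def)
    also have "\<dots> = F p" using R by (auto simp: p finite_Theta)
    finally show "F p = (\<Sum>t\<in>Theta m. E t (\<lambda>p. F (t, p))) p" ..
  qed
  also have "\<dots> \<in> rep_space (TVV m \<mu>)"
    using R by (intro cfun.subspace_sum[OF TVV] E) auto
  finally show "F \<in> rep_space (TVV m \<mu>)" .
qed

lemma TVV_act_closed:
  assumes x: "x \<in> carrier (Bgrp (2 * m))" and F: "F \<in> rep_space (TVV m \<mu>)"
  shows "rep_act (TVV m \<mu>) x F \<in> rep_space (TVV m \<mu>)"
  unfolding TVV_space_iff
proof (intro conjI ballI allI impI)
  note S = subspace_specht_tensors[of \<mu>]
  fix t' assume t': "t' \<in> Theta m"
  obtain t x1 x2 where t: "t \<in> Theta m" and d: "is_decomp m x t t' x1 x2" by (rule TVV_label_surj[OF x t'])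
  have p: "perm_of x1 permutes {..<sum_list \<mu>}" "perm_of x2 permutes {..<sum_list \<mu>}"
    using d \<mu> by (auto simp: is_decomp_def intro: perm_of_permutes)
  let ?G = "\<lambda>p. F (t, p)"
  have G: "?G \<in> specht_tensors \<mu>" using F t by (simp add: TVV_space_iff)
  have "rep_act (TVV m \<mu>) x F (t', X, Y) = sgn_bit (total_colour x2) *
      F (t, act_tabloid (pinv (perm_of x1)) X, act_tabloid (pinv (perm_of x2)) Y)" for X Y
  proof (cases "X \<in> tabloids \<mu> \<and> Y \<in> tabloids \<mu>")
    case True
    then have "act_tabloid (pinv (perm_of x1)) X \<in> tabloids \<mu>" "act_tabloid (pinv (perm_of x2)) Y \<in> tabloids \<mu>"
      using act_tabloid_closed permutes_inv p by blast+
    from TVV_act_apply[OF x t d this, of F] show ?thesis by (simp add: act_tabloid_inv(2)[OF p(1)] act_tabloid_inv(2)[OF p(2)])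
  next
    case False
    then have "act_tabloid (pinv (perm_of x1)) X \<notin> tabloids \<mu> \<or> act_tabloid (pinv (perm_of x2)) Y \<notin> tabloids \<mu>"
      using act_tabloid_closed[OF p(1)] act_tabloid_closed[OF p(2)] act_tabloid_inv(2)[OF p(1)] act_tabloid_inv(2)[OF p(2)]
      by metis
    from specht_tensors_support[OF G this] show ?thesis
      using False TVV_act_outside[OF x] by (auto simp: TVV_labels_def)
  qed
  then have "(\<lambda>p. rep_act (TVV m \<mu>) x F (t', p)) = fscale (sgn_bit (total_colour x2))
      (\<lambda>(X, Y). ?G (act_tabloid (pinv (perm_of x1)) X, act_tabloid (pinv (perm_of x2)) Y))"
    by (auto simp: fscale_def)
  also have "\<dots> \<in> specht_tensors \<mu>"
    by (intro cfun.subspace_scale[OF S] specht_tensors_act[OF _ _ G] permutes_inv p)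
  finally show "(\<lambda>p. rep_act (TVV m \<mu>) x F (t', p)) \<in> specht_tensors \<mu>" .
qed (use TVV_act_outside[OF x] in \<open>auto simp: TVV_labels_def\<close>)

lemma TVV_swap_closed:
  assumes F: "F \<in> rep_space (TVV m \<mu>)"
  shows "TVV_swap m \<mu> F \<in> rep_space (TVV m \<mu>)"
  unfolding TVV_space_iff
proof (intro conjI ballI allI impI)
  fix t assume t: "t \<in> Theta m"
  have h: "hat_perm m t \<in> Theta m" by (rule hat_perm(1)[OF t])
  have G: "(\<lambda>p. F (hat_perm m t, p)) \<in> specht_tensors \<mu>" using F h by (simp add: TVV_space_iff)
  have "TVV_swap m \<mu> F (t, X, Y) = F (hat_perm m t, Y, X)" for X Y
  proof (cases "X \<in> tabloids \<mu> \<and> Y \<in> tabloids \<mu>")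
    case True
    then show ?thesis using TVV_swap_apply[OF h, of Y X F] by (simp add: hat_perm_hat[OF t])
  next
    case False
    then have "Y \<notin> tabloids \<mu> \<or> X \<notin> tabloids \<mu>" by blast
    from specht_tensors_support[OF G this] show ?thesis
      using False TVV_swap_outside by (auto simp: TVV_labels_def)
  qed
  then have "(\<lambda>p. TVV_swap m \<mu> F (t, p)) = (\<lambda>(X, Y). F (hat_perm m t, Y, X))" by auto
  then show "(\<lambda>p. TVV_swap m \<mu> F (t, p)) \<in> specht_tensors \<mu>"
    using specht_tensors_swap[OF G] by simp
qed (use TVV_swap_outside in \<open>auto simp: TVV_labels_def\<close>)

text \<open>After exchanging halves the blocks are x2, x1, so the two sides carry the signs of z(x2)
  and z(x1). Their sum is z(x), which is 0 on D_n, hence the signs agree.\<close>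

lemma TVV_swap_act:
  assumes x: "x \<in> carrier (Dgrp (2 * m))"
  shows "TVV_swap m \<mu> (rep_act (TVV m \<mu>) x F) = rep_act (TVV m \<mu>) x (TVV_swap m \<mu> F)"
proof
  fix p :: "int mat \<times> nat set list \<times> nat set list"
  have xB: "x \<in> carrier (Bgrp (2 * m))" and x0: "total_colour x = 0" using x by (simp_all add: Dgrp_simps)
  show "TVV_swap m \<mu> (rep_act (TVV m \<mu>) x F) p = rep_act (TVV m \<mu>) x (TVV_swap m \<mu> F) p"
  proof (cases "p \<in> TVV_labels m \<mu>")
    case True
    then obtain u X Y where p: "p = (u, Y, X)" and u: "u \<in> Theta m" and XY: "X \<in> tabloids \<mu>" "Y \<in> tabloids \<mu>"
      by (auto simp: TVV_labels_def)
    let ?t' = "hat_perm m u"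
    have t': "?t' \<in> Theta m" by (rule hat_perm(1)[OF u])
    obtain t x1 x2 where t: "t \<in> Theta m" and d: "is_decomp m x t ?t' x1 x2" by (rule TVV_label_surj[OF xB t'])
    have pm: "perm_of x1 permutes {..<sum_list \<mu>}" "perm_of x2 permutes {..<sum_list \<mu>}"
      using d \<mu> by (auto simp: is_decomp_def intro: perm_of_permutes)
    define a where "a = act_tabloid (pinv (perm_of x1)) X"
    define b where "b = act_tabloid (pinv (perm_of x2)) Y"
    have ab: "a \<in> tabloids \<mu>" "b \<in> tabloids \<mu>"
      unfolding a_def b_def using act_tabloid_closed permutes_inv pm XY by blast+
    have XYab: "X = act_tabloid (perm_of x1) a" "Y = act_tabloid (perm_of x2) b"
      by (simp_all add: a_def b_def act_tabloid_inv(2)[OF pm(1)] act_tabloid_inv(2)[OF pm(2)])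
    have d': "is_decomp m x (hat_perm m t) u x2 x1"
      using is_decomp_hat[OF t d] by (simp add: hat_perm_hat[OF u])
    have "total_colour x = total_colour x1 + total_colour x2"
    proof -
      have "total_colour x = (\<Sum>j<2 * m. colour x (perm_of t j))"
        using sum.permute[OF ThetaD(2)[OF t], of "colour x"] by (simp only: total_colour_eq[OF xB] comp_def)
      also have "\<dots> = (\<Sum>i<m. colour x (perm_of t i)) + (\<Sum>i<m. colour x (perm_of t (m + i)))" by (rule sum_halves)
      also have "(\<Sum>i<m. colour x (perm_of t (m + i))) = total_colour x2"
        by (rule total_colour_decomp[OF d, symmetric])
      also have "(\<Sum>i<m. colour x (perm_of t i)) = (\<Sum>i<m. colour x (perm_of (hat_perm m t) (m + i)))"
        by (rule sum.cong) (simp_all add: hat_perm[OF t])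
      also have "\<dots> = total_colour x1" by (rule total_colour_decomp[OF d', symmetric])
      finally show ?thesis .
    qed
    then have tc: "total_colour x1 = total_colour x2"
      using x0 by (cases "total_colour x1"; cases "total_colour x2") auto
    have "TVV_swap m \<mu> (rep_act (TVV m \<mu>) x F) p = rep_act (TVV m \<mu>) x F (?t', X, Y)"
      using TVV_swap_apply[OF t' XY, of "rep_act (TVV m \<mu>) x F"] by (simp add: p hat_perm_hat[OF u])
    also have "\<dots> = sgn_bit (total_colour x2) * F (t, a, b)"
      unfolding XYab by (rule TVV_act_apply[OF xB t d ab])
    also have "\<dots> = sgn_bit (total_colour x1) * TVV_swap m \<mu> F (hat_perm m t, b, a)"
      by (simp add: tc TVV_swap_apply[OF t ab])
    also have "\<dots> = rep_act (TVV m \<mu>) x (TVV_swap m \<mu> F) p"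
      unfolding p XYab by (rule TVV_act_apply[OF xB hat_perm(1)[OF t] d' ab(2,1), symmetric])
    finally show ?thesis .
  next
    case False
    then show ?thesis by (simp add: TVV_swap_outside TVV_act_outside[OF xB])
  qed
qed

end

section \<open>The module of antisymmetric involutions\<close>

lemma linear_lin_ext: "linear_map_on V (lin_ext I \<phi>)"
  unfolding linear_map_on_def by (auto simp: fun_eq_iff lin_ext_apply fscale_def algebra_simps sum.distrib sum_distrib_left)

lemma finite_Bgrp: "finite (carrier (Bgrp n))"
proof (rule finite_subset)
  let ?f = "\<lambda>(\<sigma>, A). signed_perm n \<sigma> (\<lambda>j. if j \<in> A then 1 else 0)"
  show "carrier (Bgrp n) \<subseteq> ?f ` ({\<sigma>. \<sigma> permutes {..<n}} \<times> Pow {..<n})"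
  proof
    fix g assume g: "g \<in> carrier (Bgrp n)"
    have "g = signed_perm n (perm_of g) (colour g)" by (rule signed_perm_eq[OF g, symmetric])
    also have "\<dots> = ?f (perm_of g, {j \<in> {..<n}. colour g j = 1})"
      unfolding prod.case by (rule signed_perm_cong) auto
    finally show "g \<in> ?f ` ({\<sigma>. \<sigma> permutes {..<n}} \<times> Pow {..<n})"
      using perm_of_permutes[OF g] by blast
  qed
qed (simp add: finite_permutations)

lemma finite_c1: "finite (c1 n)"
  unfolding c1_eq using finite_subset[OF _ finite_Bgrp[of n], of "antisym_lifts n"]
  by (auto simp: antisym_lifts_def)

lemma lift_of_mem: "w \<in> antisym_lifts n \<Longrightarrow> lift_of {w, - w} = w \<or> lift_of {w, - w} = - w"
  using someI[of "\<lambda>u. u \<in> {w, - w}" w] by (auto simp: lift_of_def)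

lemma uminus_uminus_Bgrp:
  assumes "w \<in> carrier (Bgrp n)"
  shows "- (- w) = w"
  by (rule Bgrp_eqI[OF uminus_closed[OF uminus_closed[OF assms]] assms])
    (simp_all only: perm_of_uminus[OF uminus_closed[OF assms]] perm_of_uminus[OF assms]
      colour_uminus[OF uminus_closed[OF assms]] colour_uminus[OF assms] add.assoc bit_add_self add_0_right)

lemma sgn_bit_diff: "sgn_bit (a - b) = sgn_bit a * sgn_bit b"
  using sgn_bit_add[of a b] by (simp only: minus_bit_def)

text \<open>The sign of the pairing for a given lift, free of the choice in \<open>lift_of\<close>;
  for g in D_n the lifts w and -w give the same value.\<close>

definition c1_sign :: "nat \<Rightarrow> int mat \<Rightarrow> int mat \<Rightarrow> complex" where
  "c1_sign n g w = sgn_bit (\<Sum>j<n. colour g j * colour w j)"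

section \<open>The action on M(c1) expressed through lifts\<close>

context
  fixes n :: nat
  assumes n: "0 < n"
begin

lemma colour_uminus_0: "w \<in> carrier (Bgrp n) \<Longrightarrow> sgn_bit (colour (- w) 0) = - sgn_bit (colour w 0)"
  using colour_uminus[of w n 0] n by (cases "colour w 0") (simp_all add: sgn_bit_def)

lemma c1_sign_uminus:
  assumes g: "g \<in> carrier (Dgrp n)" and w: "w \<in> carrier (Bgrp n)"
  shows "c1_sign n g (- w) = c1_sign n g w"
proof -
  have gB: "g \<in> carrier (Bgrp n)" and g0: "total_colour g = 0" using g by (simp_all add: Dgrp_simps)
  have "(\<Sum>j<n. colour g j * colour (- w) j) = (\<Sum>j<n. colour g j * colour w j + colour g j)"
    by (rule sum.cong) (simp_all only: colour_uminus[OF w] lessThan_iff distrib_left mult_1_right)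
  also have "\<dots> = (\<Sum>j<n. colour g j * colour w j)"
    using g0 by (simp only: sum.distrib total_colour_eq[OF gB] add_0_right)
  finally show ?thesis by (simp only: c1_sign_def)
qed

lemma abs_conj_uminus:
  assumes "g \<in> carrier (Bgrp n)" "w \<in> carrier (Bgrp n)"
  shows "abs_conj n g (- w) = - abs_conj n g w"
  using uminus_mult_Bgrp[OF abs_mat_closed[OF assms(1)] assms(2)]
    uminus_mult_Bgrp[OF Bgrp_mult_closed[OF abs_mat_closed[OF assms(1)] assms(2)]
      group.inv_closed[OF group_Bgrp abs_mat_closed[OF assms(1)]]] by simp

text \<open>Conjugation carries the position |g|^(-1)(0) of w to position 0, so the second colour in
  \<open>a_bit\<close> belongs to position 0 of the conjugated lift.\<close>

lemma colour_abs_conj_0: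
  assumes g: "g \<in> carrier (Bgrp n)" and w: "w \<in> antisym_lifts n"
  shows "colour w (perm_of (inv\<^bsub>Bgrp n\<^esub> (abs_mat g)) 0) = colour (abs_conj n g w) 0"
proof -
  let ?j = "pinv (perm_of g) 0"
  have j: "?j < n"
    using permutes_in_image[OF permutes_inv[OF perm_of_permutes[OF g]], of 0] n by simp
  have "colour (abs_conj n g w) (perm_of g ?j) = colour w ?j" by (rule abs_conj(3)[OF g w j])
  then show ?thesis
    using permutes_inverses[OF perm_of_permutes[OF g]]
    by (simp add: perm_of_inv[OF abs_mat_closed[OF g]] perm_of_abs_mat[OF g])
qed

text \<open>The twist \<open>a(g, v)\<close> is the coboundary of the colour of position 0, so the sign in the action
  splits into a part independent of the lift and the colours of the lifts of \<open>v\<close> and \<open>g v\<close>.\<close>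

lemma M_c1_coefficient:
  assumes g: "g \<in> carrier (Dgrp n)" and w: "w \<in> antisym_lifts n"
  shows "sgn_bit (pairing n g {w, - w}) * sgn_bit (a_bit n g {w, - w}) =
    c1_sign n g w * sgn_bit (colour w 0) * sgn_bit (colour (abs_conj n g w) 0)"
proof -
  have gB: "g \<in> carrier (Bgrp n)" using g by (simp add: Dgrp_simps)
  have *: "sgn_bit (pairing n g {w, - w}) * sgn_bit (a_bit n g {w, - w}) =
    c1_sign n g u * sgn_bit (colour u 0) * sgn_bit (colour (abs_conj n g u) 0)"
    if u: "u = lift_of {w, - w}" "u \<in> antisym_lifts n" for u
    unfolding pairing_def a_bit_def u(1)[symmetric] colour_abs_conj_0[OF gB u(2)] sgn_bit_diff c1_sign_def
    by (simp only: mult.assoc)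
  have wB: "w \<in> carrier (Bgrp n)" by (rule antisym_lifts_closed[OF w])
  from lift_of_mem[OF w] show ?thesis
  proof
    assume "lift_of {w, - w} = w"
    then show ?thesis using *[of w] w by simp
  next
    assume "lift_of {w, - w} = - w"
    then have "sgn_bit (pairing n g {w, - w}) * sgn_bit (a_bit n g {w, - w}) =
      c1_sign n g (- w) * sgn_bit (colour (- w) 0) * sgn_bit (colour (abs_conj n g (- w)) 0)"
      using *[of "- w"] uminus_antisym_lifts[OF w] by simp
    \<comment> \<open>For -w both colour signs change, so their product does not.\<close>
    then show ?thesis
      by (simp add: c1_sign_uminus[OF g wB] abs_conj_uminus[OF gB wB] colour_uminus_0[OF wB]
          colour_uminus_0[OF antisym_lifts_closed[OF abs_conj(1)[OF gB w]]])
  qed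
qed

lemma conj_coset_abs: "g \<in> carrier (Bgrp n) \<Longrightarrow> w \<in> antisym_lifts n \<Longrightarrow>
    conj_coset n (abs_mat g) {w, - w} = {abs_conj n g w, - abs_conj n g w}"
  by (rule conj_coset_eq[OF abs_mat_closed antisym_lifts_closed])

lemma abs_conj_inj:
  assumes g: "g \<in> carrier (Bgrp n)" and u: "u \<in> carrier (Bgrp n)" and w: "w \<in> carrier (Bgrp n)"
  shows "abs_conj n g u = abs_conj n g w \<longleftrightarrow> u = w"
proof -
  interpret group "Bgrp n" by (rule group_Bgrp)
  show ?thesis using abs_mat_closed[OF g] u w by simp
qed

lemma conj_coset_bij:
  assumes g: "g \<in> carrier (Bgrp n)"
  shows "bij_betw (conj_coset n (abs_mat g)) (c1 n) (c1 n)"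
proof -
  have inj: "inj_on (conj_coset n (abs_mat g)) (c1 n)"
  proof (rule inj_onI)
    fix u v assume "u \<in> c1 n" "v \<in> c1 n" and eq: "conj_coset n (abs_mat g) u = conj_coset n (abs_mat g) v"
    then obtain x y where x: "x \<in> antisym_lifts n" "u = {x, - x}" and y: "y \<in> antisym_lifts n" "v = {y, - y}"
      by (auto simp: c1_eq)
    note xB = antisym_lifts_closed[OF x(1)] and yB = antisym_lifts_closed[OF y(1)]
    have "abs_conj n g x \<in> {abs_conj n g y, - abs_conj n g y}"
      using eq conj_coset_abs[OF g x(1)] conj_coset_abs[OF g y(1)] by (auto simp: x(2) y(2))
    then have "x = y \<or> x = - y"
      using abs_conj_inj[OF g xB yB] abs_conj_inj[OF g xB uminus_closed[OF yB]] abs_conj_uminus[OF g yB] by auto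
    then show "u = v" using uminus_uminus_Bgrp[OF yB] by (auto simp: x(2) y(2))
  qed
  moreover have "conj_coset n (abs_mat g) ` c1 n \<subseteq> c1 n"
    using conj_coset_abs[OF g] abs_conj(1)[OF g] by (auto simp: c1_eq)
  ultimately show ?thesis using endo_inj_surj[OF finite_c1] by (simp add: bij_betw_def)
qed

lemma M_c1_space: "f \<in> rep_space (M_c1 n) \<longleftrightarrow> (\<forall>v. v \<notin> c1 n \<longrightarrow> f v = 0)"
proof
  assume "f \<in> rep_space (M_c1 n)"
  moreover have "cfun.span (ebasis ` c1 n) \<subseteq> {f. \<forall>v. v \<notin> c1 n \<longrightarrow> f v = 0}"
    by (rule cfun.span_minimal) (auto simp: ebasis_def cfun.subspace_def fscale_def)
  ultimately show "\<forall>v. v \<notin> c1 n \<longrightarrow> f v = 0" by (auto simp: M_c1_def)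
next
  assume f: "\<forall>v. v \<notin> c1 n \<longrightarrow> f v = 0"
  have "f = (\<Sum>v\<in>c1 n. fscale (f v) (ebasis v))"
  proof
    fix u
    have "(\<Sum>v\<in>c1 n. fscale (f v) (ebasis v)) u = (\<Sum>v\<in>c1 n. f v * ebasis v u)"
      using lin_ext_apply[of "c1 n" ebasis f u] by (simp add: lin_ext_def)
    also have "\<dots> = (\<Sum>v\<in>c1 n. if v = u then f u else 0)"
      by (rule sum.cong) (auto simp: ebasis_def)
    finally show "f u = (\<Sum>v\<in>c1 n. fscale (f v) (ebasis v)) u" using f by (simp add: finite_c1)
  qed
  also have "\<dots> \<in> cfun.span (ebasis ` c1 n)"
    by (intro cfun.span_sum cfun.span_scale cfun.span_base) auto
  finally show "f \<in> rep_space (M_c1 n)" by (simp add: M_c1_def)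
qed

lemma M_c1_act_outside:
  assumes "g \<in> carrier (Bgrp n)" "u \<notin> c1 n"
  shows "rep_act (M_c1 n) g f u = 0"
proof -
  have "ebasis (conj_coset n (abs_mat g) v) u = 0" if "v \<in> c1 n" for v
    using conj_coset_bij[OF assms(1)] that assms(2) by (auto simp: bij_betw_def ebasis_def)
  then show ?thesis by (simp add: M_c1_def lin_ext_apply fscale_def)
qed

text \<open>Put differently, \<open>sgn_bit (colour w 0) * f {w, - w}\<close> is an odd function of
  w, and on such functions g acts by moving lifts with the factor \<open>c1_sign\<close>
  alone.\<close>

lemma M_c1_act_apply:
  assumes g: "g \<in> carrier (Dgrp n)" and w: "w \<in> antisym_lifts n"
  shows "rep_act (M_c1 n) g f {abs_conj n g w, - abs_conj n g w} =
    c1_sign n g w * sgn_bit (colour w 0) * sgn_bit (colour (abs_conj n g w) 0) * f {w, - w}"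
proof -
  have gB: "g \<in> carrier (Bgrp n)" using g by (simp add: Dgrp_simps)
  have wc: "{w, - w} \<in> c1 n" using w by (auto simp: c1_eq)
  let ?c = "\<lambda>v. sgn_bit (pairing n g v) * sgn_bit (a_bit n g v)"
  have "rep_act (M_c1 n) g f (conj_coset n (abs_mat g) {w, - w}) =
      (\<Sum>v\<in>c1 n. f v * (?c v * ebasis (conj_coset n (abs_mat g) v) (conj_coset n (abs_mat g) {w, - w})))"
    by (simp add: M_c1_def lin_ext_apply fscale_def)
  also have "\<dots> = (\<Sum>v\<in>c1 n. if v = {w, - w} then f v * ?c v else 0)"
  proof (rule sum.cong[OF refl])
    fix v assume "v \<in> c1 n"
    then have "conj_coset n (abs_mat g) {w, - w} = conj_coset n (abs_mat g) v \<longleftrightarrow> v = {w, - w}"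
      using conj_coset_bij[OF gB] wc by (auto simp: bij_betw_def inj_on_def)
    then show "f v * (?c v * ebasis (conj_coset n (abs_mat g) v) (conj_coset n (abs_mat g) {w, - w})) =
        (if v = {w, - w} then f v * ?c v else 0)"
      by (simp add: ebasis_def)
  qed
  also have "\<dots> = ?c {w, - w} * f {w, - w}" using wc by (simp add: finite_c1)
  finally show ?thesis by (simp only: M_c1_coefficient[OF g w] conj_coset_abs[OF gB w])
qed

lemma abs_mat_mult:
  assumes g: "g \<in> carrier (Bgrp n)" and h: "h \<in> carrier (Bgrp n)"
  shows "abs_mat (g \<otimes>\<^bsub>Bgrp n\<^esub> h) = abs_mat g \<otimes>\<^bsub>Bgrp n\<^esub> abs_mat h"
proof (rule Bgrp_eqI)
  note gh = Bgrp_mult_closed[OF g h] and a = abs_mat_closed[OF g] abs_mat_closed[OF h]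
  show "abs_mat (g \<otimes>\<^bsub>Bgrp n\<^esub> h) \<in> carrier (Bgrp n)" by (rule abs_mat_closed[OF gh])
  show "abs_mat g \<otimes>\<^bsub>Bgrp n\<^esub> abs_mat h \<in> carrier (Bgrp n)" by (rule Bgrp_mult_closed[OF a])
  fix j assume j: "j < n"
  show "perm_of (abs_mat (g \<otimes>\<^bsub>Bgrp n\<^esub> h)) j = perm_of (abs_mat g \<otimes>\<^bsub>Bgrp n\<^esub> abs_mat h) j"
    by (simp only: perm_of_abs_mat[OF gh] perm_of_mult[OF a] perm_of_mult[OF g h] perm_of_abs_mat[OF g] perm_of_abs_mat[OF h])
  have "perm_of h j < n" by (rule perm_of_unique(1)[OF h j])
  then show "colour (abs_mat (g \<otimes>\<^bsub>Bgrp n\<^esub> h)) j = colour (abs_mat g \<otimes>\<^bsub>Bgrp n\<^esub> abs_mat h) j"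
    using j by (simp only: colour_abs_mat[OF gh] colour_mult[OF a] perm_of_abs_mat[OF h] colour_abs_mat[OF g] colour_abs_mat[OF h] add_0_left)
qed

lemma abs_conj_mult:
  assumes g: "g \<in> carrier (Bgrp n)" and h: "h \<in> carrier (Bgrp n)" and w: "w \<in> carrier (Bgrp n)"
  shows "abs_conj n (g \<otimes>\<^bsub>Bgrp n\<^esub> h) w = abs_conj n g (abs_conj n h w)"
proof -
  interpret group "Bgrp n" by (rule group_Bgrp)
  show ?thesis unfolding abs_mat_mult[OF g h]
    using abs_mat_closed[OF g] abs_mat_closed[OF h] w by (simp add: m_assoc inv_mult_group)
qed

text \<open>A cocycle identity: the colour of g h at j is that of h at j plus that of g at h(j), and
  the conjugate of w has at h(j) the colour of w at j.\<close>

lemma c1_sign_mult: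
  assumes g: "g \<in> carrier (Bgrp n)" and h: "h \<in> carrier (Bgrp n)" and w: "w \<in> antisym_lifts n"
  shows "c1_sign n (g \<otimes>\<^bsub>Bgrp n\<^esub> h) w = c1_sign n g (abs_conj n h w) * c1_sign n h w"
proof -
  have "(\<Sum>j<n. colour g j * colour (abs_conj n h w) j) =
      (\<Sum>j<n. colour g (perm_of h j) * colour (abs_conj n h w) (perm_of h j))"
    using sum.permute[OF perm_of_permutes[OF h], of "\<lambda>j. colour g j * colour (abs_conj n h w) j"]
    by (simp only: comp_def)
  also have "\<dots> = (\<Sum>j<n. colour g (perm_of h j) * colour w j)"
    by (rule sum.cong) (simp_all only: abs_conj(3)[OF h w] lessThan_iff)
  finally have "(\<Sum>j<n. colour g j * colour (abs_conj n h w) j) + (\<Sum>j<n. colour h j * colour w j) =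
      (\<Sum>j<n. (colour h j + colour g (perm_of h j)) * colour w j)"
    by (simp only: sum.distrib[symmetric] distrib_right add.commute)
  also have "\<dots> = (\<Sum>j<n. colour (g \<otimes>\<^bsub>Bgrp n\<^esub> h) j * colour w j)"
    by (rule sum.cong) (simp_all only: colour_mult[OF g h] lessThan_iff)
  finally show ?thesis by (simp only: c1_sign_def flip: sgn_bit_add)
qed

lemma c1_conj_surj:
  assumes g: "g \<in> carrier (Bgrp n)" and u: "u \<in> c1 n"
  obtains w where "w \<in> antisym_lifts n" "u = {abs_conj n g w, - abs_conj n g w}"
proof -
  obtain v where v: "v \<in> c1 n" "u = conj_coset n (abs_mat g) v"
    using conj_coset_bij[OF g] u by (metis bij_betw_def imageE)
  then obtain w where "w \<in> antisym_lifts n" "v = {w, - w}" by (auto simp: c1_eq)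
  then show ?thesis using that v conj_coset_abs[OF g] by simp
qed

lemma M_c1_is_rep: "is_rep (Dgrp n) (M_c1 n)"
  unfolding is_rep_def
proof (intro conjI ballI)
  show "group (Dgrp n)" by (rule group_Dgrp)
  show "cfun.subspace (rep_space (M_c1 n))" by (simp add: M_c1_def)
  fix g assume g: "g \<in> carrier (Dgrp n)"
  then have gB: "g \<in> carrier (Bgrp n)" by (simp add: Dgrp_simps)
  show "rep_act (M_c1 n) g ` rep_space (M_c1 n) \<subseteq> rep_space (M_c1 n)"
    using M_c1_act_outside[OF gB] by (auto simp: M_c1_space)
  show "linear_map_on (rep_space (M_c1 n)) (rep_act (M_c1 n) g)"
    by (simp add: M_c1_def linear_lin_ext)
next
  fix f assume f: "f \<in> rep_space (M_c1 n)"
  interpret group "Bgrp n" by (rule group_Bgrp)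
  have one: "\<one>\<^bsub>Bgrp n\<^esub> \<in> carrier (Dgrp n)"
    using group.is_monoid[OF group_Dgrp[of n]] monoid.one_closed by (metis Dgrp_simps(3))
  show "rep_act (M_c1 n) \<one>\<^bsub>Dgrp n\<^esub> f = f"
  proof
    fix u show "rep_act (M_c1 n) \<one>\<^bsub>Dgrp n\<^esub> f u = f u"
    proof (cases "u \<in> c1 n")
      case True
      then obtain w where w: "w \<in> antisym_lifts n" "u = {w, - w}" by (auto simp: c1_eq)
      have a: "abs_mat \<one>\<^bsub>Bgrp n\<^esub> = \<one>\<^bsub>Bgrp n\<^esub>"
        by (rule Bgrp_eqI[OF abs_mat_closed[OF one_in_Bgrp] one_in_Bgrp])
          (simp_all add: perm_of_abs_mat[OF one_in_Bgrp] colour_abs_mat[OF one_in_Bgrp] colour_one)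
      have "abs_conj n \<one>\<^bsub>Bgrp n\<^esub> w = w" using antisym_lifts_closed[OF w(1)] by (simp add: a)
      moreover have "c1_sign n \<one>\<^bsub>Bgrp n\<^esub> w = 1"
        by (simp add: c1_sign_def colour_one sgn_bit_def)
      ultimately show ?thesis using M_c1_act_apply[OF one w(1), of f] by (simp add: w(2) Dgrp_simps)
    next
      case False
      then show ?thesis using M_c1_act_outside[OF one_in_Bgrp] f by (simp add: Dgrp_simps M_c1_space)
    qed
  qed
next
  fix g h f assume g: "g \<in> carrier (Dgrp n)" and h: "h \<in> carrier (Dgrp n)"
  have gB: "g \<in> carrier (Bgrp n)" and hB: "h \<in> carrier (Bgrp n)" using g h by (simp_all add: Dgrp_simps)
  have gh: "g \<otimes>\<^bsub>Bgrp n\<^esub> h \<in> carrier (Dgrp n)"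
    using monoid.m_closed[OF group.is_monoid[OF group_Dgrp] g h] by (simp add: Dgrp_simps)
  show "rep_act (M_c1 n) (g \<otimes>\<^bsub>Dgrp n\<^esub> h) f = rep_act (M_c1 n) g (rep_act (M_c1 n) h f)"
  proof
    fix u show "rep_act (M_c1 n) (g \<otimes>\<^bsub>Dgrp n\<^esub> h) f u = rep_act (M_c1 n) g (rep_act (M_c1 n) h f) u"
    proof (cases "u \<in> c1 n")
      case True
      obtain w where w: "w \<in> antisym_lifts n"
        and u: "u = {abs_conj n (g \<otimes>\<^bsub>Bgrp n\<^esub> h) w, - abs_conj n (g \<otimes>\<^bsub>Bgrp n\<^esub> h) w}"
        by (rule c1_conj_surj[OF Bgrp_mult_closed[OF gB hB] True])
      define w' where "w' = abs_conj n h w"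
      have w': "w' \<in> antisym_lifts n" unfolding w'_def by (rule abs_conj(1)[OF hB w])
      have c: "abs_conj n (g \<otimes>\<^bsub>Bgrp n\<^esub> h) w = abs_conj n g w'"
        unfolding w'_def by (rule abs_conj_mult[OF gB hB antisym_lifts_closed[OF w]])
      have "rep_act (M_c1 n) (g \<otimes>\<^bsub>Dgrp n\<^esub> h) f u =
          c1_sign n g w' * c1_sign n h w * sgn_bit (colour w 0) * sgn_bit (colour (abs_conj n g w') 0) * f {w, - w}"
        using M_c1_act_apply[OF gh w, of f] by (simp add: u Dgrp_simps c c1_sign_mult[OF gB hB w] flip: w'_def)
      moreover have "rep_act (M_c1 n) g (rep_act (M_c1 n) h f) u =
          c1_sign n g w' * sgn_bit (colour w' 0) * sgn_bit (colour (abs_conj n g w') 0) *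
          (c1_sign n h w * sgn_bit (colour w 0) * sgn_bit (colour w' 0) * f {w, - w})"
        using M_c1_act_apply[OF g w', of "rep_act (M_c1 n) h f"] M_c1_act_apply[OF h w, of f]
        by (simp add: u c flip: w'_def)
      \<comment> \<open>The colour sign of the intermediate lift \<open>w'\<close> occurs twice and
        cancels.\<close>
      ultimately show ?thesis by (simp add: mult_ac)
    next
      case False
      then show ?thesis using M_c1_act_outside gB Bgrp_mult_closed[OF gB hB] by (simp add: Dgrp_simps)
    qed
  qed
qed

end

section \<open>Evaluation of tensors at antisymmetric lifts\<close>

definition lift_eval ::
    "nat \<Rightarrow> (nat list \<times> int mat \<times> nat set list \<times> nat set list \<Rightarrow> complex) \<Rightarrow> int mat \<Rightarrow> complex" where
  "lift_eval m F w = (case SOME (t, s). is_pair m w t s of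
    (t, s) \<Rightarrow> matrix_coeff m (\<lambda>\<mu> p. F (\<mu>, t, p)) s)"

abbreviation TVV_sum where
  "TVV_sum m \<equiv> rep_sum (int_partitions m) (TVV m)"

abbreviation swap_sum where
  "swap_sum m F \<equiv> (\<lambda>(\<mu>, p). if \<mu> \<in> int_partitions m then TVV_swap m \<mu> (\<lambda>q. F (\<mu>, q)) p else 0)"

context
  fixes m :: nat
begin

lemma lift_eval_eq:
  assumes "is_pair m w t s"
  shows "lift_eval m F w = matrix_coeff m (\<lambda>\<mu> p. F (\<mu>, t, p)) s"
proof -
  have "(SOME (t, s). is_pair m w t s) = (t, s)"
  proof (rule some_equality)
    fix q assume q: "case q of (t, s) \<Rightarrow> is_pair m w t s"
    obtain u v where uv: "q = (u, v)" by (cases q)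
    then have "is_pair m w u v" using q by simp
    then show "q = (t, s)" using is_pair_unique[OF assms] uv by blast
  qed (simp add: assms)
  then show ?thesis by (simp add: lift_eval_def)
qed

text \<open>Reindexing tabloids by x1 turns the coefficient at x2 s x1^(-1) into the one at s, up to
  the sign of z(x2), which is the pairing of x with w.\<close>

lemma lift_eval_act:
  assumes x: "x \<in> carrier (Bgrp (2 * m))" and w: "w \<in> antisym_lifts (2 * m)"
  shows "lift_eval m (rep_act (TVV_sum m) x F) (abs_conj (2 * m) x w) = c1_sign (2 * m) x w * lift_eval m F w"
proof -
  obtain t s where p: "is_pair m w t s" using is_pair_ex[OF w] by blast
  obtain t' x1 x2 where d: "is_decomp m x t t' x1 x2" by (rule decompE[OF x is_pairD(1)[OF p]])
  let ?s = "perm_of x2 \<circ> s \<circ> pinv (perm_of x1)"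
  have x1: "perm_of x1 permutes {..<m}" and x2: "perm_of x2 permutes {..<m}"
    using d by (auto simp: is_decomp_def intro: perm_of_permutes)
  let ?F = "rep_act (TVV_sum m) x F"
  have "(\<Sum>X\<in>tabloids \<mu>. ?F (\<mu>, t', X, act_tabloid ?s X)) =
      sgn_bit (total_colour x2) * (\<Sum>X\<in>tabloids \<mu>. F (\<mu>, t, X, act_tabloid s X))"
    if \<mu>: "\<mu> \<in> int_partitions m" for \<mu>
  proof -
    have sm: "sum_list \<mu> = m" by (rule int_partitions_sum[OF \<mu>])
    have x1': "perm_of x1 permutes {..<sum_list \<mu>}" and s': "s permutes {..<sum_list \<mu>}"
      using x1 is_pairD(2)[OF p] sm by simp_all
    have "(\<Sum>X\<in>tabloids \<mu>. ?F (\<mu>, t', X, act_tabloid ?s X)) =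
        (\<Sum>X\<in>tabloids \<mu>. ?F (\<mu>, t', act_tabloid (perm_of x1) X, act_tabloid ?s (act_tabloid (perm_of x1) X)))"
      by (rule sum.reindex_bij_betw[OF act_tabloid_bij[OF x1'], symmetric])
    also have "\<dots> = (\<Sum>X\<in>tabloids \<mu>. sgn_bit (total_colour x2) * F (\<mu>, t, X, act_tabloid s X))"
    proof (rule sum.cong[OF refl])
      fix X assume X: "X \<in> tabloids \<mu>"
      have "act_tabloid ?s (act_tabloid (perm_of x1) X) = act_tabloid (perm_of x2) (act_tabloid s X)"
        by (simp add: act_tabloid_comp comp_assoc permutes_inv_o[OF x1])
      then show "?F (\<mu>, t', act_tabloid (perm_of x1) X, act_tabloid ?s (act_tabloid (perm_of x1) X)) =
          sgn_bit (total_colour x2) * F (\<mu>, t, X, act_tabloid s X)"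
        using TVV_act_apply[OF sm x is_pairD(1)[OF p] d X act_tabloid_closed[OF s' X]] \<mu>
        by (simp add: rep_sum_def)
    qed
    finally show ?thesis by (simp add: sum_distrib_left)
  qed
  then have "matrix_coeff m (\<lambda>\<mu> p. ?F (\<mu>, t', p)) ?s =
      sgn_bit (total_colour x2) * matrix_coeff m (\<lambda>\<mu> p. F (\<mu>, t, p)) s"
    unfolding matrix_coeff_def sum_distrib_left[of _ _ "int_partitions m"] by (rule sum.cong[OF refl])
  then show ?thesis
    unfolding lift_eval_eq[OF p] lift_eval_eq[OF is_pair_conj[OF x w p d]] c1_sign_def
      pairing_eq_total_colour[OF p d] .
qed

text \<open>S exchanges the tensor factors and passes to the opposite shuffle; reindexing tabloids
  by s replaces s by its inverse. Those are the coordinates of -w.\<close>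

lemma lift_eval_swap:
  assumes w: "w \<in> antisym_lifts (2 * m)"
  shows "lift_eval m (swap_sum m F) w = lift_eval m F (- w)"
proof -
  obtain t s where p: "is_pair m w t s" using is_pair_ex[OF w] by blast
  note t = is_pairD(1)[OF p] and s = is_pairD(2)[OF p]
  have h: "hat_perm m t \<in> Theta m" by (rule hat_perm(1)[OF t])
  have "(\<Sum>X\<in>tabloids \<mu>. swap_sum m F (\<mu>, t, X, act_tabloid s X)) =
      (\<Sum>X\<in>tabloids \<mu>. F (\<mu>, hat_perm m t, X, act_tabloid (pinv s) X))"
    if \<mu>: "\<mu> \<in> int_partitions m" for \<mu>
  proof -
    have sm: "sum_list \<mu> = m" by (rule int_partitions_sum[OF \<mu>])
    have s': "s permutes {..<sum_list \<mu>}" using s sm by simp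
    have "(\<Sum>X\<in>tabloids \<mu>. F (\<mu>, hat_perm m t, X, act_tabloid (pinv s) X)) =
        (\<Sum>X\<in>tabloids \<mu>. F (\<mu>, hat_perm m t, act_tabloid s X, act_tabloid (pinv s) (act_tabloid s X)))"
      by (rule sum.reindex_bij_betw[OF act_tabloid_bij[OF s'], symmetric])
    also have "\<dots> = (\<Sum>X\<in>tabloids \<mu>. swap_sum m F (\<mu>, t, X, act_tabloid s X))"
    proof (rule sum.cong[OF refl])
      fix X assume X: "X \<in> tabloids \<mu>"
      show "F (\<mu>, hat_perm m t, act_tabloid s X, act_tabloid (pinv s) (act_tabloid s X)) =
          swap_sum m F (\<mu>, t, X, act_tabloid s X)"
        using TVV_swap_apply[OF sm h act_tabloid_closed[OF s' X] X, of "\<lambda>q. F (\<mu>, q)"] \<mu>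
        by (simp add: act_tabloid_inv(1)[OF s'] hat_perm_hat[OF t])
    qed
    finally show ?thesis ..
  qed
  then show ?thesis
    unfolding lift_eval_eq[OF p] lift_eval_eq[OF is_pair_uminus[OF w p]] matrix_coeff_def
    by (rule sum.cong[OF refl])
qed

lemma TVV_sum_space: "F \<in> rep_space (TVV_sum m) \<longleftrightarrow>
    (\<forall>\<mu>\<in>int_partitions m. (\<lambda>p. F (\<mu>, p)) \<in> rep_space (TVV m \<mu>)) \<and>
    (\<forall>\<mu> p. \<mu> \<notin> int_partitions m \<longrightarrow> F (\<mu>, p) = 0)"
  by (simp add: rep_sum_def)

text \<open>For a fixed shuffle t every permutation s comes from some lift, so all matrix
  coefficients of the t-components vanish and \<open>matrix_coeff_inj\<close> applies.\<close>

lemma lift_eval_inj: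
  assumes F: "F \<in> rep_space (TVV_sum m)" and zero: "\<And>w. w \<in> antisym_lifts (2 * m) \<Longrightarrow> lift_eval m F w = 0"
  shows "F = 0"
proof
  fix q :: "nat list \<times> int mat \<times> nat set list \<times> nat set list"
  obtain \<mu> t p where q: "q = (\<mu>, t, p)" by (cases q) auto
  show "F q = 0 q"
  proof (cases "\<mu> \<in> int_partitions m \<and> t \<in> Theta m")
    case True
    have "(\<lambda>p. F (\<kappa>, t, p)) \<in> specht_tensors \<kappa>" if "\<kappa> \<in> int_partitions m" for \<kappa>
    proof -
      have "(\<lambda>p. F (\<kappa>, p)) \<in> rep_space (TVV m \<kappa>)" using F that unfolding TVV_sum_space by blast
      then show ?thesis using True unfolding TVV_space_iff[OF int_partitions_sum[OF that]] by blast
    qed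
    moreover have "matrix_coeff m (\<lambda>\<mu> p. F (\<mu>, t, p)) s = 0" if s: "s permutes {..<m}" for s
    proof -
      have "t \<in> Theta m" using True by simp
      from is_pair_exists_lift[OF this s] obtain w where "w \<in> antisym_lifts (2 * m)" "is_pair m w t s" by blast
      then show ?thesis using zero[of w] by (simp add: lift_eval_eq)
    qed
    ultimately have "(\<lambda>p. F (\<mu>, t, p)) = 0"
      using matrix_coeff_inj[of m "\<lambda>\<mu> p. F (\<mu>, t, p)" \<mu>] True by blast
    from fun_cong[OF this, of p] show ?thesis by (simp add: q)
  next
    case False
    obtain X Y where p: "p = (X, Y)" by (cases p)
    from False show ?thesis using F unfolding q p
      by (cases "\<mu> \<in> int_partitions m") (auto simp: TVV_sum_space TVV_space_iff[OF int_partitions_sum])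
  qed
qed

lemma lift_eval_surj:
  "\<exists>F\<in>rep_space (TVV_sum m). \<forall>w\<in>antisym_lifts (2 * m). lift_eval m F w = f w"
proof -
  \<comment> \<open>\<open>f\<close> is read as a function of the pair (t, s). For a shuffle t the
    choice operator returns the unique lift with that pair; other t are cut off in the definition of
    \<open>F\<close>.\<close>
  have "\<exists>G. (\<forall>\<mu>\<in>int_partitions m. G \<mu> \<in> specht_tensors \<mu>) \<and>
      (\<forall>s. s permutes {..<m} \<longrightarrow> matrix_coeff m G s = f (SOME w. w \<in> antisym_lifts (2 * m) \<and> is_pair m w t s))" for t
    by (rule matrix_coeff_surj)
  then obtain G where G: "\<And>t \<mu>. \<mu> \<in> int_partitions m \<Longrightarrow> G t \<mu> \<in> specht_tensors \<mu>"
    and Gf: "\<And>t s. s permutes {..<m} \<Longrightarrow>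
      matrix_coeff m (G t) s = f (SOME w. w \<in> antisym_lifts (2 * m) \<and> is_pair m w t s)" by metis
  define F where "F = (\<lambda>(\<mu>, t, p). if \<mu> \<in> int_partitions m \<and> t \<in> Theta m then G t \<mu> p else 0)"
  have "F \<in> rep_space (TVV_sum m)"
    using G by (auto simp: TVV_sum_space F_def TVV_space_iff[OF int_partitions_sum])
  moreover have "lift_eval m F w = f w" if w: "w \<in> antisym_lifts (2 * m)" for w
  proof -
    obtain t s where p: "is_pair m w t s" using is_pair_ex[OF w] by blast
    have "(SOME w. w \<in> antisym_lifts (2 * m) \<and> is_pair m w t s) = w"
      by (rule some_equality) (use w p is_pair_lift_unique[OF _ w _ p] in blast)+
    moreover have "matrix_coeff m (\<lambda>\<mu> p. F (\<mu>, t, p)) s = matrix_coeff m (G t) s"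
      unfolding matrix_coeff_def by (intro sum.cong) (use is_pairD(1)[OF p] in \<open>simp_all add: F_def\<close>)
    ultimately show ?thesis using Gf[OF is_pairD(2)[OF p], of t] by (simp add: lift_eval_eq[OF p])
  qed
  ultimately show ?thesis by blast
qed

end

section \<open>The isomorphism\<close>

text \<open>The identity and product laws of R' are pulled back along the injective equivariant map,
  so products of factorizations x t = t' diag(x1, x2) never have to be computed. The natural map
  runs from tensors to M(c1), hence the inverse at the end.\<close>

lemma rep_iso_inverse:
  assumes R: "is_rep G R" and sub: "cfun.subspace (rep_space R')"
    and closed: "\<And>g f. \<lbrakk>g \<in> carrier G; f \<in> rep_space R'\<rbrakk> \<Longrightarrow> rep_act R' g f \<in> rep_space R'"
    and lin: "\<And>g. g \<in> carrier G \<Longrightarrow> linear_map_on (rep_space R') (rep_act R' g)"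
    and bij: "bij_betw \<psi> (rep_space R') (rep_space R)" and lin\<psi>: "linear_map_on (rep_space R') \<psi>"
    and equiv: "\<And>g f. \<lbrakk>g \<in> carrier G; f \<in> rep_space R'\<rbrakk> \<Longrightarrow> \<psi> (rep_act R' g f) = rep_act R g (\<psi> f)"
  shows "rep_iso G R R'"
proof -
  have G: "group G" using R by (simp add: is_rep_def)
  have \<psi>_mem: "\<psi> f \<in> rep_space R" if "f \<in> rep_space R'" for f
    using bij that by (auto simp: bij_betw_def)
  have inj: "f = f'" if "\<psi> f = \<psi> f'" "f \<in> rep_space R'" "f' \<in> rep_space R'" for f f'
    using bij that by (auto simp: bij_betw_def inj_on_def)
  have one: "\<one>\<^bsub>G\<^esub> \<in> carrier G" using G by (simp add: group.is_monoid monoid.one_closed)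
  have R': "is_rep G R'"
    unfolding is_rep_def
  proof (intro conjI ballI)
    fix f assume f: "f \<in> rep_space R'"
    have "\<psi> (rep_act R' \<one>\<^bsub>G\<^esub> f) = \<psi> f"
      using R \<psi>_mem[OF f] by (simp add: equiv one f is_rep_def)
    then show "rep_act R' \<one>\<^bsub>G\<^esub> f = f" by (rule inj[OF _ closed[OF one f] f])
  next
    fix g h f assume g: "g \<in> carrier G" and h: "h \<in> carrier G" and f: "f \<in> rep_space R'"
    have gh: "g \<otimes>\<^bsub>G\<^esub> h \<in> carrier G" using G g h by (simp add: group.is_monoid monoid.m_closed)
    have "\<psi> (rep_act R' (g \<otimes>\<^bsub>G\<^esub> h) f) = \<psi> (rep_act R' g (rep_act R' h f))"
      using R \<psi>_mem[OF f] g h by (simp add: equiv gh g h f closed is_rep_def)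
    then show "rep_act R' (g \<otimes>\<^bsub>G\<^esub> h) f = rep_act R' g (rep_act R' h f)"
      by (rule inj) (intro closed gh g h f)+
  qed (use G sub closed lin in auto)
  define \<phi> where "\<phi> = inv_into (rep_space R') \<psi>"
  have b\<phi>: "bij_betw \<phi> (rep_space R) (rep_space R')"
    unfolding \<phi>_def by (rule bij_betw_inv_into[OF bij])
  have mem: "\<phi> f \<in> rep_space R'" and \<psi>\<phi>: "\<psi> (\<phi> f) = f" if "f \<in> rep_space R" for f
    using b\<phi> that bij_betw_inv_into_right[OF bij that] by (auto simp: bij_betw_def \<phi>_def)
  have subR: "cfun.subspace (rep_space R)" using R by (simp add: is_rep_def)
  have "linear_map_on (rep_space R) \<phi>"
    unfolding linear_map_on_def
  proof (intro conjI ballI allI)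
    fix f f' assume f: "f \<in> rep_space R" "f' \<in> rep_space R"
    have "\<psi> (\<phi> (f + f')) = \<psi> (\<phi> f + \<phi> f')"
      using lin\<psi> mem f \<psi>\<phi> cfun.subspace_add[OF subR f] by (simp add: linear_map_on_def)
    then show "\<phi> (f + f') = \<phi> f + \<phi> f'"
      by (rule inj) (intro mem cfun.subspace_add[OF sub] cfun.subspace_add[OF subR] f)+
  next
    fix c f assume f: "f \<in> rep_space R"
    have "\<psi> (\<phi> (fscale c f)) = \<psi> (fscale c (\<phi> f))"
      using lin\<psi> mem f \<psi>\<phi> cfun.subspace_scale[OF subR f] by (simp add: linear_map_on_def)
    then show "\<phi> (fscale c f) = fscale c (\<phi> f)"
      by (rule inj) (intro mem cfun.subspace_scale[OF sub] cfun.subspace_scale[OF subR] f)+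
  qed
  moreover have "\<phi> (rep_act R g f) = rep_act R' g (\<phi> f)" if g: "g \<in> carrier G" and f: "f \<in> rep_space R" for g f
  proof (rule inj)
    have a: "rep_act R g f \<in> rep_space R" using R g f by (auto simp: is_rep_def)
    show "\<psi> (\<phi> (rep_act R g f)) = \<psi> (rep_act R' g (\<phi> f))"
      by (simp add: \<psi>\<phi> a f equiv[OF g mem[OF f]])
    show "\<phi> (rep_act R g f) \<in> rep_space R'" by (rule mem[OF a])
  qed (rule closed[OF g mem[OF f]])
  ultimately show ?thesis unfolding rep_iso_def using R R' b\<phi> by blast
qed

text \<open>The base point is the lift with a shuffle \<open>t0\<close> and the identity matching;
  an unsigned permutation carries it to the lift with any prescribed pair.\<close>

lemma c1_single_orbit:
  "\<exists>v\<in>c1 (2 * m). c1 (2 * m) = (\<lambda>h. conj_coset (2 * m) h v) ` perm_mats (2 * m)"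
proof -
  let ?n = "2 * m"
  have "{0..<m} \<subseteq> {..<?n}" by auto
  then obtain t0 where t0: "t0 \<in> Theta m" using Theta_ex[of "{0..<m}" m] by auto
  obtain w0 where w0: "w0 \<in> antisym_lifts ?n" and p0: "is_pair m w0 t0 id"
    using is_pair_exists_lift[OF t0 permutes_id] by blast
  have w0B: "w0 \<in> carrier (Bgrp ?n)" by (rule antisym_lifts_closed[OF w0])
  have "c1 ?n \<subseteq> (\<lambda>h. conj_coset ?n h {w0, - w0}) ` perm_mats ?n"
  proof
    fix v assume "v \<in> c1 ?n"
    then obtain w where w: "w \<in> antisym_lifts ?n" "v = {w, - w}" by (auto simp: c1_eq)
    obtain t s where p: "is_pair m w t s" using is_pair_ex[OF w(1)] by blast
    note t = is_pairD(1)[OF p] and s = is_pairD(2)[OF p]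
    \<comment> \<open>Chosen to send t0(i) to t(i) and t0(m + i) to t(m + s(i)), so that colour
      classes and matching are both carried over.\<close>
    define \<sigma> where "\<sigma> = perm_of t \<circ> block_perm m id s \<circ> pinv (perm_of t0)"
    have \<sigma>: "\<sigma> permutes {..<?n}" unfolding \<sigma>_def
      by (intro permutes_compose permutes_inv ThetaD(2)[OF t0] ThetaD(2)[OF t]
          block_perm_permutes permutes_id s)
    define h where "h = signed_perm ?n \<sigma> (\<lambda>_. 0)"
    have hB: "h \<in> carrier (Bgrp ?n)" unfolding h_def by (rule signed_perm_closed[OF \<sigma>])
    have hp: "perm_of h = \<sigma>" unfolding h_def by (rule perm_of_signed_perm[OF \<sigma>])
    have h: "h \<in> perm_mats ?n"
      unfolding perm_mats_iff[OF hB] by (simp add: h_def colour_signed_perm[OF \<sigma>])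
    have lo: "perm_of h (perm_of t0 i) = perm_of t i"
      and hi: "perm_of h (perm_of t0 (m + i)) = perm_of t (m + s i)" if "i < m" for i
      using that permutes_inverses[OF ThetaD(2)[OF t0]] by (simp_all add: hp \<sigma>_def block_perm_def)
    define w' where "w' = h \<otimes>\<^bsub>Bgrp ?n\<^esub> w0 \<otimes>\<^bsub>Bgrp ?n\<^esub> inv\<^bsub>Bgrp ?n\<^esub> h"
    have w': "w' \<in> antisym_lifts ?n" unfolding w'_def by (rule conj_antisym_lifts[OF h w0])
    note pc = perm_of_conj[OF hB w0B, folded w'_def] and cc = colour_conj[OF h w0B, folded w'_def]
    have "is_pair m w' t s" unfolding is_pair_def
    proof (intro conjI allI impI t s)
      fix i assume i: "i < m"
      have i': "perm_of t0 i < ?n" using Theta_less[OF t0] i by simp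
      show "perm_of w' (perm_of t i) = perm_of t (m + s i)"
        using pc[of "perm_of t0 i"] is_pairD(3)[OF p0 i] lo[OF i] hi[OF i] by simp
      show "colour w' (perm_of t i) = 0"
        using cc[OF i'] is_pairD(4)[OF p0 i] lo[OF i] by simp
      have k: "pinv s i < m" using permutes_in_image[OF permutes_inv[OF s], of i] i by simp
      have k': "perm_of t0 (m + pinv s i) < ?n" using Theta_less[OF t0] k by simp
      show "colour w' (perm_of t (m + i)) = 1"
        using cc[OF k'] is_pairD(5)[OF p0 k] hi[OF k] permutes_inverses[OF s] by simp
    qed
    then have "w' = w" by (rule is_pair_lift_unique[OF w' w(1) _ p])
    then have "v = conj_coset ?n h {w0, - w0}" using conj_coset_eq[OF hB w0B] by (simp add: w(2) w'_def)
    then show "v \<in> (\<lambda>h. conj_coset ?n h {w0, - w0}) ` perm_mats ?n" using h by blast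
  qed
  moreover have "conj_coset ?n h {w0, - w0} \<in> c1 ?n" if h: "h \<in> perm_mats ?n" for h
  proof -
    have hB: "h \<in> carrier (Bgrp ?n)" using h by (simp add: perm_mats_def)
    show ?thesis unfolding conj_coset_eq[OF hB w0B] c1_eq using conj_antisym_lifts[OF h w0] by blast
  qed
  moreover have "{w0, - w0} \<in> c1 ?n" using w0 by (auto simp: c1_eq)
  ultimately show ?thesis by blast
qed

lemma lift_eval_add: "lift_eval m (F + G) w = lift_eval m F w + lift_eval m G w"
  by (simp add: lift_eval_def matrix_coeff_def case_prod_unfold sum.distrib)

lemma lift_eval_scale: "lift_eval m (fscale c F) w = c * lift_eval m F w"
  by (simp add: lift_eval_def matrix_coeff_def case_prod_unfold fscale_def sum_distrib_left)

lemma lift_eval_uminus: "lift_eval m (- F) w = - lift_eval m F w"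
  using lift_eval_scale[of m "-1" F w] by simp

definition rho_sum :: "nat \<Rightarrow> (int mat, nat list \<times> int mat \<times> nat set list \<times> nat set list) rep" where
  "rho_sum m = rep_sum (int_partitions m) (\<lambda>\<mu>. rho_split m \<mu> 1)"

context
  fixes m :: nat
begin

lemma rho_sum_act: "rep_act (rho_sum m) = rep_act (TVV_sum m)"
  by (auto simp: rho_sum_def rep_sum_def rho_split_def fun_eq_iff)

lemma rho_sum_space:
  "F \<in> rep_space (rho_sum m) \<longleftrightarrow> F \<in> rep_space (TVV_sum m) \<and> swap_sum m F = - F"
proof -
  have "swap_sum m F = - F \<longleftrightarrow>
      (\<forall>\<mu>\<in>int_partitions m. TVV_swap m \<mu> (\<lambda>p. F (\<mu>, p)) = fscale (-1) (\<lambda>p. F (\<mu>, p)))"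
    if "\<And>\<mu> p. \<mu> \<notin> int_partitions m \<Longrightarrow> F (\<mu>, p) = 0"
    using that by (auto simp: fun_eq_iff fscale_def)
  then show ?thesis
    by (auto simp: rho_sum_def rep_sum_def rho_split_def sgn_bit_def)
qed

lemma TVV_sum_subspace: "cfun.subspace (rep_space (TVV_sum m))"
proof -
  have "cfun.subspace (rep_space (TVV m \<mu>))" for \<mu> by (simp add: TVV_def)
  note S = this[unfolded cfun.subspace_def zero_fun_def plus_fun_def fscale_def]
  show ?thesis
    by (rule cfun.subspaceI) (use S in \<open>simp_all add: TVV_sum_space zero_fun_def plus_fun_def fscale_def\<close>)
qed

lemma TVV_sum_act_linear: "linear_map_on V (rep_act (TVV_sum m) g)"
proof -
  have "linear_map_on UNIV (rep_act (TVV m \<mu>) g)" for \<mu>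
    unfolding TVV_def rep.simps by (rule linear_lin_ext)
  then have "rep_act (TVV m \<mu>) g (f + f') = rep_act (TVV m \<mu>) g f + rep_act (TVV m \<mu>) g f'"
    "rep_act (TVV m \<mu>) g (fscale c f) = fscale c (rep_act (TVV m \<mu>) g f)" for \<mu> f f' c
    by (simp_all add: linear_map_on_def)
  then show ?thesis
    unfolding linear_map_on_def rep_sum_def
    by (auto simp: fun_eq_iff fscale_def plus_fun_def)
qed

lemma swap_sum_linear:
  "swap_sum m (F + G) = swap_sum m F + swap_sum m G" "swap_sum m (fscale c F) = fscale c (swap_sum m F)"
proof -
  have "linear_map_on UNIV (TVV_swap m \<mu>)" for \<mu>
    unfolding TVV_swap_def by (rule linear_lin_ext)
  then have "TVV_swap m \<mu> (f + f') = TVV_swap m \<mu> f + TVV_swap m \<mu> f'"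
    "TVV_swap m \<mu> (fscale c f) = fscale c (TVV_swap m \<mu> f)" for \<mu> f f' c
    by (simp_all add: linear_map_on_def)
  then show "swap_sum m (F + G) = swap_sum m F + swap_sum m G" "swap_sum m (fscale c F) = fscale c (swap_sum m F)"
    by (auto simp: fun_eq_iff fscale_def plus_fun_def)
qed

lemma rho_sum_subspace: "cfun.subspace (rep_space (rho_sum m))"
  unfolding cfun.subspace_def
proof (intro conjI ballI allI)
  have "swap_sum m (fscale 0 0) = fscale 0 (swap_sum m 0)" by (rule swap_sum_linear(2))
  moreover have "fscale 0 F = 0" for F :: "'x \<Rightarrow> complex" by (auto simp: fscale_def)
  ultimately have "swap_sum m 0 = 0" by metis
  then show "0 \<in> rep_space (rho_sum m)"
    using cfun.subspace_0[OF TVV_sum_subspace] by (simp add: rho_sum_space)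
next
  fix F G assume "F \<in> rep_space (rho_sum m)" "G \<in> rep_space (rho_sum m)"
  then show "F + G \<in> rep_space (rho_sum m)"
    using cfun.subspace_add[OF TVV_sum_subspace] unfolding rho_sum_space swap_sum_linear
    by (simp add: cfun.scale_right_distrib)
next
  fix c F assume "F \<in> rep_space (rho_sum m)"
  then show "fscale c F \<in> rep_space (rho_sum m)"
    using cfun.subspace_scale[OF TVV_sum_subspace] unfolding rho_sum_space swap_sum_linear by simp
qed

lemma rho_sum_closed:
  assumes g: "g \<in> carrier (Dgrp (2 * m))" and F: "F \<in> rep_space (rho_sum m)"
  shows "rep_act (rho_sum m) g F \<in> rep_space (rho_sum m)"
  unfolding rho_sum_def rep_sum_def rep.simps mem_Collect_eq
proof (intro conjI ballI allI impI)
  fix \<mu> assume \<mu>: "\<mu> \<in> int_partitions m"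
  note sm = int_partitions_sum[OF \<mu>]
  have gB: "g \<in> carrier (Bgrp (2 * m))" using g by (simp add: Dgrp_simps)
  let ?f = "\<lambda>p. F (\<mu>, p)"
  have f: "?f \<in> rep_space (TVV m \<mu>)" "TVV_swap m \<mu> ?f = fscale (sgn_bit 1) ?f"
    using F \<mu> by (simp_all add: rho_sum_def rep_sum_def rho_split_def)
  have "linear_map_on UNIV (rep_act (TVV m \<mu>) g)"
    unfolding TVV_def rep.simps by (rule linear_lin_ext)
  then have "rep_act (TVV m \<mu>) g (fscale c ?f) = fscale c (rep_act (TVV m \<mu>) g ?f)" for c
    by (simp add: linear_map_on_def)
  then have "rep_act (TVV m \<mu>) g ?f \<in> rep_space (rho_split m \<mu> 1)"
    using TVV_act_closed[OF sm gB f(1)] TVV_swap_act[OF sm g] f(2) by (simp add: rho_split_def)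
  then show "(\<lambda>i. (case (\<mu>, i) of (\<mu>, i) \<Rightarrow> if \<mu> \<in> int_partitions m
      then rep_act (rho_split m \<mu> 1) g (\<lambda>i. F (\<mu>, i)) i else 0)) \<in> rep_space (rho_split m \<mu> 1)"
    using \<mu> by (simp add: rho_split_def)
qed simp

lemma lift_eval_antisym:
  assumes "F \<in> rep_space (rho_sum m)" "w \<in> antisym_lifts (2 * m)"
  shows "lift_eval m F (- w) = - lift_eval m F w"
proof -
  have "swap_sum m F = - F" using assms(1) by (simp add: rho_sum_space)
  then show ?thesis using lift_eval_swap[OF assms(2), of F] by (simp add: lift_eval_uminus)
qed

text \<open>On the -1 eigenspace the evaluation is odd in the lift, and so is the sign of the colour
  at position 0; their product is a function on cosets.\<close>

definition descend ::
    "(nat list \<times> int mat \<times> nat set list \<times> nat set list \<Rightarrow> complex) \<Rightarrow> int mat set \<Rightarrow> complex" where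
  "descend F v = (if v \<in> c1 (2 * m)
     then sgn_bit (colour (lift_of v) 0) * lift_eval m F (lift_of v) else 0)"

context
  assumes m: "0 < m"
begin

lemma descend_eq:
  assumes F: "F \<in> rep_space (rho_sum m)" and w: "w \<in> antisym_lifts (2 * m)"
  shows "descend F {w, - w} = sgn_bit (colour w 0) * lift_eval m F w"
proof -
  have "{w, - w} \<in> c1 (2 * m)" using w by (auto simp: c1_eq)
  then have d: "descend F {w, - w} =
      sgn_bit (colour (lift_of {w, - w}) 0) * lift_eval m F (lift_of {w, - w})"
    by (simp add: descend_def)
  from lift_of_mem[OF w] show ?thesis
  proof
    assume "lift_of {w, - w} = - w"
    then show ?thesis using d lift_eval_antisym[OF F w] m
      by (simp add: colour_uminus_0[OF _ antisym_lifts_closed[OF w]])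
  qed (use d in simp)
qed

lemma descend_linear: "linear_map_on V descend"
  unfolding linear_map_on_def
  by (auto simp: fun_eq_iff descend_def lift_eval_add lift_eval_scale[unfolded fscale_def] fscale_def algebra_simps)

text \<open>A function on cosets times the colour sign prescribes odd values on lifts, which some F
  in the full sum attains. Oddness makes S F + F evaluate to zero at every lift, so injectivity on
  the full sum puts F into the -1 eigenspace.\<close>

lemma descend_bij: "bij_betw descend (rep_space (rho_sum m)) (rep_space (M_c1 (2 * m)))"
  unfolding bij_betw_def
proof
  have n: "0 < 2 * m" using m by simp
  have zero: "F = 0" if F: "F \<in> rep_space (rho_sum m)" and d: "descend F = 0" for F
  proof (rule lift_eval_inj[of F m])
    show "F \<in> rep_space (TVV_sum m)" using F by (simp add: rho_sum_space)
    fix w assume w: "w \<in> antisym_lifts (2 * m)"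
    show "lift_eval m F w = 0" using descend_eq[OF F w] d by simp
  qed
  show "inj_on descend (rep_space (rho_sum m))"
  proof (rule inj_onI)
    fix F G assume F: "F \<in> rep_space (rho_sum m)" and G: "G \<in> rep_space (rho_sum m)" and eq: "descend F = descend G"
    have add: "descend (f + f') = descend f + descend f'" for f f'
      using descend_linear[of UNIV] by (simp add: linear_map_on_def)
    have "descend (F - G) + descend G = 0 + descend G" using add[of "F - G" G] by (simp add: eq)
    then have "descend (F - G) = 0" by (simp only: add_right_cancel)
    then have "F - G = 0" using cfun.subspace_diff[OF rho_sum_subspace F G] by (intro zero)
    then show "F = G" by simp
  qed
  show "descend ` rep_space (rho_sum m) = rep_space (M_c1 (2 * m))"
  proof (intro equalityI subsetI)
    fix f assume "f \<in> descend ` rep_space (rho_sum m)"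
    then show "f \<in> rep_space (M_c1 (2 * m))" by (auto simp: M_c1_space[OF n] descend_def)
  next
    fix f assume f: "f \<in> rep_space (M_c1 (2 * m))"
    obtain F where F: "F \<in> rep_space (TVV_sum m)"
      and Ff: "\<And>w. w \<in> antisym_lifts (2 * m) \<Longrightarrow> lift_eval m F w = sgn_bit (colour w 0) * f {w, - w}"
      using lift_eval_surj[of m "\<lambda>w. sgn_bit (colour w 0) * f {w, - w}"] by blast
    have S: "swap_sum m F + F \<in> rep_space (TVV_sum m)"
    proof (rule cfun.subspace_add[OF TVV_sum_subspace _ F])
      show "swap_sum m F \<in> rep_space (TVV_sum m)"
        using F TVV_swap_closed[OF int_partitions_sum] by (simp add: TVV_sum_space)
    qed
    have "swap_sum m F + F = 0"
    proof (rule lift_eval_inj[OF S])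
      fix w assume w: "w \<in> antisym_lifts (2 * m)"
      note wB = antisym_lifts_closed[OF w]
      have "lift_eval m F (- w) = - (sgn_bit (colour w 0) * f {w, - w})"
        using Ff[OF uminus_antisym_lifts[OF w]]
        by (simp add: uminus_uminus_Bgrp[OF wB] colour_uminus_0[OF n wB] insert_commute)
      then show "lift_eval m (swap_sum m F + F) w = 0"
        by (simp add: lift_eval_add lift_eval_swap[OF w] Ff[OF w])
    qed
    then have "swap_sum m F = - F" by (simp only: eq_neg_iff_add_eq_0)
    then have Fm: "F \<in> rep_space (rho_sum m)" using F by (simp add: rho_sum_space)
    have "descend F = f"
    proof
      fix v show "descend F v = f v"
      proof (cases "v \<in> c1 (2 * m)")
        case True
        then obtain w where w: "w \<in> antisym_lifts (2 * m)" "v = {w, - w}" by (auto simp: c1_eq)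
        show ?thesis unfolding w(2) descend_eq[OF Fm w(1)] Ff[OF w(1)] by simp
      next
        case False
        then show ?thesis using f by (simp add: descend_def M_c1_space[OF n])
      qed
    qed
    then show "f \<in> descend ` rep_space (rho_sum m)" using Fm by blast
  qed
qed

text \<open>At the conjugate of w by |g| both sides reduce to the colour sign of that conjugate,
  \<open>c1_sign\<close> and the evaluation at w; on the right the colour sign of w appears
  squared.\<close>

lemma descend_equivariant:
  assumes g: "g \<in> carrier (Dgrp (2 * m))" and F: "F \<in> rep_space (rho_sum m)"
  shows "descend (rep_act (rho_sum m) g F) = rep_act (M_c1 (2 * m)) g (descend F)"
proof
  have n: "0 < 2 * m" using m by simp
  have gB: "g \<in> carrier (Bgrp (2 * m))" using g by (simp add: Dgrp_simps)
  fix v show "descend (rep_act (rho_sum m) g F) v = rep_act (M_c1 (2 * m)) g (descend F) v"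
  proof (cases "v \<in> c1 (2 * m)")
    case True
    obtain w where w: "w \<in> antisym_lifts (2 * m)" and v: "v = {abs_conj (2 * m) g w, - abs_conj (2 * m) g w}"
      by (rule c1_conj_surj[OF n gB True])
    show ?thesis
      unfolding v M_c1_act_apply[OF n g w] descend_eq[OF rho_sum_closed[OF g F] abs_conj(1)[OF gB w]]
        descend_eq[OF F w]
      unfolding rho_sum_act lift_eval_act[OF gB w]
      by (simp add: mult_ac)
  next
    case False
    then show ?thesis by (simp add: M_c1_act_outside[OF n gB] descend_def)
  qed
qed

end

end

theorem theorem4p3:
  fixes m n :: nat
  assumes "m \<ge> 1" and "n = 2 * m"
  shows "(\<exists>v\<in>c1 n. c1 n = (\<lambda>h. conj_coset n h v) ` perm_mats n) \<and>
    rep_iso (Dgrp n) (M_c1 n) (rep_sum (int_partitions m) (\<lambda>\<mu>. rho_split m \<mu> 1))"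
proof
  have m: "0 < m" using assms(1) by simp
  show "\<exists>v\<in>c1 n. c1 n = (\<lambda>h. conj_coset n h v) ` perm_mats n"
    unfolding assms(2) by (rule c1_single_orbit)
  have "rep_iso (Dgrp (2 * m)) (M_c1 (2 * m)) (rho_sum m)"
  proof (rule rep_iso_inverse)
    show "is_rep (Dgrp (2 * m)) (M_c1 (2 * m))" by (rule M_c1_is_rep) (use m in simp)
    show "linear_map_on (rep_space (rho_sum m)) (rep_act (rho_sum m) g)" for g
      unfolding rho_sum_act by (rule TVV_sum_act_linear)
  qed (fact rho_sum_subspace rho_sum_closed descend_bij[OF m] descend_linear[OF m] descend_equivariant[OF m])+
  then show "rep_iso (Dgrp n) (M_c1 n) (rep_sum (int_partitions m) (\<lambda>\<mu>. rho_split m \<mu> 1))"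
    unfolding assms(2) rho_sum_def .
qed

end
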